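(* Fix a positive integer $r$. (MaxCut) If $\frac{r(r+1)}{2}+r\le n$, then there is a set of cost matrices $C\in\mathbf{S}^n$ with positive measure for which the SDP "minimize $\operatorname{tr}(CX)$ subject to $\operatorname{diag}(X)=1$ (all diagonal entries equal to $1$), $X\succeq0$, $X\in\mathbf{S}^n$" admits a unique solution, of rank $1$, and is simple, but the Burer–Monteiro approach with factor size $r$ fails for it. (ProductSDP) Let $D$ be a positive integer and let $S_1,\dots,S_m$ be a partition of $\{1,\dots,D\}$. If $\frac{r(r+1)}{2}+r\le m$, then there is a set of cost matrices $C\in\mathbf{S}^D$ with positive measure for which the SDP "minimize $\operatorname{tr}(CX)$ subject to $\sum_{k\in S_i}X_{kk}=1$, $i=1,\dots,m$, $X\succeq0$, $X\in\mathbf{S}^D$" admits a unique solution, of rank $1$, and is simple, but the Burer–Monteiro approach with factor size $r$ fails for it. (OrthogonalCut) Let $S$ be a positive integer and $d\in\{1,2,3\}$. If $\frac{r(r+1)}{2}+rd\le m=\frac{Sd(d+1)}{2}$, then there is a set of cost matrices $C\in\mathbf{S}^{Sd}$ with positive measure for which the SDP "minimize $\operatorname{tr}(CX)$ subject to $\mathrm{Block}_s(X)=I_d$, $s=1,\dots,S$, $X\succeq0$, $X\in\mathbf{S}^{Sd}$" admits a unique solution, of rank $d$, and is simple, but the Burer–Monteiro approach with factor size $r$ fails for it.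
   Context: $\mathbf{S}^n$ is the space of real symmetric $n\times n$ matrices with the trace inner product $\langle X,Y\rangle=\operatorname{tr}(X^\top Y)$; measure is Lebesgue measure. $\mathrm{Block}_s(X)$ is the $s$-th diagonal $d\times d$ block of $X\in\mathbf{S}^{Sd}$; the constraint $\mathrm{Block}_s(X)=I_d$ counts as $d(d+1)/2$ scalar constraints, so that $m=\frac{Sd(d+1)}{2}$ is the total number of constraints of OrthogonalCut. Consider a standard form SDP (P): minimize $\langle C,X\rangle$ subject to $\mathcal{A}X=b$, $X\succeq0$, with variable $X\in\mathbf{S}^n$, where $[\mathcal{A}X]_i=\langle A_i,X\rangle$ for $i=1,\dots,m$ with fixed $A_i\in\mathbf{S}^n$. Its dual (D) is: maximize $\langle b,y\rangle$ subject to $C-\mathcal{A}^*y\succeq0$, with variable $y\in\mathbb{R}^m$, where $\mathcal{A}^*$ is the adjoint of $\mathcal{A}$, i.e. $\mathcal{A}^*y=\sum_i y_iA_i$. "Solution" means optimal solution. - Strong duality: a primal-dual solution pair exists, and for any solution pair $(X_\star,y_\star)$ of (P) and (D), $\operatorname{tr}(CX_\star)=b^\top y_\star$. - Surjective constraint map: $\mathcal{A}:\mathbf{S}^n\to\mathbb{R}^m$ is surjective, equivalently the matrices $A_i$ are linearly independent. - Strict complementarity: there is a solution pair $(X_\star,y_\star)$ of (P) and (D) with $\operatorname{rank}(X_\star)+\operatorname{rank}(C-\mathcal{A}^*y_\star)=n$. - (P) is simple if it satisfies strong duality, has a surjective constraint map, satisfies strict complementarity, and both (P) and (D) have unique solutions.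 Burer–Monteiro (BM) approach with factor size $r$: the problem of minimizing $f(F)=\operatorname{tr}(CFF^\top)$ over $F\in\mathbb{R}^{n\times r}$ subject to $\mathcal{A}(FF^\top)=b$. For the three SDP classes above, the feasible set $\mathcal{M}_r=\{F\in\mathbb{R}^{n\times r}:\mathcal{A}(FF^\top)=b\}$ is regarded as a Riemannian manifold equipped with the trace inner product of $\mathbb{R}^{n\times r}$. A point $F\in\mathcal{M}_r$ is a second order stationary point (SOSP) if the Riemannian gradient of $f$ on $\mathcal{M}_r$ at $F$ is zero and the Riemannian Hessian of $f$ at $F$ is a positive semidefinite symmetric linear map on the tangent space $T_F\mathcal{M}_r$. The BM approach fails for (P) if the BM problem has an SOSP that is not globally optimal (it succeeds if every SOSP $F$ is globally optimal, and hence $FF^\top$ is optimal for (P)).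
   Formalization: In OrthogonalCut the hypothesis r ≥ d is added: for r < d no F satisfies the block constraints Block_s(FFᵀ)=I_d, so the Burer–Monteiro problem has no feasible point and cannot fail (e.g. d=2, r=1, S=1). *)

theory Defs
  imports "HOL-Analysis.Analysis" "HOL-Library.Uprod"
begin

section \<open>The Euclidean space of real symmetric matrices\<close>

text \<open>
  The space of symmetric matrices is made a type of its own, of class
  \<^class>\<open>euclidean_space\<close>, so that \<^const>\<open>lebesgue\<close> on it is Lebesgue measure of
  dimension \<open>n(n+1)/2\<close> (symmetric matrices form a null set in the space of all matrices).
\<close>

typedef ('n::finite) symmat = "{A :: real^'n^'n. transpose A = A}"
  morphisms mat_of_sym Symmat
  by (rule exI[of _ 0]) (simp add: transpose_def vec_eq_iff)

lemma transpose_mat_of_sym [simp]: "transpose (mat_of_sym X) = mat_of_sym X"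
  using mat_of_sym by auto

lemma mat_of_sym_Symmat: "transpose A = A \<Longrightarrow> mat_of_sym (Symmat A) = A"
  by (simp add: Symmat_inverse)

lemma subspace_symmetric: "subspace {A :: real^'n^'n. transpose A = A}"
  by (auto simp: subspace_def transpose_def vec_eq_iff)

instantiation symmat :: (finite) real_vector
begin

definition zero_symmat :: "'a symmat" where "0 = Symmat 0"

definition plus_symmat :: "'a symmat \<Rightarrow> 'a symmat \<Rightarrow> 'a symmat"
  where "X + Y = Symmat (mat_of_sym X + mat_of_sym Y)"

definition uminus_symmat :: "'a symmat \<Rightarrow> 'a symmat"
  where "- X = Symmat (- mat_of_sym X)"

definition minus_symmat :: "'a symmat \<Rightarrow> 'a symmat \<Rightarrow> 'a symmat"
  where "X - Y = Symmat (mat_of_sym X - mat_of_sym Y)"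

definition scaleR_symmat :: "real \<Rightarrow> 'a symmat \<Rightarrow> 'a symmat"
  where "c *\<^sub>R X = Symmat (c *\<^sub>R mat_of_sym X)"

lemma mat_of_sym_zero [simp]: "mat_of_sym (0 :: 'a symmat) = 0"
  unfolding zero_symmat_def
  by (rule mat_of_sym_Symmat) (simp add: transpose_def vec_eq_iff)

lemma mat_of_sym_add [simp]:
  fixes X Y :: "'a symmat"
  shows "mat_of_sym (X + Y) = mat_of_sym X + mat_of_sym Y"
  unfolding plus_symmat_def
  using subspace_add[OF subspace_symmetric mat_of_sym mat_of_sym, of X Y]
  by (simp add: Symmat_inverse)

lemma mat_of_sym_minus [simp]:
  fixes X :: "'a symmat"
  shows "mat_of_sym (- X) = - mat_of_sym X"
  unfolding uminus_symmat_def
  using subspace_neg[OF subspace_symmetric mat_of_sym, of X]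
  by (simp add: Symmat_inverse)

lemma mat_of_sym_diff [simp]:
  fixes X Y :: "'a symmat"
  shows "mat_of_sym (X - Y) = mat_of_sym X - mat_of_sym Y"
  unfolding minus_symmat_def
  using subspace_diff[OF subspace_symmetric mat_of_sym mat_of_sym, of X Y]
  by (simp add: Symmat_inverse)

lemma mat_of_sym_scaleR [simp]:
  fixes X :: "'a symmat"
  shows "mat_of_sym (c *\<^sub>R X) = c *\<^sub>R mat_of_sym X"
  unfolding scaleR_symmat_def
  using subspace_scale[OF subspace_symmetric mat_of_sym, of c X]
  by (simp add: Symmat_inverse)

instance
  by standard (simp_all add: mat_of_sym_inject[symmetric] algebra_simps)

end

instantiation symmat :: (finite) real_normed_vector
begin

definition norm_symmat :: "'a symmat \<Rightarrow> real"
  where "norm_symmat X = norm (mat_of_sym X)"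

definition dist_symmat :: "'a symmat \<Rightarrow> 'a symmat \<Rightarrow> real"
  where "dist_symmat X Y = norm (X - Y)"

definition sgn_symmat :: "'a symmat \<Rightarrow> 'a symmat"
  where "sgn_symmat X = X /\<^sub>R norm X"

definition uniformity_symmat :: "('a symmat \<times> 'a symmat) filter"
  where [code del]: "uniformity = (INF e\<in>{0<..}. principal {(X :: 'a symmat, Y). dist X Y < e})"

definition open_symmat :: "'a symmat set \<Rightarrow> bool"
  where [code del]: "open_symmat U \<longleftrightarrow>
    (\<forall>X\<in>U. \<forall>\<^sub>F (X', Y) in uniformity. X' = X \<longrightarrow> Y \<in> U)"

instance
proof
  fix X Y :: "'a symmat" and c :: real and U :: "'a symmat set"
  show "dist X Y = norm (X - Y)" by (rule dist_symmat_def)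
  show "sgn X = X /\<^sub>R norm X" by (rule sgn_symmat_def)
  show "uniformity = (INF e\<in>{0<..}. principal {(X :: 'a symmat, Y). dist X Y < e})"
    by (rule uniformity_symmat_def)
  show "open U \<longleftrightarrow> (\<forall>X\<in>U. \<forall>\<^sub>F (X', Y) in uniformity. X' = X \<longrightarrow> Y \<in> U)"
    by (rule open_symmat_def)
  show "norm X = 0 \<longleftrightarrow> X = 0"
    by (simp add: norm_symmat_def mat_of_sym_inject[symmetric])
  show "norm (X + Y) \<le> norm X + norm Y" "norm (c *\<^sub>R X) = \<bar>c\<bar> * norm X"
    by (simp_all add: norm_symmat_def norm_triangle_ineq)
qed

end

text \<open>
  The inner product of \<^typ>\<open>real^'n^'n\<close> is the trace inner product; see
  \<open>inner_matrix_eq_trace\<close> below.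
\<close>

instantiation symmat :: (finite) real_inner
begin

definition inner_symmat :: "'a symmat \<Rightarrow> 'a symmat \<Rightarrow> real"
  where "inner_symmat X Y = mat_of_sym X \<bullet> mat_of_sym Y"

instance
proof
  fix X Y Z :: "'a symmat" and c :: real
  show "X \<bullet> Y = Y \<bullet> X"
    unfolding inner_symmat_def by (rule inner_commute)
  show "(X + Y) \<bullet> Z = X \<bullet> Z + Y \<bullet> Z" "(c *\<^sub>R X) \<bullet> Y = c * (X \<bullet> Y)"
    "0 \<le> X \<bullet> X" "norm X = sqrt (X \<bullet> X)"
    by (simp_all add: inner_symmat_def norm_symmat_def inner_add_left norm_eq_sqrt_inner)
  show "X \<bullet> X = 0 \<longleftrightarrow> X = 0"
    by (simp add: inner_symmat_def mat_of_sym_inject[symmetric])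
qed

end

lemma orthonormal_basis_symmat:
  "\<exists>B :: 'n::finite symmat set. finite B \<and> B \<noteq> {} \<and>
     (\<forall>u\<in>B. \<forall>v\<in>B. u \<bullet> v = (if u = v then 1 else 0)) \<and> (\<forall>X. (\<forall>u\<in>B. X \<bullet> u = 0) \<longleftrightarrow> X = 0)"
proof -
  let ?S = "{A :: real^'n^'n. transpose A = A}"
  obtain B where B: "B \<subseteq> ?S" "pairwise orthogonal B" "\<And>x. x \<in> B \<Longrightarrow> norm x = 1"
    "independent B" "card B = dim ?S" "span B = ?S"
    by (rule orthonormal_basis_subspace[OF subspace_symmetric]) blast
  have fin: "finite B" using B(4) by (rule independent_imp_finite)
  have rep: "mat_of_sym (Symmat b) = b" if "b \<in> B" for b
    using that B(1) by (auto intro: mat_of_sym_Symmat)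
  have zero: "X = 0" if X: "\<And>b. b \<in> B \<Longrightarrow> X \<bullet> Symmat b = 0" for X :: "'n symmat"
  proof -
    have "orthogonal (mat_of_sym X) b" if "b \<in> B" for b
      using X[OF that] rep[OF that] by (simp add: inner_symmat_def orthogonal_def)
    moreover have "mat_of_sym X \<in> span B" using B(6) mat_of_sym by auto
    ultimately have "orthogonal (mat_of_sym X) (mat_of_sym X)"
      by (metis orthogonal_to_span)
    then show ?thesis by (simp add: orthogonal_def mat_of_sym_inject[symmetric])
  qed
  have ne: "B \<noteq> {}"
  proof
    assume "B = {}"
    then have "transpose (A :: real^'n^'n) = A \<longrightarrow> A = 0" for A using B(6) by auto
    from this[of "mat 1"] have "(mat 1 :: real^'n^'n) = 0" by (simp add: transpose_mat)
    then have "(mat 1 :: real^'n^'n) $ undefined $ undefined = 0" by simp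
    then show False by (simp add: mat_def)
  qed
  have orth: "Symmat b \<bullet> Symmat c = (if Symmat b = Symmat c then 1 else 0)"
    if "b \<in> B" "c \<in> B" for b c
  proof (cases "b = c")
    case True
    then show ?thesis
      using B(3)[OF that(1)] by (simp add: inner_symmat_def rep[OF that(1)] rep[OF that(2)] norm_eq_1)
  next
    case False
    then have "b \<bullet> c = 0" using pairwiseD[OF B(2) that] by (simp add: orthogonal_def)
    moreover have "Symmat b \<noteq> Symmat c" using False rep[OF that(1)] rep[OF that(2)] by metis
    ultimately show ?thesis
      by (simp add: inner_symmat_def rep[OF that(1)] rep[OF that(2)])
  qed
  show ?thesis
  proof (intro exI[of _ "Symmat ` B"] conjI allI)
    show "(\<forall>u\<in>Symmat ` B. X \<bullet> u = 0) \<longleftrightarrow> X = 0" for X using zero by auto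
  qed (use fin ne orth in auto)
qed

text \<open>Lebesgue measure does not depend on the orthonormal basis chosen here.\<close>

instantiation symmat :: (finite) euclidean_space
begin

definition Basis_symmat :: "'a symmat set" where
  "Basis = (SOME B :: 'a symmat set. finite B \<and> B \<noteq> {} \<and>
     (\<forall>u\<in>B. \<forall>v\<in>B. u \<bullet> v = (if u = v then 1 else 0)) \<and> (\<forall>X. (\<forall>u\<in>B. X \<bullet> u = 0) \<longleftrightarrow> X = 0))"

instance
proof
  have B: "finite (Basis :: 'a symmat set) \<and> (Basis :: 'a symmat set) \<noteq> {} \<and>
     (\<forall>u\<in>(Basis :: 'a symmat set). \<forall>v\<in>Basis. u \<bullet> v = (if u = v then 1 else 0)) \<and>
     (\<forall>X :: 'a symmat. (\<forall>u\<in>Basis. X \<bullet> u = 0) \<longleftrightarrow> X = 0)"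
    unfolding Basis_symmat_def by (rule someI_ex[OF orthonormal_basis_symmat])
  show "(Basis :: 'a symmat set) \<noteq> {}" "finite (Basis :: 'a symmat set)"
    using B by simp_all
  show "u \<bullet> v = (if u = v then 1 else 0)" if "u \<in> Basis" "v \<in> Basis" for u v :: "'a symmat"
    using B that by simp
  show "(\<forall>u\<in>Basis. X \<bullet> u = 0) \<longleftrightarrow> X = 0" for X :: "'a symmat"
    using B by simp
qed

end

lemma inner_matrix_eq_trace:
  fixes A B :: "real^'n^'m"
  shows "A \<bullet> B = trace (transpose A ** B)"
proof -
  have "A \<bullet> B = (\<Sum>i\<in>UNIV. \<Sum>j\<in>UNIV. A $ i $ j * B $ i $ j)" by (simp add: inner_vec_def)
  also have "\<dots> = (\<Sum>j\<in>UNIV. \<Sum>i\<in>UNIV. A $ i $ j * B $ i $ j)" by (rule sum.swap)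
  also have "\<dots> = trace (transpose A ** B)"
    by (simp add: trace_def matrix_matrix_mult_def transpose_def)
  finally show ?thesis .
qed

lemma inner_symmat_eq_trace: "X \<bullet> Y = trace (transpose (mat_of_sym X) ** mat_of_sym Y)"
  by (simp only: inner_symmat_def inner_matrix_eq_trace)

definition psd :: "'n::finite symmat \<Rightarrow> bool"
  where "psd X \<longleftrightarrow> (\<forall>v. 0 \<le> v \<bullet> (mat_of_sym X *v v))"


section \<open>Standard form semidefinite programs\<close>

text \<open>
  A program is given by the cost \<open>C\<close>, the constraint matrices \<open>A\<close> (indexed by a finite type
  with \<open>m\<close> elements) and the right-hand side \<open>b\<close>.
\<close>

definition constraint_map :: "('m::finite \<Rightarrow> 'n::finite symmat) \<Rightarrow> 'n symmat \<Rightarrow> real^'m"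
  where "constraint_map A X = (\<chi> i. A i \<bullet> X)"

definition constraint_adjoint :: "('m::finite \<Rightarrow> 'n::finite symmat) \<Rightarrow> real^'m \<Rightarrow> 'n symmat"
  where "constraint_adjoint A y = (\<Sum>i\<in>UNIV. y $ i *\<^sub>R A i)"

lemma constraint_adjoint: "constraint_map A X \<bullet> y = X \<bullet> constraint_adjoint A y"
  by (simp add: constraint_map_def constraint_adjoint_def inner_vec_def inner_sum_right
      inner_commute mult.commute)

definition primal_feasible :: "('m::finite \<Rightarrow> 'n::finite symmat) \<Rightarrow> real^'m \<Rightarrow> 'n symmat \<Rightarrow> bool"
  where "primal_feasible A b X \<longleftrightarrow> constraint_map A X = b \<and> psd X"

definition primal_solution ::
    "'n::finite symmat \<Rightarrow> ('m::finite \<Rightarrow> 'n symmat) \<Rightarrow> real^'m \<Rightarrow> 'n symmat \<Rightarrow> bool"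
  where "primal_solution C A b X \<longleftrightarrow>
    primal_feasible A b X \<and> (\<forall>X'. primal_feasible A b X' \<longrightarrow> C \<bullet> X \<le> C \<bullet> X')"

definition dual_feasible :: "'n::finite symmat \<Rightarrow> ('m::finite \<Rightarrow> 'n symmat) \<Rightarrow> real^'m \<Rightarrow> bool"
  where "dual_feasible C A y \<longleftrightarrow> psd (C - constraint_adjoint A y)"

definition dual_solution ::
    "'n::finite symmat \<Rightarrow> ('m::finite \<Rightarrow> 'n symmat) \<Rightarrow> real^'m \<Rightarrow> real^'m \<Rightarrow> bool"
  where "dual_solution C A b y \<longleftrightarrow>
    dual_feasible C A y \<and> (\<forall>y'. dual_feasible C A y' \<longrightarrow> b \<bullet> y' \<le> b \<bullet> y)"

definition strong_duality ::
    "'n::finite symmat \<Rightarrow> ('m::finite \<Rightarrow> 'n symmat) \<Rightarrow> real^'m \<Rightarrow> bool"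
  where "strong_duality C A b \<longleftrightarrow>
    (\<exists>X y. primal_solution C A b X \<and> dual_solution C A b y) \<and>
    (\<forall>X y. primal_solution C A b X \<longrightarrow> dual_solution C A b y \<longrightarrow>
      trace (mat_of_sym C ** mat_of_sym X) = b \<bullet> y)"

definition strict_complementarity ::
    "'n::finite symmat \<Rightarrow> ('m::finite \<Rightarrow> 'n symmat) \<Rightarrow> real^'m \<Rightarrow> bool"
  where "strict_complementarity C A b \<longleftrightarrow>
    (\<exists>X y. primal_solution C A b X \<and> dual_solution C A b y \<and>
      rank (mat_of_sym X) + rank (mat_of_sym (C - constraint_adjoint A y)) = CARD('n))"

definition simple_sdp ::
    "'n::finite symmat \<Rightarrow> ('m::finite \<Rightarrow> 'n symmat) \<Rightarrow> real^'m \<Rightarrow> bool"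
  where "simple_sdp C A b \<longleftrightarrow>
    strong_duality C A b \<and> surj (constraint_map A) \<and> strict_complementarity C A b \<and>
    (\<exists>!X. primal_solution C A b X) \<and> (\<exists>!y. dual_solution C A b y)"

definition unique_solution_of_rank ::
    "nat \<Rightarrow> 'n::finite symmat \<Rightarrow> ('m::finite \<Rightarrow> 'n symmat) \<Rightarrow> real^'m \<Rightarrow> bool"
  where "unique_solution_of_rank k C A b \<longleftrightarrow>
    (\<exists>X. primal_solution C A b X \<and> (\<forall>X'. primal_solution C A b X' \<longrightarrow> X' = X) \<and>
      rank (mat_of_sym X) = k)"


section \<open>Second order stationary points on embedded submanifolds\<close>

text \<open>
  The notions below are the usual ones for a set \<open>M\<close> that is an embedded submanifold of a
  Euclidean space, with the induced metric.
\<close>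

definition smooth_on_interval :: "real set \<Rightarrow> (real \<Rightarrow> 'a::real_normed_vector) \<Rightarrow> bool"
  where "smooth_on_interval I c \<longleftrightarrow>
    (\<exists>g. g 0 = c \<and> (\<forall>k. \<forall>t\<in>I. (g k has_vector_derivative g (Suc k) t) (at t)))"

definition curve_with_velocity ::
    "'a::real_normed_vector set \<Rightarrow> 'a \<Rightarrow> 'a \<Rightarrow> (real \<Rightarrow> 'a) \<Rightarrow> bool"
  where "curve_with_velocity M x u c \<longleftrightarrow>
    (\<exists>e>0. smooth_on_interval {-e<..<e} c \<and> c ` {-e<..<e} \<subseteq> M) \<and>
    c 0 = x \<and> (c has_vector_derivative u) (at 0)"

definition tangent_space :: "'a::real_normed_vector set \<Rightarrow> 'a \<Rightarrow> 'a set"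
  where "tangent_space M x = {u. \<exists>c. curve_with_velocity M x u c}"

definition orth_proj :: "'a::real_inner set \<Rightarrow> 'a \<Rightarrow> 'a"
  where "orth_proj T w = (THE p. p \<in> T \<and> (\<forall>v\<in>T. (w - p) \<bullet> v = 0))"

definition riem_gradient :: "'a::euclidean_space set \<Rightarrow> ('a \<Rightarrow> real) \<Rightarrow> 'a \<Rightarrow> 'a"
  where "riem_gradient M f x =
    (THE g. g \<in> tangent_space M x \<and>
      (\<forall>v\<in>tangent_space M x. frechet_derivative f (at x) v = g \<bullet> v))"

text \<open>
  The Riemannian Hessian at \<open>x\<close> maps \<open>u\<close> to the covariant derivative of the gradient field
  along \<open>u\<close>. For the Levi-Civita connection of the induced metric this is the tangential
  part of the ordinary derivative of the field along any curve in \<open>M\<close> with velocity \<open>u\<close>.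
\<close>

definition riem_hessian :: "'a::euclidean_space set \<Rightarrow> ('a \<Rightarrow> real) \<Rightarrow> 'a \<Rightarrow> 'a \<Rightarrow> 'a"
  where "riem_hessian M f x u =
    (THE h. \<forall>c. curve_with_velocity M x u c \<longrightarrow>
      (\<exists>w. ((\<lambda>t. riem_gradient M f (c t)) has_vector_derivative w) (at 0) \<and>
           h = orth_proj (tangent_space M x) w))"

definition psd_symmetric_linear_on :: "'a::real_inner set \<Rightarrow> ('a \<Rightarrow> 'a) \<Rightarrow> bool"
  where "psd_symmetric_linear_on T H \<longleftrightarrow>
    H ` T \<subseteq> T \<and>
    (\<forall>u\<in>T. \<forall>v\<in>T. H (u + v) = H u + H v) \<and> (\<forall>a. \<forall>u\<in>T. H (a *\<^sub>R u) = a *\<^sub>R H u) \<and>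
    (\<forall>u\<in>T. \<forall>v\<in>T. H u \<bullet> v = u \<bullet> H v) \<and> (\<forall>u\<in>T. 0 \<le> u \<bullet> H u)"

definition sosp :: "'a::euclidean_space set \<Rightarrow> ('a \<Rightarrow> real) \<Rightarrow> 'a \<Rightarrow> bool"
  where "sosp M f x \<longleftrightarrow>
    x \<in> M \<and> riem_gradient M f x = 0 \<and>
    psd_symmetric_linear_on (tangent_space M x) (riem_hessian M f x)"


section \<open>The Burer--Monteiro approach\<close>

text \<open>The factor \<open>F\<close> has type \<^typ>\<open>real^'r^'n\<close>: \<open>n\<close> rows and \<open>r\<close> columns.\<close>

definition gram :: "real^'r^'n \<Rightarrow> 'n::finite symmat"
  where "gram F = Symmat (F ** transpose F)"

lemma mat_of_sym_gram: "mat_of_sym (gram F) = F ** transpose F"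
  unfolding gram_def by (rule mat_of_sym_Symmat) (simp add: matrix_transpose_mul)

definition bm_feasible :: "('m::finite \<Rightarrow> 'n::finite symmat) \<Rightarrow> real^'m \<Rightarrow> (real^'r^'n) set"
  where "bm_feasible A b = {F. constraint_map A (gram F) = b}"

definition bm_objective :: "'n::finite symmat \<Rightarrow> real^'r^'n \<Rightarrow> real"
  where "bm_objective C F = trace (mat_of_sym C ** F ** transpose F)"

definition bm_fails ::
    "'r::finite itself \<Rightarrow> 'n::finite symmat \<Rightarrow> ('m::finite \<Rightarrow> 'n symmat) \<Rightarrow> real^'m \<Rightarrow> bool"
  where "bm_fails r C A b \<longleftrightarrow>
    (\<exists>F :: real^'r^'n. sosp (bm_feasible A b) (bm_objective C) F \<and>
      \<not> (\<forall>G :: real^'r^'n\<in>bm_feasible A b. bm_objective C F \<le> bm_objective C G))"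


section \<open>The three classes of programs\<close>

definition maxcut_mats :: "'n::finite \<Rightarrow> 'n symmat"
  where "maxcut_mats i = Symmat (\<chi> k l. if k = i \<and> l = i then 1 else 0)"

definition maxcut_rhs :: "real^'n"
  where "maxcut_rhs = (\<chi> i. 1)"

definition product_mats :: "('m \<Rightarrow> 'n::finite set) \<Rightarrow> 'm \<Rightarrow> 'n symmat"
  where "product_mats S i = Symmat (\<chi> k l. if k = l \<and> k \<in> S i then 1 else 0)"

definition product_rhs :: "real^'m"
  where "product_rhs = (\<chi> i. 1)"

text \<open>
  For OrthogonalCut rows and columns are indexed by pairs (block, position within the block).
  The constraints are indexed by a block \<open>s\<close> and an unordered pair \<open>{i, j}\<close> of positions, and
  read \<open>X\<^bsub>(s,i),(s,j)\<^esub> = (if i = j then 1 else 0)\<close>.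
\<close>

instance uprod :: (finite) finite
  by standard simp

definition orthcut_mats :: "'s \<times> 'd uprod \<Rightarrow> ('s::finite \<times> 'd::finite) symmat"
  where "orthcut_mats q = Symmat (\<chi> k l.
    if fst k = fst q \<and> fst l = fst q \<and> Upair (snd k) (snd l) = snd q
    then (if k = l then 1 else 1 / 2) else 0)"

definition orthcut_rhs :: "real^('s::finite \<times> 'd::finite uprod)"
  where "orthcut_rhs = (\<chi> q. if proper_uprod (snd q) then 0 else 1)"

definition block :: "'s \<Rightarrow> ('s::finite \<times> 'd::finite) symmat \<Rightarrow> real^'d^'d"
  where "block s X = (\<chi> i j. mat_of_sym X $ (s, i) $ (s, j))"

lemma inner_symmat_entries:
  "X \<bullet> Y = (\<Sum>k\<in>UNIV. \<Sum>l\<in>UNIV. mat_of_sym X $ k $ l * mat_of_sym Y $ k $ l)"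
  by (simp add: inner_symmat_def inner_vec_def)

lemma mat_of_sym_entries_commute: "mat_of_sym X $ k $ l = mat_of_sym X $ l $ k"
  by (subst transpose_mat_of_sym[symmetric]) (simp only: transpose_def vec_lambda_beta)

lemma sum_delta_delta:
  fixes f :: "'k::finite \<Rightarrow> 'l::finite \<Rightarrow> real"
  shows "(\<Sum>k\<in>UNIV. \<Sum>l\<in>UNIV. if k = a then (if l = b then f k l else 0) else 0) = f a b"
proof -
  have "(\<Sum>l\<in>UNIV. if k = a then (if l = b then f k l else 0) else 0) = (if k = a then f k b else 0)"
    for k
    by (cases "k = a") simp_all
  then show ?thesis by simp
qed

lemma maxcut_constraint: "maxcut_mats i \<bullet> X = mat_of_sym X $ i $ i"
proof -
  have "mat_of_sym (maxcut_mats i) = (\<chi> k l. if k = i \<and> l = i then 1 else 0)"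
    unfolding maxcut_mats_def by (rule mat_of_sym_Symmat) (auto simp: transpose_def vec_eq_iff)
  then have "maxcut_mats i \<bullet> X =
      (\<Sum>k\<in>UNIV. \<Sum>l\<in>UNIV. if k = i then (if l = i then mat_of_sym X $ k $ l else 0) else 0)"
    by (auto simp: inner_symmat_entries intro!: sum.cong)
  then show ?thesis by (simp only: sum_delta_delta)
qed

lemma maxcut_feasible_iff:
  "primal_feasible maxcut_mats maxcut_rhs X \<longleftrightarrow> (\<forall>i. mat_of_sym X $ i $ i = 1) \<and> psd X"
  by (simp add: primal_feasible_def constraint_map_def maxcut_rhs_def maxcut_constraint vec_eq_iff)

lemma product_constraint: "product_mats S i \<bullet> X = (\<Sum>k\<in>S i. mat_of_sym X $ k $ k)"
proof -
  have "mat_of_sym (product_mats S i) = (\<chi> k l. if k = l \<and> k \<in> S i then 1 else 0)"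
    unfolding product_mats_def by (rule mat_of_sym_Symmat) (auto simp: transpose_def vec_eq_iff)
  then have "product_mats S i \<bullet> X =
      (\<Sum>k\<in>UNIV. \<Sum>l\<in>UNIV. if k = l then (if k \<in> S i then mat_of_sym X $ k $ l else 0) else 0)"
    unfolding inner_symmat_entries by (intro sum.cong refl) simp
  also have "\<dots> = (\<Sum>k\<in>UNIV. if k \<in> S i then mat_of_sym X $ k $ k else 0)"
    by simp
  finally show ?thesis by (simp add: sum.If_cases)
qed

lemma product_feasible_iff:
  "primal_feasible (product_mats S) product_rhs X \<longleftrightarrow>
    (\<forall>i. (\<Sum>k\<in>S i. mat_of_sym X $ k $ k) = 1) \<and> psd X"
  by (simp add: primal_feasible_def constraint_map_def product_rhs_def product_constraint vec_eq_iff)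

lemma orthcut_constraint: "orthcut_mats (s, Upair i j) \<bullet> X = mat_of_sym X $ (s, i) $ (s, j)"
proof -
  have "mat_of_sym (orthcut_mats (s, Upair i j)) = (\<chi> k l.
      if fst k = s \<and> fst l = s \<and> Upair (snd k) (snd l) = Upair i j
      then (if k = l then 1 else 1 / 2) else 0)"
    unfolding orthcut_mats_def fst_conv snd_conv
    by (rule mat_of_sym_Symmat) (auto simp: transpose_def vec_eq_iff)
  also have "\<dots> = (\<chi> k l. (1 / 2) * (if k = (s, i) then (if l = (s, j) then 1 else 0) else 0)
      + (1 / 2) * (if k = (s, j) then (if l = (s, i) then 1 else 0) else 0))"
    by (auto simp: vec_eq_iff)
  finally have m: "mat_of_sym (orthcut_mats (s, Upair i j)) $ k $ l * mat_of_sym X $ k $ l =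
      (if k = (s, i) then (if l = (s, j) then mat_of_sym X $ k $ l / 2 else 0) else 0)
      + (if k = (s, j) then (if l = (s, i) then mat_of_sym X $ k $ l / 2 else 0) else 0)" for k l
    by simp
  show ?thesis
    unfolding inner_symmat_entries m sum.distrib sum_delta_delta
    using mat_of_sym_entries_commute[of X "(s, i)" "(s, j)"] by simp
qed

lemma orthcut_feasible_iff:
  "primal_feasible orthcut_mats orthcut_rhs X \<longleftrightarrow> (\<forall>s. block s X = mat 1) \<and> psd X"
proof -
  have "constraint_map orthcut_mats X = orthcut_rhs \<longleftrightarrow>
      (\<forall>s i j. orthcut_mats (s, Upair i j) \<bullet> X = (if i = j then 1 else 0))"
    (is "?L \<longleftrightarrow> ?R")
  proof
    show ?R if ?L
      using that by (auto simp: constraint_map_def orthcut_rhs_def vec_eq_iff)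
    show ?L if R: ?R
    proof -
      have "orthcut_mats (s, p) \<bullet> X = (if proper_uprod p then 0 else 1)" for s p
        using R by (cases p) auto
      then show ?thesis by (auto simp: constraint_map_def orthcut_rhs_def vec_eq_iff)
    qed
  qed
  also have "\<dots> \<longleftrightarrow> (\<forall>s. block s X = mat 1)"
    by (auto simp: orthcut_constraint block_def vec_eq_iff mat_def)
  finally show ?thesis by (simp add: primal_feasible_def)
qed

lemma card_orthcut_constraints:
  "CARD('s::finite \<times> 'd::finite uprod) = CARD('s) * CARD('d) * (CARD('d) + 1) div 2"
proof -
  have "even (CARD('d) * (CARD('d) + 1))" by simp
  then show ?thesis
    by (simp only: card_prod card_UNIV_uprod mult.assoc div_mult_swap)
qed

end

theory Submission
  imports Defs
begin

text \<open>
  Fix feasible factors \<open>U\<close> (with \<open>d\<close> columns, the future solution) and \<open>F\<close> (with \<open>r\<close> columns, the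
  future spurious point) for which \<open>(T, R) \<mapsto> \<A>(F T F\<^sup>T + F R U\<^sup>T + U R\<^sup>T F\<^sup>T)\<close> is injective.
  The adjoint is surjective, so some \<open>N = \<A>\<^sup>* y\<close> has \<open>F\<^sup>T N F = - I\<close> and \<open>U\<^sup>T N F = 0\<close>. Put
  \<open>C = N F F\<^sup>T N + t E\<^sup>T E\<close> with \<open>E\<close> a projection whose kernel is spanned by \<open>F\<close> and \<open>U\<close>. Then \<open>C\<close> is
  positive semidefinite with kernel the range of \<open>U\<close>, which makes \<open>U U\<^sup>T\<close> the unique solution, while
  \<open>(C + N) F = 0\<close> and, for large \<open>t\<close>, injectivity makes \<open>F\<close> a local minimum of the
  Burer--Monteiro problem that is strict up to rotations. Both properties are stable. For a cost near \<open>C\<close>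
  the minimum over a neighbourhood of \<open>F F\<^sup>T\<close> is attained in the interior, hence at a second order
  stationary point that is not optimal; and a global minimizer with factor size \<open>d\<close>
  provides the optimality certificate.

  For block diagonal constraints injectivity asks for isometries \<open>\<phi>\<^sub>s : \<real>\<^sup>d \<rightarrow> \<real>\<^sup>r\<close> such that
  \<open>\<phi>\<^sub>s\<^sup>T T \<phi>\<^sub>s + \<phi>\<^sub>s\<^sup>T R + R\<^sup>T \<phi>\<^sub>s = 0\<close> for all \<open>s\<close> only if \<open>T = 0\<close> and \<open>R = 0\<close>. The hypothesis on \<open>r\<close> says that
  there are at least as many equations as unknowns; explicit rational frames, assembled by
  induction on \<open>r\<close>, then suffice.
\<close>

section \<open>Frames that determine a quadratic form\<close>

text \<open>The obstacle is that \<open>C + N\<close> need not be positive semidefinite: on the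
  range of \<open>U\<close> its quadratic form is that of \<open>N\<close>, whose sign there is not
  controlled, so \<open>F\<close> might be left downhill in the direction of \<open>U\<close>. Write
  a nearby factor as \<open>G = F L + U K + Y\<close>, where \<open>Y\<close> is the component seen
  by \<open>E\<close>. In the difference of the constraint values of \<open>G\<close> and
  \<open>F\<close>, the overview's linear map is applied to \<open>T = L L^T - 1\<close> and
  \<open>R = L K^T\<close>; every other term is linear in \<open>Y\<close> or quadratic in
  \<open>U K + Y\<close>. Since an injective linear map is bounded below, feasibility forces
  \<open>K\<close> to be of order \<open>Y\<close>: the dangerous directions can only be followed if
  \<open>Y\<close> moves as well, and \<open>Y\<close> is what the factor \<open>t\<close>
  penalizes. The number of unknowns in \<open>(T, R)\<close> is r(r+1)/2 + rd, the left side of the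
  hypothesis. Nearness is always measured in \<open>gram G\<close>, because cost and constraints do
  not change under rotations of the columns. Stationarity is never perturbed directly; it is deduced
  again from local minimality for each nearby cost.\<close>

fun orthonormal :: "'v::real_inner list \<Rightarrow> bool" where
  "orthonormal [] \<longleftrightarrow> True"
| "orthonormal (x # xs) \<longleftrightarrow> x \<bullet> x = 1 \<and> (\<forall>y\<in>set xs. x \<bullet> y = 0) \<and> orthonormal xs"

lemma orthonormal_append:
  "orthonormal (xs @ ys) \<longleftrightarrow>
    orthonormal xs \<and> orthonormal ys \<and> (\<forall>x\<in>set xs. \<forall>y\<in>set ys. x \<bullet> y = 0)"
  by (induction xs) auto

lemma orthonormal_nth:
  "orthonormal xs \<Longrightarrow> i < length xs \<Longrightarrow> j < length xs \<Longrightarrow> xs ! i \<bullet> xs ! j = (if i = j then 1 else 0)"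
proof (induction xs arbitrary: i j)
  case (Cons x xs)
  then show ?case by (cases i; cases j) (auto simp: inner_commute)
qed simp

text \<open>\<open>R k x\<close> stands for entry \<open>k\<close> of R^T x, so the position of a
  vector within its frame matters and frames are lists. Indexing the functionals by
  \<open>nat\<close> keeps \<open>d\<close> out of the types; a frame of length \<open>d\<close>
  constrains only the indices below \<open>d\<close>.\<close>

definition form :: "('v::real_inner \<Rightarrow> 'v \<Rightarrow> real) \<Rightarrow> (nat \<Rightarrow> 'v \<Rightarrow> real) \<Rightarrow> bool" where
  "form T R \<longleftrightarrow> bilinear T \<and> (\<forall>x y. T x y = T y x) \<and> (\<forall>k. linear (R k))"

lemma form_expand:
  assumes "form T R"
  shows "T (x + y) z = T x z + T y z" "T z (x + y) = T z x + T z y"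
    "T (c *\<^sub>R x) z = c * T x z" "T z (c *\<^sub>R x) = c * T z x"
    "T (- x) z = - T x z" "T z (- x) = - T z x"
    "T (x - y) z = T x z - T y z" "T z (x - y) = T z x - T z y"
    "R k (x + y) = R k x + R k y" "R k (c *\<^sub>R x) = c * R k x" "R k (- x) = - R k x"
    "R k (x - y) = R k x - R k y"
  using assms unfolding form_def
  by (simp_all add: bilinear_ladd bilinear_radd bilinear_lmul bilinear_rmul bilinear_lneg bilinear_rneg
      bilinear_lsub bilinear_rsub linear_diff linear_add linear_scale linear_neg)

lemma form_sym: "form T R \<Longrightarrow> T x y = T y x"
  by (simp add: form_def)

text \<open>
  With columns \<open>b!j\<close>, this is the equation \<open>b\<^sup>T T b + b\<^sup>T R + R\<^sup>T b = 0\<close> in \<open>d \<times> d\<close> matrices.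
\<close>

definition vanishes :: "('v \<Rightarrow> 'v \<Rightarrow> real) \<Rightarrow> (nat \<Rightarrow> 'v \<Rightarrow> real) \<Rightarrow> 'v list \<Rightarrow> bool" where
  "vanishes T R b \<longleftrightarrow>
    (\<forall>j<length b. \<forall>k<length b. T (b ! j) (b ! k) + R k (b ! j) + R j (b ! k) = 0)"

lemma vanishes_1:
  "vanishes T R [a] \<longleftrightarrow> T a a + R 0 a + R 0 a = 0"
  by (simp add: vanishes_def)

lemma vanishes_2:
  assumes "form T R"
  shows "vanishes T R [a, b] \<longleftrightarrow>
    T a a + R 0 a + R 0 a = 0 \<and> T b b + R (Suc 0) b + R (Suc 0) b = 0 \<and>
    T a b + R (Suc 0) a + R 0 b = 0"
  unfolding vanishes_def using form_sym[OF assms, of a b]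
  by (simp add: All_less_Suc) argo

lemma vanishes_3:
  assumes "form T R"
  shows "vanishes T R [a, b, c] \<longleftrightarrow>
    T a a + R 0 a + R 0 a = 0 \<and> T b b + R (Suc 0) b + R (Suc 0) b = 0 \<and>
    T c c + R (Suc (Suc 0)) c + R (Suc (Suc 0)) c = 0 \<and>
    T a b + R (Suc 0) a + R 0 b = 0 \<and>
    T a c + R (Suc (Suc 0)) a + R 0 c = 0 \<and>
    T b c + R (Suc (Suc 0)) b + R (Suc 0) c = 0"
  unfolding vanishes_def
  using form_sym[OF assms, of a b] form_sym[OF assms, of a c] form_sym[OF assms, of b c]
  by (simp add: All_less_Suc) argo

lemma vanishes_3D:
  assumes "form T R" "vanishes T R [a, b, c]"
  shows "T a a + 2 * R 0 a = 0" "T b b + 2 * R 1 b = 0" "T c c + 2 * R 2 c = 0"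
    "T a b + R 1 a + R 0 b = 0" "T a c + R 2 a + R 0 c = 0" "T b c + R 2 b + R 1 c = 0"
  using assms(2) unfolding vanishes_3[OF assms(1)] by (simp_all add: numeral_2_eq_2)

text \<open>A triple in the manner of Hoare logic: with \<open>H\<close> already known,
  \<open>n\<close> frames buy \<open>G\<close>. The frames are fixed before \<open>T\<close> and
  \<open>R\<close> are given, so costs add up along \<open>forced_seq\<close> and the counting
  argument becomes arithmetic on \<open>n\<close>.\<close>

definition forced ::
    "nat \<Rightarrow> nat \<Rightarrow> (('v::real_inner \<Rightarrow> 'v \<Rightarrow> real) \<Rightarrow> (nat \<Rightarrow> 'v \<Rightarrow> real) \<Rightarrow> bool) \<Rightarrow>
      (('v \<Rightarrow> 'v \<Rightarrow> real) \<Rightarrow> (nat \<Rightarrow> 'v \<Rightarrow> real) \<Rightarrow> bool) \<Rightarrow> bool" where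
  "forced d n H G \<longleftrightarrow> (\<exists>bs. length bs = n \<and> (\<forall>b\<in>set bs. length b = d \<and> orthonormal b) \<and>
    (\<forall>T R. form T R \<longrightarrow> H T R \<longrightarrow> (\<forall>b\<in>set bs. vanishes T R b) \<longrightarrow> G T R))"

lemma forcedI:
  assumes "length bs = n" "\<And>b. b \<in> set bs \<Longrightarrow> length b = d \<and> orthonormal b"
    "\<And>T R. form T R \<Longrightarrow> H T R \<Longrightarrow> (\<And>b. b \<in> set bs \<Longrightarrow> vanishes T R b) \<Longrightarrow> G T R"
  shows "forced d n H G"
  unfolding forced_def using assms by blast

lemma forced_trivial:
  "(\<And>T R. form T R \<Longrightarrow> H T R \<Longrightarrow> G T R) \<Longrightarrow> forced d 0 H G"
  by (rule forcedI[of "[]"]) auto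

lemma forced_seq:
  assumes "forced d n H G" "forced d m G' K"
    "\<And>T R. form T R \<Longrightarrow> H T R \<Longrightarrow> G T R \<Longrightarrow> G' T R"
    "\<And>T R. form T R \<Longrightarrow> H T R \<Longrightarrow> G T R \<Longrightarrow> K T R \<Longrightarrow> L T R"
  shows "forced d (n + m) H L"
proof -
  obtain bs cs where "length bs = n" "\<forall>b\<in>set bs. length b = d \<and> orthonormal b"
    and G: "\<And>T R. form T R \<Longrightarrow> H T R \<Longrightarrow> \<forall>b\<in>set bs. vanishes T R b \<Longrightarrow> G T R"
    and "length cs = m" "\<forall>b\<in>set cs. length b = d \<and> orthonormal b"
    and K: "\<And>T R. form T R \<Longrightarrow> G' T R \<Longrightarrow> \<forall>b\<in>set cs. vanishes T R b \<Longrightarrow> K T R"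
    using assms(1,2) unfolding forced_def by blast
  then show ?thesis
    using assms(3,4) by (intro forcedI[of "bs @ cs"]) auto
qed

lemma forced_pre:
  assumes "forced d n H G" "\<And>T R. form T R \<Longrightarrow> H' T R \<Longrightarrow> H T R"
    "\<And>T R. form T R \<Longrightarrow> H' T R \<Longrightarrow> G T R \<Longrightarrow> G' T R"
  shows "forced d n H' G'"
  using forced_seq[OF forced_trivial assms(1), of H' H] assms(2,3) by auto

text \<open>Surplus places are filled with copies of \<open>e\<close>, whose equations are
  ignored.\<close>

lemma forced_mono:
  fixes e :: "'v::real_inner list" and H G :: "('v \<Rightarrow> 'v \<Rightarrow> real) \<Rightarrow> (nat \<Rightarrow> 'v \<Rightarrow> real) \<Rightarrow> bool"
  assumes "forced d n H G" "n \<le> m" "length e = d" "orthonormal e"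
  shows "forced d m H G"
proof -
  have "forced d (m - n) G G"
    by (rule forcedI[of "replicate (m - n) e"]) (use assms in auto)
  from forced_seq[OF assms(1) this, of G] show ?thesis using assms(2) by simp
qed

definition cross :: "'v list \<Rightarrow> 'v list \<Rightarrow> ('v \<Rightarrow> 'v \<Rightarrow> real) \<Rightarrow> (nat \<Rightarrow> 'v \<Rightarrow> real) \<Rightarrow> bool" where
  "cross xs zs T R \<longleftrightarrow> (\<forall>x\<in>set xs. \<forall>z\<in>set zs. T x z = 0)"

definition null :: "nat \<Rightarrow> 'v list \<Rightarrow> ('v \<Rightarrow> 'v \<Rightarrow> real) \<Rightarrow> (nat \<Rightarrow> 'v \<Rightarrow> real) \<Rightarrow> bool" where
  "null d xs T R \<longleftrightarrow> cross xs xs T R \<and> (\<forall>x\<in>set xs. \<forall>k<d. R k x = 0)"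

text \<open>\<open>R\<close> has no off-diagonal block. Once both diagonal blocks are settled, only
  the \<open>length xs * length zs\<close> entries of \<open>T\<close> in \<open>cross\<close> are
  still unknown, which is what \<open>solvable_append\<close> pays for separately.\<close>

lemma null_append:
  assumes "form T R"
  shows "null d (xs @ zs) T R \<longleftrightarrow> null d xs T R \<and> null d zs T R \<and> cross xs zs T R"
proof -
  have "(\<forall>x\<in>set xs. \<forall>z\<in>set zs. T x z = 0) \<longleftrightarrow> (\<forall>z\<in>set zs. \<forall>x\<in>set xs. T z x = 0)"
    using form_sym[OF assms] by metis
  then show ?thesis unfolding null_def cross_def by (simp add: ball_Un) blast
qed

abbreviation solvable :: "nat \<Rightarrow> nat \<Rightarrow> 'v::real_inner list \<Rightarrow> bool" where
  "solvable d n xs \<equiv> forced d n (\<lambda>_ _. True) (null d xs)"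

abbreviation solvable_cross :: "nat \<Rightarrow> nat \<Rightarrow> 'v::real_inner list \<Rightarrow> 'v list \<Rightarrow> bool" where
  "solvable_cross d n xs zs \<equiv> forced d n (\<lambda>T R. null d xs T R \<and> null d zs T R) (cross xs zs)"

lemma solvable_append:
  assumes "solvable d n xs" "solvable d m zs" "solvable_cross d k xs zs"
  shows "solvable d (n + m + k) (xs @ zs)"
proof -
  have "forced d (n + m) (\<lambda>_ _. True) (\<lambda>T R. null d xs T R \<and> null d zs T R)"
    by (rule forced_seq[OF assms(1,2)]) auto
  then show ?thesis by (rule forced_seq[OF _ assms(3)]) (auto simp: null_append)
qed

lemma solvable_cross_append_left:
  assumes "solvable_cross d n xs zs" "solvable_cross d m ys zs"
  shows "solvable_cross d (n + m) (xs @ ys) zs"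
proof (rule forced_seq)
  show "forced d n (\<lambda>T R. null d (xs @ ys) T R \<and> null d zs T R) (cross xs zs)"
    by (rule forced_pre[OF assms(1)]) (auto simp: null_append)
  show "forced d m (\<lambda>T R. null d (xs @ ys) T R \<and> null d zs T R) (cross ys zs)"
    by (rule forced_pre[OF assms(2)]) (auto simp: null_append)
qed (auto simp: cross_def)

lemma solvable_cross_append_right:
  assumes "solvable_cross d n xs zs" "solvable_cross d m xs ws"
  shows "solvable_cross d (n + m) xs (zs @ ws)"
proof (rule forced_seq)
  show "forced d n (\<lambda>T R. null d xs T R \<and> null d (zs @ ws) T R) (cross xs zs)"
    by (rule forced_pre[OF assms(1)]) (auto simp: null_append)
  show "forced d m (\<lambda>T R. null d xs T R \<and> null d (zs @ ws) T R) (cross xs ws)"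
    by (rule forced_pre[OF assms(2)]) (auto simp: null_append)
qed (auto simp: cross_def)

text \<open>The triple 3, 4, 5 gives a rational unit vector. If \<open>null\<close> holds for the
  \<open>x\<close>s and for the \<open>z\<close>s, the diagonal equation at \<open>mix x z\<close>
  reduces to \<open>T x z = 0\<close>, and the equation between \<open>mix x z\<close> and
  \<open>mix x' z'\<close> to \<open>T x z' + T x' z = 0\<close>.\<close>

abbreviation mix :: "'v::real_inner \<Rightarrow> 'v \<Rightarrow> 'v" where
  "mix x z \<equiv> (3 / 5) *\<^sub>R x + (4 / 5) *\<^sub>R z"

lemmas inner_expand = inner_add_left inner_add_right inner_scaleR_left inner_scaleR_right
  inner_minus_left inner_minus_right inner_diff_left inner_diff_right

section \<open>Frames of one vector\<close>

text \<open>A new vector \<open>z\<close> brings \<open>length xs + 2\<close> unknowns: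
  \<open>T z z\<close> and \<open>R 0 z\<close>, separated by the frames \<open>z\<close> and
  \<open>- z\<close>, and one entry \<open>T x z\<close> for each old \<open>x\<close>. Each costs
  one frame of one equation, so nothing is lost.\<close>

lemma solvable_1:
  assumes "orthonormal xs" "xs \<noteq> []" "length xs * (length xs + 3) \<le> 2 * n"
  shows "solvable 1 n xs"
  using assms
proof (induction xs arbitrary: n rule: rev_induct)
  case (snoc z xs)
  have on: "orthonormal xs" "z \<bullet> z = 1" "\<And>x. x \<in> set xs \<Longrightarrow> x \<bullet> z = 0" "\<And>x. x \<in> set xs \<Longrightarrow> x \<bullet> x = 1"
    using snoc.prems(1) orthonormal_nth[of xs] by (auto simp: orthonormal_append in_set_conv_nth)
  have z: "solvable 1 2 [z]"
  proof (rule forcedI[of "[[z], [- z]]"])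
    fix T R assume f: "form T R" and v: "\<And>b. b \<in> set [[z], [- z]] \<Longrightarrow> vanishes T R b"
    show "null 1 [z] T R"
      using v[of "[z]"] v[of "[- z]"] by (simp add: vanishes_1 form_expand[OF f] null_def cross_def)
  qed (use on in auto)
  show ?case
  proof (cases "xs = []")
    case True
    then show ?thesis using forced_mono[OF z, of n "[z]"] snoc.prems on by simp
  next
    case False
    have c: "solvable_cross 1 (length xs) xs [z]"
    proof (rule forcedI[of "map (\<lambda>x. [mix x z]) xs"])
      fix T R assume f: "form T R" and n: "null 1 xs T R \<and> null 1 [z] T R"
        and v: "\<And>b. b \<in> set (map (\<lambda>x. [mix x z]) xs) \<Longrightarrow> vanishes T R b"
      have "T x z = 0" if "x \<in> set xs" for x
        using v[of "[mix x z]"] that n form_sym[OF f, of z x]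
        by (auto simp: vanishes_1 form_expand[OF f] null_def cross_def)
      then show "cross xs [z] T R" by (simp add: cross_def)
    qed (use on in \<open>auto simp: inner_expand inner_commute\<close>)
    define r where "r = length xs"
    have n: "r * (r + 3) + 2 * (r + 2) \<le> 2 * n"
      using snoc.prems(3) by (simp add: r_def algebra_simps)
    then have "r * (r + 3) \<le> 2 * (n - (r + 2))" by simp
    then have "solvable 1 (n - (r + 2)) xs"
      using snoc.IH[OF on(1) False] by (simp add: r_def)
    from solvable_append[OF this z c] have "solvable 1 (n - (r + 2) + 2 + r) (xs @ [z])"
      by (simp only: r_def)
    moreover have "n - (r + 2) + 2 + r = n" using n by simp
    ultimately show ?thesis by (simp only:)
  qed
qed simp

section \<open>Frames of two vectors\<close>

text \<open>Six unknowns meet six equations. The sum in the mixed equation of each frame contains an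
  entry that is killed by a diagonal equation of the other frame.\<close>

lemma solvable_cross_2_3:
  fixes x1 x2 z1 z2 z3 :: "'v::real_inner"
  assumes "orthonormal [x1, x2, z1, z2, z3]"
  shows "solvable_cross 2 2 [x1, x2] [z1, z2, z3]"
proof (rule forcedI[of "[[mix x1 z1, mix x2 z2], [mix x1 z2, mix x2 z3]]"])
  fix T R assume f: "form T R" and n: "null 2 [x1, x2] T R \<and> null 2 [z1, z2, z3] T R"
    and v: "\<And>b. b \<in> set [[mix x1 z1, mix x2 z2], [mix x1 z2, mix x2 z3]] \<Longrightarrow> vanishes T R b"
  have v: "vanishes T R [mix x1 z1, mix x2 z2]" "vanishes T R [mix x1 z2, mix x2 z3]"
    by (rule v; simp)+
  have s: "T z x = T x z" if "x \<in> {x1, x2}" "z \<in> {z1, z2, z3}" for x z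
    by (rule form_sym[OF f])
  show "cross [x1, x2] [z1, z2, z3] T R"
    using v n unfolding vanishes_2[OF f]
    by (simp add: form_expand[OF f] s null_def cross_def)
qed (use assms in \<open>auto simp: inner_expand inner_commute\<close>)

text \<open>The six diagonal equations leave \<open>T x1 z2\<close>, \<open>T x2 z1\<close> and
  \<open>T x3 z3\<close>. The three mixed equations make any two of these opposite, and a cycle of
  odd length forces them to vanish.\<close>

lemma solvable_cross_3_3:
  fixes x1 x2 x3 z1 z2 z3 :: "'v::real_inner"
  assumes "orthonormal [x1, x2, x3, z1, z2, z3]"
  shows "solvable_cross 2 3 [x1, x2, x3] [z1, z2, z3]"
proof -
  let ?bs = "[[mix x1 z1, mix x2 z2], [mix x3 z2, mix x1 z3], [mix x3 z1, mix x2 z3]]"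
  show ?thesis
  proof (rule forcedI[of ?bs])
    fix T R assume f: "form T R" and n: "null 2 [x1, x2, x3] T R \<and> null 2 [z1, z2, z3] T R"
      and v: "\<And>b. b \<in> set ?bs \<Longrightarrow> vanishes T R b"
    have v: "vanishes T R [mix x1 z1, mix x2 z2]" "vanishes T R [mix x3 z2, mix x1 z3]"
      "vanishes T R [mix x3 z1, mix x2 z3]"
      by (rule v; simp)+
    have s: "T z x = T x z" if "x \<in> {x1, x2, x3}" "z \<in> {z1, z2, z3}" for x z
      by (rule form_sym[OF f])
    show "cross [x1, x2, x3] [z1, z2, z3] T R"
      using v n unfolding vanishes_2[OF f]
      by (simp add: form_expand[OF f] s null_def cross_def)
  qed (use assms in \<open>auto simp: inner_expand inner_commute\<close>)
qed

text \<open>The frames of the base cases with \<open>d = 2\<close> and \<open>d = 3\<close> were found by a computer search among frames of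
  signed basis vectors and the rational unit vectors \<open>(\<plusminus>3 e\<^sub>i \<plusminus> 4 e\<^sub>j) / 5\<close>.\<close>

lemma solvable_2_base2:
  fixes x y :: "'v::real_inner"
  assumes "orthonormal [x, y]"
  shows "solvable 2 3 [x, y]"
proof -
  let ?bs = "[[x, y], [- x, - y], [x, - y]]"
  show ?thesis
  proof (rule forcedI[of ?bs])
    fix T R assume f: "form T R" and v: "\<And>b. b \<in> set ?bs \<Longrightarrow> vanishes T R b"
    have v: "vanishes T R [x, y]" "vanishes T R [- x, - y]" "vanishes T R [x, - y]"
      by (rule v; simp)+
    show "null 2 [x, y] T R"
      using v form_sym[OF f, of x y] unfolding vanishes_2[OF f]
      by (simp add: form_expand[OF f] null_def cross_def All_less_Suc numeral_2_eq_2)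
  qed (use assms in \<open>auto simp: inner_expand inner_commute\<close>)
qed

lemma solvable_2_base3:
  fixes x y z :: "'v::real_inner"
  assumes "orthonormal [x, y, z]"
  shows "solvable 2 4 [x, y, z]"
proof -
  let ?bs = "[[- mix y z, x], [- x, - y], [z, - x], [- z, y]]"
  show ?thesis
  proof (rule forcedI[of ?bs])
    fix T R assume f: "form T R" and v: "\<And>b. b \<in> set ?bs \<Longrightarrow> vanishes T R b"
    have v: "vanishes T R [- mix y z, x]" "vanishes T R [- x, - y]"
      "vanishes T R [z, - x]" "vanishes T R [- z, y]"
      by (rule v; simp)+
    show "null 2 [x, y, z] T R"
      using v form_sym[OF f, of y x] form_sym[OF f, of z x] form_sym[OF f, of z y]
      unfolding vanishes_2[OF f]
      by (simp add: form_expand[OF f] null_def cross_def All_less_Suc numeral_2_eq_2)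
  qed (use assms in \<open>auto simp: inner_expand inner_commute\<close>)
qed

lemma solvable_2_base4:
  fixes x y z w :: "'v::real_inner"
  assumes "orthonormal [x, y, z, w]"
  shows "solvable 2 6 [x, y, z, w]"
proof -
  let ?bs = "[[z, y], [y, - w], [- x, w], [- y, x], [w, - z], [- z, - x]]"
  show ?thesis
  proof (rule forcedI[of ?bs])
    fix T R assume f: "form T R" and v: "\<And>b. b \<in> set ?bs \<Longrightarrow> vanishes T R b"
    have v: "vanishes T R [z, y]" "vanishes T R [y, - w]" "vanishes T R [- x, w]"
      "vanishes T R [- y, x]" "vanishes T R [w, - z]" "vanishes T R [- z, - x]"
      by (rule v; simp)+
    show "null 2 [x, y, z, w] T R"
      using v form_sym[OF f, of y x] form_sym[OF f, of z x] form_sym[OF f, of z y]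
        form_sym[OF f, of w x] form_sym[OF f, of w y] form_sym[OF f, of w z]
      unfolding vanishes_2[OF f]
      by (simp add: form_expand[OF f] null_def cross_def All_less_Suc numeral_2_eq_2)
  qed (use assms in \<open>auto simp: inner_expand inner_commute\<close>)
qed

lemma length_3_cases:
  assumes "length xs = 3"
  obtains x y z where "xs = [x, y, z]"
  using assms by (auto simp: numeral_3_eq_3 length_Suc_conv)

text \<open>A single \<open>x\<close> is excluded: the two vectors of one frame have only two
  components in the span of \<open>zs\<close>, too few for three entries. Every other length is a
  sum of twos and threes.\<close>

lemma solvable_cross_2:
  fixes xs zs :: "'v::real_inner list"
  assumes "orthonormal (xs @ zs)" "length xs \<noteq> 1" "length zs = 3"
  shows "solvable_cross 2 (length xs) xs zs"
  using assms(1,2)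
proof (induction "length xs" arbitrary: xs rule: less_induct)
  case less
  obtain z1 z2 z3 where zs: "zs = [z1, z2, z3]" using assms(3) by (rule length_3_cases)
  consider "xs = []" | x1 x2 x3 where "xs = [x1, x2, x3]"
    | x1 x2 ys where "xs = [x1, x2] @ ys" "length ys \<noteq> 1"
    using less.prems(2) by (cases xs; cases "tl xs"; cases "tl (tl xs)"; cases "tl (tl (tl xs))") auto
  then show ?case
  proof cases
    case 1
    then show ?thesis by (auto intro!: forced_trivial simp: cross_def)
  next
    case 2
    then show ?thesis using solvable_cross_3_3[of x1 x2 x3 z1 z2 z3] less.prems(1)
      by (simp add: zs numeral_3_eq_3)
  next
    case 3
    have "solvable_cross 2 (length ys) ys zs"
      by (rule less.hyps) (use 3 less.prems(1) in auto)
    moreover have "solvable_cross 2 2 [x1, x2] zs"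
      unfolding zs by (rule solvable_cross_2_3) (use 3 less.prems(1) zs in \<open>simp add: orthonormal_append\<close>)
    ultimately show ?thesis
      using solvable_cross_append_left[of 2 2 "[x1, x2]" zs "length ys" ys] 3 by simp
  qed
qed

lemma split_last:
  assumes "k \<le> length xs"
  obtains ys zs where "xs = ys @ zs" "length ys = length xs - k" "length zs = k"
proof (rule that[of "take (length xs - k) xs" "drop (length xs - k) xs"])
qed (use assms in simp_all)

text \<open>Three more vectors raise \<open>r * (r + 5)\<close> by exactly
  \<open>6 * (r + 4)\<close>, which pays for the four frames of the new diagonal block and the
  \<open>r\<close> frames of the cross block. Steps of three need the bases 2, 3 and 4; a remainder
  of length 1, excluded in \<open>solvable_cross_2\<close>, never occurs.\<close>

lemma solvable_2:
  fixes xs :: "'v::real_inner list"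
  assumes "orthonormal xs" "2 \<le> length xs" "length xs * (length xs + 5) \<le> 6 * n"
  shows "solvable 2 n xs"
  using assms
proof (induction "length xs" arbitrary: xs n rule: less_induct)
  case less
  obtain x y ws where ws: "xs = x # y # ws"
    using less.prems(2) by (cases xs; cases "tl xs") auto
  have mono: "solvable 2 n xs" if "solvable 2 k xs" "k \<le> n" for k
    by (rule forced_mono[OF that, of "[x, y]"]) (use less.prems(1) ws in simp_all)
  have base3: "solvable 2 4 zs" if "length zs = 3" "orthonormal zs" for zs :: "'v list"
    by (rule length_3_cases[OF that(1)]) (use that(2) solvable_2_base3 in blast)
  consider "ws = []" | z where "ws = [z]" | z w where "ws = [z, w]" | "5 \<le> length xs"
    unfolding ws by (cases ws; cases "tl ws"; cases "tl (tl ws)") auto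
  then show ?case
  proof cases
    case 1
    show ?thesis
      by (rule mono[of 3]) (use 1 ws less.prems solvable_2_base2[of x y] in simp_all)
  next
    case 2
    show ?thesis
      by (rule mono[of 4]) (use 2 ws less.prems base3 in simp_all)
  next
    case 3
    show ?thesis
      by (rule mono[of 6]) (use 3 ws less.prems solvable_2_base4[of x y z w] in simp_all)
  next
    case 4
    obtain ys zs where yz: "xs = ys @ zs" "length ys = length xs - 3" "length zs = 3"
      using split_last[of 3 xs] 4 by auto
    define r where "r = length ys"
    have len: "length xs = r + 3" using yz(1,3) by (simp add: r_def)
    have on: "orthonormal ys" "orthonormal zs"
      using less.prems(1) unfolding yz(1) orthonormal_append by simp_all
    have n: "r * (r + 5) + 6 * (r + 4) \<le> 6 * n"
      using less.prems(3) by (simp add: len algebra_simps)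
    then have "r * (r + 5) \<le> 6 * (n - (r + 4))" by simp
    then have "solvable 2 (n - (r + 4)) ys"
      using less.hyps[of ys] 4 len on by (simp add: r_def)
    moreover have "solvable 2 4 zs"
      using base3 yz(3) on by blast
    moreover have "solvable_cross 2 r ys zs"
      unfolding r_def by (rule solvable_cross_2) (use 4 len yz(1,3) less.prems(1) r_def in auto)
    ultimately have "solvable 2 (n - (r + 4) + 4 + r) xs"
      unfolding yz(1) by (rule solvable_append)
    moreover have "n - (r + 4) + 4 + r = n" using n by simp
    ultimately show ?thesis by (simp only:)
  qed
qed

section \<open>Frames of three vectors\<close>

text \<open>The frames \<open>zs\<close> and \<open>-zs\<close> separate \<open>T\<close> from \<open>R\<close>, and leave only the skew part of \<open>R\<close> undetermined.\<close>

definition skew :: "'v list \<Rightarrow> ('v \<Rightarrow> 'v \<Rightarrow> real) \<Rightarrow> (nat \<Rightarrow> 'v \<Rightarrow> real) \<Rightarrow> bool" where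
  "skew zs T R \<longleftrightarrow> cross zs zs T R \<and>
    (\<forall>i<length zs. \<forall>j<length zs. R j (zs ! i) + R i (zs ! j) = 0)"

lemma skew_3D:
  assumes "skew [x, y, z] T R"
  shows "T x x = 0" "T x y = 0" "T x z = 0" "T y y = 0" "T y z = 0" "T z z = 0"
    "R 0 x = 0" "R 1 y = 0" "R 2 z = 0" "R 0 y = - R 1 x" "R 0 z = - R 2 x" "R 1 z = - R 2 y"
  using assms by (simp_all add: skew_def cross_def All_less_Suc numeral_2_eq_2)

lemma forced_skew:
  fixes x y z :: "'v::real_inner"
  assumes "orthonormal [x, y, z]"
  shows "forced 3 2 (\<lambda>_ _. True) (skew [x, y, z])"
proof -
  let ?bs = "[[x, y, z], [- x, - y, - z]]"
  show ?thesis
  proof (rule forcedI[of ?bs])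
    fix T R assume f: "form T R" and v: "\<And>b. b \<in> set ?bs \<Longrightarrow> vanishes T R b"
    have v: "vanishes T R [x, y, z]" "vanishes T R [- x, - y, - z]"
      by (rule v; simp)+
    show "skew [x, y, z] T R"
      using v form_sym[OF f, of y x] form_sym[OF f, of z x] form_sym[OF f, of z y]
      unfolding vanishes_3[OF f]
      by (simp add: form_expand[OF f] skew_def cross_def All_less_Suc)
  qed (use assms in \<open>auto simp: inner_expand inner_commute\<close>)
qed

text \<open>Three unknowns survive \<open>forced_skew\<close>, and the diagonal equations of the
  cyclic shift \<open>[y, z, x]\<close> are precisely their vanishing: \<open>R 0 y\<close>,
  \<open>R 1 z\<close> and \<open>R 2 x\<close>.\<close>

lemma solvable_3_base3:
  fixes x y z :: "'v::real_inner"
  assumes "orthonormal [x, y, z]"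
  shows "solvable 3 3 [x, y, z]"
proof -
  have "forced 3 1 (skew [x, y, z]) (null 3 [x, y, z])"
  proof (rule forcedI[of "[[y, z, x]]"])
    fix T R assume f: "form T R" and s: "skew [x, y, z] T R"
      and v: "\<And>b. b \<in> set [[y, z, x]] \<Longrightarrow> vanishes T R b"
    have v: "vanishes T R [y, z, x]" by (rule v; simp)
    show "null 3 [x, y, z] T R"
      using v s unfolding vanishes_3[OF f]
      by (simp add: form_expand[OF f] skew_def null_def cross_def All_less_Suc numeral_3_eq_3)
  qed (use assms in \<open>auto simp: inner_commute\<close>)
  from forced_seq[OF forced_skew[OF assms] this, of "null 3 [x, y, z]"] show ?thesis by simp
qed

lemma solvable_3_base4:
  fixes x y z w :: "'v::real_inner"
  assumes "orthonormal [x, y, z, w]"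
  shows "solvable 3 4 [x, y, z, w]"
proof -
  let ?bs = "[[w, x, - y], [- w, y, - z], [- x, w, z], [z, - x, y]]"
  show ?thesis
  proof (rule forcedI[of ?bs])
    fix T R assume f: "form T R" and v: "\<And>b. b \<in> set ?bs \<Longrightarrow> vanishes T R b"
    have v: "vanishes T R [w, x, - y]" "vanishes T R [- w, y, - z]"
      "vanishes T R [- x, w, z]" "vanishes T R [z, - x, y]"
      by (rule v; simp)+
    show "null 3 [x, y, z, w] T R"
      using v form_sym[OF f, of y x] form_sym[OF f, of z x] form_sym[OF f, of z y]
        form_sym[OF f, of w x] form_sym[OF f, of w y] form_sym[OF f, of w z]
      unfolding vanishes_3[OF f]
      by (simp add: form_expand[OF f] null_def cross_def All_less_Suc numeral_3_eq_3)
  qed (use assms in \<open>auto simp: inner_expand inner_commute\<close>)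
qed

text \<open>There is no slack: 15 + 15 unknowns and five frames of six equations. The elimination is
  therefore spelled out.\<close>

lemma solvable_3_base5:
  fixes x y z w u :: "'v::real_inner"
  assumes "orthonormal [x, y, z, w, u]"
  shows "solvable 3 5 [x, y, z, w, u]"
proof -
  let ?bs = "[[- z, u, (3 / 5) *\<^sub>R x - (4 / 5) *\<^sub>R w], [- w, - u, y], [w, - x, - u]]"
  have "forced 3 3 (skew [x, y, z]) (null 3 [x, y, z, w, u])"
  proof (rule forcedI[of ?bs])
    fix T R assume f: "form T R" and s: "skew [x, y, z] T R"
      and v: "\<And>b. b \<in> set ?bs \<Longrightarrow> vanishes T R b"
    have v: "vanishes T R [- z, u, (3 / 5) *\<^sub>R x - (4 / 5) *\<^sub>R w]" "vanishes T R [- w, - u, y]"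
      "vanishes T R [w, - x, - u]"
      by (rule v; simp)+
    note k = skew_3D[OF s]
    have sym: "T y x = T x y" "T z x = T x z" "T z y = T y z" "T w x = T x w" "T w y = T y w"
      "T w z = T z w" "T u x = T x u" "T u y = T y u" "T u z = T z u" "T u w = T w u"
      by (rule form_sym[OF f])+
    note e1 = vanishes_3D[OF f v(1), unfolded form_expand[OF f] sym k, simplified, folded One_nat_def]
    note e2 = vanishes_3D[OF f v(2), unfolded form_expand[OF f] sym k, simplified, folded One_nat_def]
    note e3 = vanishes_3D[OF f v(3), unfolded form_expand[OF f] sym k, simplified, folded One_nat_def]
    have k0: "R 1 x = 0" "R 2 x = 0" "R 2 y = 0" using e1(1) e2(3) e3(2) by linarith+
    have u: "T u u = 0" "R 1 u = 0" "R 2 u = 0" using e1(2) e2(2) e3(3) by linarith+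
    have w: "T w w = 0" "R 0 w = 0" using e2(1) e3(1) by linarith+
    have t: "T y u = 0" "T x u = 0" "T z w = 0" using e2(6) e3(6) e1(5) k0 u w by linarith+
    have r: "T z u = R 0 u" "R 2 w = - 3 * R 1 w" "T w u = - R 1 w" "R 0 u = - 2 * R 1 w"
      using e1(4,6) e2(4) e3(5) t u k0 by linarith+
    \<comment> \<open>With the relations found so far the two equations read
      \<open>T x w = 5 * R 1 w\<close> and \<open>T x w = R 1 w\<close>.\<close>
    have "R 1 w = 0" using e1(3) e3(4) r k0 w by (simp add: field_simps)
    then have "T z u = 0" "R 2 w = 0" "T w u = 0" "R 0 u = 0" "R 1 w = 0" "T x w = 0" "T y w = 0"
      using r e1(3) e2(5) e3(4) k0 w by linarith+
    with k k0 u w t show "null 3 [x, y, z, w, u] T R"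
      by (simp add: sym null_def cross_def All_less_Suc numeral_3_eq_3 numeral_2_eq_2)
  qed (use assms in \<open>auto simp: inner_expand inner_commute\<close>)
  note 1 = this
  have "solvable 3 (2 + 3) [x, y, z, w, u]"
    by (rule forced_seq[OF forced_skew 1]) (use assms in auto)
  then show ?thesis by simp
qed

text \<open>Twelve unknowns meet twelve equations. The second frame is the first one shifted along
  the \<open>x\<close>s, so that each sum in a mixed equation contains an entry that is already
  known to vanish, and the entries are found one after another.\<close>

lemma solvable_cross_4_3:
  fixes x1 x2 x3 x4 z1 z2 z3 :: "'v::real_inner"
  assumes "orthonormal [x1, x2, x3, x4, z1, z2, z3]"
  shows "solvable_cross 3 2 [x1, x2, x3, x4] [z1, z2, z3]"
proof -
  let ?bs = "[[mix x1 z1, mix x2 z2, mix x3 z3], [mix x2 z1, mix x3 z2, mix x4 z3]]"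
  show ?thesis
  proof (rule forcedI[of ?bs])
    fix T R assume f: "form T R"
      and n: "null 3 [x1, x2, x3, x4] T R \<and> null 3 [z1, z2, z3] T R"
      and v: "\<And>b. b \<in> set ?bs \<Longrightarrow> vanishes T R b"
    have v: "vanishes T R [mix x1 z1, mix x2 z2, mix x3 z3]"
      "vanishes T R [mix x2 z1, mix x3 z2, mix x4 z3]"
      by (rule v; simp)+
    have s: "T z x = T x z" if "x \<in> {x1, x2, x3, x4}" "z \<in> {z1, z2, z3}" for x z
      by (rule form_sym[OF f])
    show "cross [x1, x2, x3, x4] [z1, z2, z3] T R"
      using v n unfolding vanishes_3[OF f]
      by (simp add: form_expand[OF f] s null_def cross_def)
  qed (use assms in \<open>auto simp: inner_expand inner_commute\<close>)
qed

lemma solvable_skew_1: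
  fixes x z1 z2 z3 :: "'v::real_inner"
  assumes "orthonormal [x, z1, z2, z3]"
  shows "forced 3 1 (\<lambda>T R. skew [z1, z2, z3] T R \<and> null 3 [x] T R) (null 3 [x, z1, z2, z3])"
proof (rule forcedI[of "[[z2, z3, mix x z1]]"])
  fix T R assume f: "form T R"
    and n: "skew [z1, z2, z3] T R \<and> null 3 [x] T R"
    and v: "\<And>b. b \<in> set [[z2, z3, mix x z1]] \<Longrightarrow> vanishes T R b"
  have v: "vanishes T R [z2, z3, mix x z1]" by (rule v; simp)
  have k: "skew [z1, z2, z3] T R" and x: "T x x = 0" "R 0 x = 0" "R 1 x = 0" "R 2 x = 0"
    using n by (simp_all add: null_def cross_def)
  note k = skew_3D[OF k]
  have sym: "T z1 x = T x z1" "T z2 x = T x z2" "T z3 x = T x z3"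
    "T z2 z1 = T z1 z2" "T z3 z1 = T z1 z3" "T z3 z2 = T z2 z3"
    by (rule form_sym[OF f])+
  note e = vanishes_3D[OF f v, unfolded form_expand[OF f] sym k x, simplified, folded One_nat_def]
  have r: "R 1 z1 = 0" "R 2 z2 = 0" "R 2 z1 = 0" using e(1,2,4) by linarith+
  moreover have "T x z1 = 0" "T x z2 = 0" "T x z3 = 0" using r e(3,5,6) by linarith+
  ultimately show "null 3 [x, z1, z2, z3] T R"
    using k x by (simp add: sym null_def cross_def All_less_Suc numeral_3_eq_3 numeral_2_eq_2)
qed (use assms in \<open>auto simp: inner_expand inner_commute\<close>)

text \<open>The first frame keeps each \<open>z\<close> at its own position, where the skew part of
  \<open>R\<close> cancels, and sees only entries of \<open>T\<close>. The second permutes the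
  positions and brings in the three skew entries. This gives 12 equations for 9 + 3
  unknowns.\<close>

lemma solvable_skew_3:
  fixes x1 x2 x3 z1 z2 z3 :: "'v::real_inner"
  assumes "orthonormal [x1, x2, x3, z1, z2, z3]"
  shows "forced 3 2 (\<lambda>T R. skew [z1, z2, z3] T R \<and> null 3 [x1, x2, x3] T R)
    (null 3 [x1, x2, x3, z1, z2, z3])"
proof -
  let ?bs = "[[mix x1 z1, mix x2 z2, mix x3 z3], [z2, mix x1 z3, mix x2 z1]]"
  show ?thesis
  proof (rule forcedI[of ?bs])
    fix T R assume f: "form T R"
      and n: "skew [z1, z2, z3] T R \<and> null 3 [x1, x2, x3] T R"
      and v: "\<And>b. b \<in> set ?bs \<Longrightarrow> vanishes T R b"
    have v: "vanishes T R [mix x1 z1, mix x2 z2, mix x3 z3]"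
      "vanishes T R [z2, mix x1 z3, mix x2 z1]"
      by (rule v; simp)+
    have s: "T z x = T x z" if "x \<in> {x1, x2, x3}" "z \<in> {z1, z2, z3}" for x z
      by (rule form_sym[OF f])
    show "null 3 [x1, x2, x3, z1, z2, z3] T R"
      using v n unfolding vanishes_3[OF f]
      by (simp add: form_expand[OF f] s skew_def null_def cross_def All_less_Suc numeral_3_eq_3)
  qed (use assms in \<open>auto simp: inner_expand inner_commute\<close>)
qed


lemma solvable_3_base9:
  fixes x1 x2 x3 y1 y2 y3 z1 z2 z3 :: "'v::real_inner"
  assumes "orthonormal [x1, x2, x3, y1, y2, y3, z1, z2, z3]"
  shows "solvable 3 12 [x1, x2, x3, y1, y2, y3, z1, z2, z3]"
proof -
  let ?all = "[x1, x2, x3, y1, y2, y3, z1, z2, z3]"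
  let ?bs = "[[mix y1 x1, mix y2 x2, mix y3 x3], [x2, mix y1 x3, mix y2 x1],
    [mix z1 y1, mix z2 y2, mix z3 y3], [y2, mix z1 y3, mix z2 y1],
    [mix x1 z1, mix x2 z2, mix x3 z3], [z2, mix x1 z3, mix x2 z1]]"
  have "forced 3 6 (\<lambda>T R. skew [x1, x2, x3] T R \<and> skew [y1, y2, y3] T R \<and> skew [z1, z2, z3] T R)
    (null 3 ?all)"
  proof (rule forcedI[of ?bs])
    fix T R assume f: "form T R"
      and n: "skew [x1, x2, x3] T R \<and> skew [y1, y2, y3] T R \<and> skew [z1, z2, z3] T R"
      and v: "\<And>b. b \<in> set ?bs \<Longrightarrow> vanishes T R b"
    have v: "vanishes T R [mix y1 x1, mix y2 x2, mix y3 x3]" "vanishes T R [x2, mix y1 x3, mix y2 x1]"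
      "vanishes T R [mix z1 y1, mix z2 y2, mix z3 y3]" "vanishes T R [y2, mix z1 y3, mix z2 y1]"
      "vanishes T R [mix x1 z1, mix x2 z2, mix x3 z3]" "vanishes T R [z2, mix x1 z3, mix x2 z1]"
      by (rule v; simp)+
    note kx = skew_3D[OF n[THEN conjunct1]]
    note ky = skew_3D[OF n[THEN conjunct2, THEN conjunct1]]
    note kz = skew_3D[OF n[THEN conjunct2, THEN conjunct2]]
    have sym: "T x2 x1 = T x1 x2" "T x3 x1 = T x1 x3" "T x3 x2 = T x2 x3"
      "T y2 y1 = T y1 y2" "T y3 y1 = T y1 y3" "T y3 y2 = T y2 y3"
      "T z2 z1 = T z1 z2" "T z3 z1 = T z1 z3" "T z3 z2 = T z2 z3"
      "T y1 x1 = T x1 y1" "T y1 x2 = T x2 y1" "T y1 x3 = T x3 y1"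
      "T y2 x1 = T x1 y2" "T y2 x2 = T x2 y2" "T y2 x3 = T x3 y2"
      "T y3 x1 = T x1 y3" "T y3 x2 = T x2 y3" "T y3 x3 = T x3 y3"
      "T z1 y1 = T y1 z1" "T z1 y2 = T y2 z1" "T z1 y3 = T y3 z1"
      "T z2 y1 = T y1 z2" "T z2 y2 = T y2 z2" "T z2 y3 = T y3 z2"
      "T z3 y1 = T y1 z3" "T z3 y2 = T y2 z3" "T z3 y3 = T y3 z3"
      "T z1 x1 = T x1 z1" "T z1 x2 = T x2 z1" "T z1 x3 = T x3 z1"
      "T z2 x1 = T x1 z2" "T z2 x2 = T x2 z2" "T z2 x3 = T x3 z2"
      "T z3 x1 = T x1 z3" "T z3 x2 = T x2 z3" "T z3 x3 = T x3 z3"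
      by (rule form_sym[OF f])+
    note e1 = vanishes_3D[OF f v(1), unfolded form_expand[OF f] sym kx ky, simplified, folded One_nat_def]
    note e2 = vanishes_3D[OF f v(2), unfolded form_expand[OF f] sym kx ky, simplified, folded One_nat_def]
    note e3 = vanishes_3D[OF f v(3), unfolded form_expand[OF f] sym ky kz, simplified, folded One_nat_def]
    note e4 = vanishes_3D[OF f v(4), unfolded form_expand[OF f] sym ky kz, simplified, folded One_nat_def]
    note e5 = vanishes_3D[OF f v(5), unfolded form_expand[OF f] sym kz kx, simplified, folded One_nat_def]
    note e6 = vanishes_3D[OF f v(6), unfolded form_expand[OF f] sym kz kx, simplified, folded One_nat_def]
    \<comment> \<open>The second frame of each pair of triples involves the skew parts of both
      triples, so the pairs cannot be finished one at a time. The elimination goes in layers, each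
      using what the previous layer found for all three triples; the cyclic arrangement of the pairs
      makes this possible.\<close>
    have p: "R 1 x1 = 0" "R 1 y1 = 0" "R 1 z1 = 0" using e2(1) e4(1) e6(1) by linarith+
    have d: "T x1 y1 = 0" "T x2 y2 = 0" "T x3 y3 = 0" "T y1 z1 = 0" "T y2 z2 = 0" "T y3 z3 = 0"
      "T x1 z1 = 0" "T x2 z2 = 0" "T x3 z3 = 0"
      using e1(1-3) e3(1-3) e5(1-3) by linarith+
    have a: "T x2 y1 = - T x1 y2" "T x3 y1 = - T x1 y3" "T x3 y2 = - T x2 y3"
      "T y2 z1 = - T y1 z2" "T y3 z1 = - T y1 z3" "T y3 z2 = - T y2 z3"
      "T x2 z1 = - T x1 z2" "T x3 z1 = - T x1 z3" "T x3 z2 = - T x2 z3"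
      using e1(4-6) e3(4-6) e5(4-6) by linarith+
    have s: "R 2 x2 = 0" "R 2 y2 = 0" "R 2 z2 = 0" using e2(5) e4(5) e6(5) p d by linarith+
    have q: "R 2 x1 = 0" "T x1 y2 = 0" using e2(3,4) p d a s by linarith+
    have q': "R 2 y1 = 0" "T y1 z2 = 0" using e4(3,4) p d a s by linarith+
    have q'': "R 2 z1 = 0" "T x1 z2 = 0" using e6(3,4) p d a s by linarith+
    have g: "T x1 y3 = 0" "T x2 y3 = 0" "T y1 z3 = 0" "T y2 z3 = 0" "T x1 z3 = 0" "T x2 z3 = 0"
      using e2(2,6) e4(2,6) e6(2,6) p d a s q q' q'' by linarith+
    show "null 3 ?all T R"
      using kx ky kz p d a s q q' q'' g
      by (simp add: sym null_def cross_def All_less_Suc numeral_3_eq_3 numeral_2_eq_2)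
  qed (use assms in \<open>auto simp: inner_expand inner_commute\<close>)
  note 1 = this
  have 2: "forced 3 (2 + 2 + 2) (\<lambda>_ _. True)
      (\<lambda>T R. skew [x1, x2, x3] T R \<and> skew [y1, y2, y3] T R \<and> skew [z1, z2, z3] T R)"
  proof (rule forced_seq)
    show "forced 3 (2 + 2) (\<lambda>_ _. True) (\<lambda>T R. skew [x1, x2, x3] T R \<and> skew [y1, y2, y3] T R)"
      by (rule forced_seq[OF forced_skew forced_skew]) (use assms in auto)
    show "forced 3 2 (\<lambda>_ _. True) (skew [z1, z2, z3])"
      by (rule forced_skew) (use assms in auto)
  qed auto
  have "forced 3 (2 + 2 + 2 + 6) (\<lambda>_ _. True) (null 3 ?all)"
    by (rule forced_seq[OF 2 1]) auto
  then show ?thesis by simp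
qed

lemma four_cases:
  assumes "length xs \<ge> 4"
  obtains x1 x2 x3 x4 ys where "xs = [x1, x2, x3, x4] @ ys"
  using assms by (auto simp: numeral_eq_Suc Suc_le_length_iff)

lemma solvable_cross_3:
  fixes xs zs :: "'v::real_inner list"
  assumes "orthonormal (xs @ zs)" "length xs = 4 * k" "length zs = 3"
  shows "solvable_cross 3 (2 * k) xs zs"
  using assms(1,2)
proof (induction k arbitrary: xs)
  case 0
  then show ?case by (auto intro!: forced_trivial simp: cross_def)
next
  case (Suc k)
  obtain z1 z2 z3 where zs: "zs = [z1, z2, z3]" using assms(3) by (rule length_3_cases)
  obtain x1 x2 x3 x4 ys where xs: "xs = [x1, x2, x3, x4] @ ys"
    by (rule four_cases[of xs]) (use Suc.prems in auto)
  have "solvable_cross 3 (2 * k) ys zs"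
    by (rule Suc.IH) (use Suc.prems xs in auto)
  moreover have "solvable_cross 3 2 [x1, x2, x3, x4] zs"
    unfolding zs by (rule solvable_cross_4_3) (use Suc.prems(1) xs zs in \<open>simp add: orthonormal_append\<close>)
  ultimately have "solvable_cross 3 (2 + 2 * k) xs zs"
    unfolding xs by (intro solvable_cross_append_left)
  then show ?case by simp
qed

text \<open>The block between \<open>xs\<close> and \<open>zs\<close> has
  \<open>3 * (2 * k + 1)\<close> entries. Together with the three skew entries of \<open>R\<close>
  this makes \<open>6 * (k + 1)\<close>, so for odd length the postponed skew part exactly fills the
  last frame. Groups of four are peeled off by \<open>solvable_cross_4_3\<close> until one or three
  vectors remain.\<close>

lemma forced_skew_odd:
  fixes xs zs :: "'v::real_inner list"
  assumes "orthonormal (xs @ zs)" "length xs = 2 * k + 1" "length zs = 3"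
  shows "forced 3 (k + 1) (\<lambda>T R. skew zs T R \<and> null 3 xs T R) (null 3 (xs @ zs))"
  using assms(1,2)
proof (induction k arbitrary: xs rule: less_induct)
  case (less k)
  obtain z1 z2 z3 where zs: "zs = [z1, z2, z3]" using assms(3) by (rule length_3_cases)
  consider "k = 0" | "k = 1" | "k \<ge> 2" by linarith
  then show ?case
  proof cases
    case 1
    then obtain x where "xs = [x]" using less.prems(2) by (auto simp: length_Suc_conv)
    then show ?thesis using solvable_skew_1[of x z1 z2 z3] less.prems(1) 1 by (simp add: zs)
  next
    case 2
    then obtain x1 x2 x3 where "xs = [x1, x2, x3]"
      using less.prems(2) by (auto simp: length_Suc_conv numeral_eq_Suc)
    then show ?thesis
      using solvable_skew_3[of x1 x2 x3 z1 z2 z3] less.prems(1) 2 by (simp add: zs numeral_2_eq_2)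
  next
    case 3
    obtain x1 x2 x3 x4 ys where xs: "xs = [x1, x2, x3, x4] @ ys"
      by (rule four_cases[of xs]) (use less.prems 3 in auto)
    have "forced 3 (k - 2 + 1) (\<lambda>T R. skew zs T R \<and> null 3 ys T R) (null 3 (ys @ zs))"
      by (rule less.IH) (use less.prems xs 3 in auto)
    then have 1: "forced 3 (k - 2 + 1) (\<lambda>T R. skew zs T R \<and> null 3 xs T R)
        (\<lambda>T R. null 3 xs T R \<and> null 3 (ys @ zs) T R)"
      by (rule forced_pre) (auto simp: xs null_append simp del: append_Cons append_Nil)
    have 2: "solvable_cross 3 2 [x1, x2, x3, x4] zs"
      unfolding zs
      by (rule solvable_cross_4_3) (use less.prems(1) xs zs in \<open>simp add: orthonormal_append\<close>)
    have "forced 3 (k - 2 + 1 + 2) (\<lambda>T R. skew zs T R \<and> null 3 xs T R) (null 3 (xs @ zs))"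
    proof (rule forced_seq[OF 1 2])
      fix T R assume f: "form T R" and n: "null 3 xs T R \<and> null 3 (ys @ zs) T R"
      then show "null 3 [x1, x2, x3, x4] T R \<and> null 3 zs T R"
        by (simp only: xs null_append[OF f])
      assume "cross [x1, x2, x3, x4] zs T R"
      moreover have "cross ys zs T R" using n by (simp only: null_append[OF f])
      ultimately have "cross xs zs T R" by (simp only: xs) (auto simp: cross_def)
      then show "null 3 (xs @ zs) T R" using n by (simp only: null_append[OF f])
    qed
    moreover have "k - 2 + 1 + 2 = k + 1" using 3 by simp
    ultimately show ?thesis by (simp only:)
  qed
qed

text \<open>
  There are \<open>r (r + 7) / 2\<close> unknowns and \<open>6\<close> equations per frame, so hardly any equation may be wasted:
  going from \<open>r\<close> to \<open>r + 3\<close> is lossless for odd \<open>r\<close> if the skew part of the new \<open>R\<close> is left to the mixed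
  frames, and for \<open>4 dvd r\<close> the loss is absorbed by the rounding. The remaining \<open>r\<close>
  are reached through \<open>9\<close>, where \<open>12\<close> frames give exactly the \<open>72\<close> equations needed.
\<close>

lemma solvable_3:
  fixes xs :: "'v::real_inner list"
  assumes "orthonormal xs" "3 \<le> length xs" "length xs * (length xs + 7) \<le> 12 * n"
  shows "solvable 3 n xs"
  using assms
proof (induction "length xs" arbitrary: xs n rule: less_induct)
  case less
  obtain e1 e2 e3 es where es: "xs = e1 # e2 # e3 # es"
    using less.prems(2) by (auto simp: numeral_eq_Suc Suc_le_length_iff)
  have mono: "solvable 3 n xs" if "solvable 3 k xs" "k \<le> n" for k
    by (rule forced_mono[OF that, of "[e1, e2, e3]"]) (use less.prems(1) es in simp_all)
  have base3: "solvable 3 3 zs" if "length zs = 3" "orthonormal zs" for zs :: "'v list"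
    by (rule length_3_cases[OF that(1)]) (use that(2) solvable_3_base3 in blast)
  have base9: "solvable 3 12 zs" if "length zs = 9" "orthonormal zs" for zs :: "'v list"
  proof -
    obtain x1 x2 x3 x4 x5 x6 x7 x8 x9 where "zs = [x1, x2, x3, x4, x5, x6, x7, x8, x9]"
      using \<open>length zs = 9\<close> by (auto simp: numeral_eq_Suc length_Suc_conv)
    then show ?thesis using that(2) solvable_3_base9 by blast
  qed
  have split: thesis
    if k: "k < length xs" and *: "\<And>ys zs. xs = ys @ zs \<Longrightarrow> orthonormal (ys @ zs) \<Longrightarrow> orthonormal ys \<Longrightarrow> orthonormal zs \<Longrightarrow>
      length ys = length xs - k \<Longrightarrow> length zs = k \<Longrightarrow> thesis" for k thesis
  proof -
    obtain ys zs where yz: "xs = ys @ zs" "length ys = length xs - k" "length zs = k"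
      by (rule split_last[OF less_imp_le[OF k]])
    show thesis
      by (rule *[OF yz(1) _ _ _ yz(2,3)]) (use less.prems(1) yz(1) in \<open>simp_all add: orthonormal_append\<close>)
  qed
  \<comment> \<open>Even lengths from 6 on exceed an odd length by 3, lengths
    \<open>4 * k + 3\<close> exceed a multiple of 4 by 3, and lengths \<open>4 * k + 9\<close>
    exceed one by 9. The shorter list must again have at least three members, which leaves 3, 4, 5
    and 9 as bases.\<close>
  have "length xs = 3 \<or> length xs = 4 \<or> length xs = 5 \<or> length xs = 9 \<or>
      (\<exists>k. length xs = 2 * k + 4 \<and> k \<ge> 1) \<or> (\<exists>k. length xs = 4 * k + 3 \<and> k \<ge> 1) \<or>
      (\<exists>k. length xs = 4 * k + 9 \<and> k \<ge> 1)"
    using less.prems(2) by presburger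
  then consider "length xs = 3" | "length xs = 4" | "length xs = 5" | "length xs = 9"
    | k where "length xs = 2 * k + 4" "k \<ge> 1" | k where "length xs = 4 * k + 3" "k \<ge> 1"
    | k where "length xs = 4 * k + 9" "k \<ge> 1"
    by blast
  then show ?case
  proof cases
    case 1
    then show ?thesis using mono[of 3] base3 less.prems by auto
  next
    case 2
    then obtain x y z w where "xs = [x, y, z, w]" by (auto simp: numeral_eq_Suc length_Suc_conv)
    then show ?thesis using mono[of 4] solvable_3_base4[of x y z w] less.prems by simp
  next
    case 3
    then obtain x y z w u where "xs = [x, y, z, w, u]"
      by (auto simp: numeral_eq_Suc length_Suc_conv)
    then show ?thesis using mono[of 5] solvable_3_base5[of x y z w u] less.prems by simp
  next
    case 4
    then show ?thesis using mono[of 12] base9 less.prems by auto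
  next
    case (5 k)
    have len: "3 < length xs" using 5 by linarith
    obtain ys zs where yz: "xs = ys @ zs" "orthonormal (ys @ zs)" "orthonormal ys" "orthonormal zs"
      "length ys = length xs - 3" "length zs = 3"
      by (rule split[OF len])
    have ys: "length ys = 2 * k + 1" using yz(5) 5(1) by linarith
    obtain z1 z2 z3 where zs: "zs = [z1, z2, z3]" using yz(6) by (rule length_3_cases)
    have n: "(2 * k + 1) * (2 * k + 8) + 12 * (k + 3) \<le> 12 * n"
      using less.prems(3) by (simp add: 5 algebra_simps)
    have 1: "solvable 3 (n - (k + 3)) ys"
      by (rule less.hyps) (use 5 ys yz(3) n in \<open>simp_all add: algebra_simps\<close>)
    have 2: "forced 3 (n - (k + 3) + 2) (\<lambda>_ _. True) (\<lambda>T R. null 3 ys T R \<and> skew zs T R)"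
      by (rule forced_seq[OF 1 forced_skew[of z1 z2 z3]]) (use yz(2-4) ys zs in auto)
    have "solvable 3 (n - (k + 3) + 2 + (k + 1)) xs"
      unfolding yz(1) by (rule forced_seq[OF 2 forced_skew_odd]) (use yz(2-4,6) ys in auto)
    moreover have "n - (k + 3) + 2 + (k + 1) = n" using n by simp
    ultimately show ?thesis by (simp only:)
  next
    case (6 k)
    have len: "3 < length xs" using 6 by linarith
    obtain ys zs where yz: "xs = ys @ zs" "orthonormal (ys @ zs)" "orthonormal ys" "orthonormal zs"
      "length ys = length xs - 3" "length zs = 3"
      by (rule split[OF len])
    have ys: "length ys = 4 * k" using yz(5) 6(1) by linarith
    have n: "16 * (k * k) + 28 * k + 12 * (3 + 2 * k) \<le> 12 * n + 6"
      using less.prems(3) by (simp add: 6 algebra_simps)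
    \<comment> \<open>The step spends half a frame too much, a deficit of 6. After division by 4 the
      only possible failure is \<open>4 * k^2 + 13 * k + 8 = 3 * n\<close>, and modulo 3 that would
      require \<open>k^2 + k\<close> to be 1.\<close>
    have mod: "(k * k + k) mod 3 \<noteq> 1"
    proof -
      have "(k * k + k) mod 3 = (k * k mod 3 + k mod 3) mod 3" by (rule mod_add_eq[symmetric])
      moreover have "k * k mod 3 = (k mod 3) * (k mod 3) mod 3" by (rule mod_mult_eq[symmetric])
      moreover have "k mod 3 = 0 \<or> k mod 3 = 1 \<or> k mod 3 = 2" by linarith
      ultimately show ?thesis by auto
    qed
    have n': "16 * (k * k) + 28 * k + 12 * (3 + 2 * k) \<le> 12 * n"
    proof -
      define q where "q = k * k"
      have "4 * q + 13 * k + 9 \<le> 3 * n + 1" using n[folded q_def] by presburger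
      then have le: "4 * q + 13 * k + 8 \<le> 3 * n" by simp
      have "4 * q + 13 * k + 8 \<noteq> 3 * n"
      proof
        assume eq: "4 * q + 13 * k + 8 = 3 * n"
        have "4 * q + 13 * k + 8 = (q + k + 2) + 3 * (q + 4 * k + 2)" by simp
        then have "(q + k + 2) mod 3 = 3 * n mod 3" unfolding eq[symmetric] by (metis mod_mult_self2)
        then have "(q + k + 2) mod 3 = 0" by simp
        moreover have "x mod 3 = 1" if "(x + 2) mod 3 = 0" for x :: nat using that by presburger
        ultimately show False using mod by (simp add: q_def)
      qed
      with le have "4 * q + 13 * k + 9 \<le> 3 * n" by simp
      then have "4 * (4 * q + 13 * k + 9) \<le> 4 * (3 * n)" by (rule mult_le_mono2)
      then show ?thesis unfolding q_def by simp
    qed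
    have 1: "solvable 3 (n - (3 + 2 * k)) ys"
      by (rule less.hyps) (use 6 ys yz(3) n' in \<open>simp_all add: algebra_simps\<close>)
    have "solvable 3 (n - (3 + 2 * k) + 3 + 2 * k) xs"
      unfolding yz(1) by (rule solvable_append[OF 1 base3 solvable_cross_3]) (use yz(2-4,6) ys in auto)
    moreover have "n - (3 + 2 * k) + 3 + 2 * k = n" using n' by simp
    ultimately show ?thesis by (simp only:)
  next
    case (7 k)
    have len: "9 < length xs" using 7 by linarith
    obtain ys zs where yz: "xs = ys @ zs" "orthonormal (ys @ zs)" "orthonormal ys" "orthonormal zs"
      "length ys = length xs - 9" "length zs = 9"
      by (rule split[OF len])
    have ys: "length ys = 4 * k" using yz(5) 7(1) by linarith
    have n: "16 * (k * k) + 28 * k + 12 * (12 + 6 * k) \<le> 12 * n"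
      using less.prems(3) by (simp add: 7 algebra_simps)
    have 1: "solvable 3 (n - (12 + 6 * k)) ys"
      by (rule less.hyps) (use 7 ys yz(3) n in \<open>simp_all add: algebra_simps\<close>)
    obtain as bs cs where zs: "zs = as @ bs @ cs" "length as = 3" "length bs = 3" "length cs = 3"
    proof (rule that[of "take 3 zs" "take 3 (drop 3 zs)" "drop 3 (drop 3 zs)"])
      show "zs = take 3 zs @ take 3 (drop 3 zs) @ drop 3 (drop 3 zs)"
        by (simp only: append_take_drop_id)
    qed (use yz(6) in simp_all)
    have "solvable_cross 3 (2 * k + (2 * k + 2 * k)) ys zs"
      unfolding zs(1)
      by (intro solvable_cross_append_right solvable_cross_3)
        (use yz(2) ys zs in \<open>auto simp: orthonormal_append\<close>)
    with 1 base9[OF yz(6,4)] have "solvable 3 (n - (12 + 6 * k) + 12 + (2 * k + (2 * k + 2 * k))) xs"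
      unfolding yz(1) by (intro solvable_append)
    moreover have "n - (12 + 6 * k) + 12 + (2 * k + (2 * k + 2 * k)) = n" using n by simp
    ultimately show ?thesis by (simp only:)
  qed
qed

section \<open>The frames in matrix form\<close>

lemma solvable_exists:
  fixes xs :: "'v::real_inner list"
  assumes "d \<in> {1, 2, 3}" "orthonormal xs" "d \<le> length xs"
    and "length xs * (length xs + 1) div 2 + length xs * d \<le> m * d * (d + 1) div 2"
  shows "solvable d m xs"
proof -
  let ?r = "length xs"
  have "2 * (?r * (?r + 1) div 2) = ?r * (?r + 1)" "2 * (m * d * (d + 1) div 2) = m * d * (d + 1)"
    by (simp_all add: dvd_mult_div_cancel)
  then have *: "?r * (?r + 1) + 2 * (?r * d) \<le> m * d * (d + 1)"
    using assms(4) by linarith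
  consider "d = 1" | "d = 2" | "d = 3" using assms(1) by blast
  then show ?thesis
  proof cases
    case 1
    show ?thesis unfolding 1
      by (rule solvable_1) (use assms(2,3) * 1 in \<open>auto simp: algebra_simps\<close>)
  next
    case 2
    show ?thesis unfolding 2
      by (rule solvable_2) (use assms(2,3) * 2 in \<open>simp_all add: algebra_simps\<close>)
  next
    case 3
    show ?thesis unfolding 3
      by (rule solvable_3) (use assms(2,3) * 3 in \<open>simp_all add: algebra_simps\<close>)
  qed
qed

text \<open>Evaluating \<open>null\<close> on the standard basis yields all entries of
  \<open>T\<close> and \<open>R\<close>. The bijections \<open>f\<close> and \<open>g\<close> only
  number the blocks and the positions within a block.\<close>

lemma interpolating_frames:
  assumes "CARD('d::finite) \<in> {1, 2, 3}" "CARD('d) \<le> CARD('r::finite)"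
    and "CARD('r) * (CARD('r) + 1) div 2 + CARD('r) * CARD('d)
      \<le> CARD('s::finite) * CARD('d) * (CARD('d) + 1) div 2"
  obtains \<phi> :: "'s::finite \<Rightarrow> 'd::finite \<Rightarrow> real^('r::finite)" where
    "\<And>s i j. \<phi> s i \<bullet> \<phi> s j = (if i = j then 1 else 0)"
    "\<And>(T :: real^('r::finite)^('r::finite)) (R :: real^('d::finite)^('r::finite)). transpose T = T \<Longrightarrow>
      (\<And>s i j. \<phi> s i \<bullet> (T *v \<phi> s j) + (transpose R *v \<phi> s i) $ j + (transpose R *v \<phi> s j) $ i = 0) \<Longrightarrow>
      T = 0 \<and> R = 0"
proof -
  let ?d = "CARD('d)" and ?m = "CARD('s)"
  obtain l :: "'r list" where l: "set l = UNIV" "distinct l"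
    using finite_distinct_list[of "UNIV :: 'r set"] by auto
  define xs where "xs = map (\<lambda>i. axis i 1 :: real^'r) l"
  have len: "length xs = CARD('r)" using distinct_card[OF l(2)] l(1) by (simp add: xs_def)
  have "distinct l' \<Longrightarrow> orthonormal (map (\<lambda>i. axis i 1 :: real^'r) l')" for l'
    by (induction l') (auto simp: inner_axis_axis)
  then have "orthonormal xs" using l(2) by (simp add: xs_def)
  then have "solvable ?d ?m xs"
    using assms by (intro solvable_exists) (simp_all add: len)
  then obtain bs where bs: "length bs = ?m" "\<And>b. b \<in> set bs \<Longrightarrow> length b = ?d \<and> orthonormal b"
    and force: "\<And>T R. form T R \<Longrightarrow> (\<forall>b\<in>set bs. vanishes T R b) \<Longrightarrow> null ?d xs T R"
    unfolding forced_def by blast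
  obtain f :: "'s \<Rightarrow> nat" where f: "bij_betw f UNIV {0..<?m}"
    using ex_bij_betw_finite_nat[of "UNIV :: 's set"] by auto
  obtain g :: "'d \<Rightarrow> nat" where g: "bij_betw g UNIV {0..<?d}"
    using ex_bij_betw_finite_nat[of "UNIV :: 'd set"] by auto
  have fm: "f s < length bs" for s using f bs(1) by (auto simp: bij_betw_def)
  have gd: "g i < ?d" for i using g by (auto simp: bij_betw_def)
  have inj: "g i = g j \<longleftrightarrow> i = j" for i j using g by (auto simp: bij_betw_def inj_def)
  show ?thesis
  proof (rule that[of "\<lambda>s i. bs ! f s ! g i"])
    fix s :: 's and i j :: 'd
    show "bs ! f s ! g i \<bullet> bs ! f s ! g j = (if i = j then 1 else 0)"
      using orthonormal_nth[of "bs ! f s" "g i" "g j"] bs(2)[OF nth_mem[OF fm]] gd inj by simp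
  next
    fix T :: "real^'r^'r" and R :: "real^'d^'r"
    assume T: "transpose T = T" and z: "\<And>s i j. bs ! f s ! g i \<bullet> (T *v (bs ! f s ! g j)) +
        (transpose R *v (bs ! f s ! g i)) $ j + (transpose R *v (bs ! f s ! g j)) $ i = 0"
    define T' where "T' = (\<lambda>x y :: real^'r. x \<bullet> (T *v y))"
    define R' where "R' = (\<lambda>k (x :: real^'r). (transpose R *v x) $ inv g k)"
    have sym: "T' x y = T' y x" for x y
      unfolding T'_def using dot_lmul_matrix[of x T y] T
      by (metis inner_commute transpose_matrix_vector)
    have "form T' R'"
      unfolding form_def
    proof (intro conjI allI sym)
      show "bilinear T'"
        unfolding bilinear_def T'_def
        by (auto intro!: linearI simp: inner_add_left inner_add_right matrix_vector_right_distrib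
            matrix_vector_mult_scaleR)
      show "linear (R' k)" for k
        unfolding R'_def
        by (auto intro!: linearI simp: matrix_vector_right_distrib matrix_vector_mult_scaleR
            simp del: transpose_matrix_vector)
    qed
    moreover have "vanishes T' R' b" if b: "b \<in> set bs" for b
    proof -
      obtain k where "k < ?m" "b = bs ! k" using b bs(1) by (auto simp: in_set_conv_nth)
      moreover obtain s where "k = f s"
        using f \<open>k < ?m\<close> unfolding bij_betw_def by (metis atLeastLessThan_iff imageE le0)
      ultimately have bf: "b = bs ! f s" by simp
      show ?thesis
        unfolding vanishes_def
      proof (intro allI impI)
        fix j k assume "j < length b" "k < length b"
        then have "j < ?d" "k < ?d" using bs(2)[OF b] by auto
        then obtain i i' where "j = g i" "k = g i'"
          using g by (metis atLeastLessThan_iff bij_betwE bij_betw_imp_surj_on imageE zero_le)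
        moreover have "inv g (g i) = i" for i by (rule inv_f_f) (simp add: inj inj_def)
        ultimately show "T' (b ! j) (b ! k) + R' k (b ! j) + R' j (b ! k) = 0"
          using z[of s i i'] by (simp add: T'_def R'_def bf)
      qed
    qed
    ultimately have null: "null ?d xs T' R'" using force by blast
    have ax: "axis i 1 \<in> set xs" for i using l(1) by (simp add: xs_def)
    have "T $ i $ j = 0" for i j
    proof -
      have "T' (axis i 1) (axis j 1) = 0" using null ax by (auto simp: null_def cross_def)
      then show ?thesis
        by (simp add: T'_def inner_axis' matrix_vector_mult_basis column_def)
    qed
    moreover have "R $ i $ j = 0" for i j
    proof -
      have "R' (g j) (axis i 1) = 0" using null ax gd by (auto simp: null_def)
      moreover have "inv g (g j) = j" by (rule inv_f_f) (simp add: inj inj_def)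
      ultimately show ?thesis
        by (simp add: R'_def matrix_vector_mult_basis column_def transpose_def)
    qed
    ultimately show "T = 0 \<and> R = 0" by (simp add: vec_eq_iff)
  qed
qed

section \<open>Matrices\<close>

lemma bounded_bilinear_matrix_mult:
  "bounded_bilinear ((**) :: real^'n^'m \<Rightarrow> real^'k^'n \<Rightarrow> real^'k^'m)"
proof -
  have "bilinear ((**) :: real^'n^'m \<Rightarrow> real^'k^'n \<Rightarrow> real^'k^'m)"
    unfolding bilinear_def
    by (auto intro!: linearI simp: matrix_matrix_mult_def vec_eq_iff sum.distrib
        sum_distrib_left distrib_left distrib_right mult_ac)
  then show ?thesis by (simp add: bilinear_conv_bounded_bilinear)
qed

interpretation mmult: bounded_bilinear "(**) :: real^'n^'m \<Rightarrow> real^'k^'n \<Rightarrow> real^'k^'m"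
  by (rule bounded_bilinear_matrix_mult)

lemma bounded_linear_transpose: "bounded_linear (transpose :: real^'n^'m \<Rightarrow> real^'m^'n)"
  by (auto intro!: linear_conv_bounded_linear[THEN iffD1] linearI simp: transpose_def vec_eq_iff)

lemma bounded_linear_mat_of_sym: "bounded_linear (mat_of_sym :: 'n::finite symmat \<Rightarrow> real^'n^'n)"
  by (auto intro!: linear_conv_bounded_linear[THEN iffD1] linearI)

lemmas mat_of_sym_sum = linear_sum[OF bounded_linear.linear[OF bounded_linear_mat_of_sym]]

lemmas transpose_add = linear_add[OF bounded_linear.linear[OF bounded_linear_transpose]]
  and transpose_diff = linear_diff[OF bounded_linear.linear[OF bounded_linear_transpose]]
  and transpose_minus = linear_neg[OF bounded_linear.linear[OF bounded_linear_transpose]]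
  and transpose_zero = linear_0[OF bounded_linear.linear[OF bounded_linear_transpose]]
  and transpose_scaleR = linear_scale[OF bounded_linear.linear[OF bounded_linear_transpose]]

lemma inner_matrix_mult_left:
  fixes A :: "real^'n^'m" and B :: "real^'k^'n"
  shows "(A ** B) \<bullet> C = B \<bullet> (transpose A ** C)"
  by (simp add: inner_matrix_eq_trace matrix_transpose_mul matrix_mul_assoc)

lemma inner_transpose: "transpose A \<bullet> transpose B = A \<bullet> (B :: real^'n^'m)"
  by (simp add: inner_matrix_eq_trace trace_mul_sym[of "A" "transpose B"])
    (metis inner_commute inner_matrix_eq_trace)

lemma inner_matrix_mult_right:
  fixes A :: "real^'n^'m" and B :: "real^'k^'n"
  shows "(A ** B) \<bullet> C = A \<bullet> (C ** transpose B)"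
  using inner_matrix_mult_left[of "transpose B" "transpose A" "transpose C"]
  by (metis inner_transpose matrix_transpose_mul transpose_transpose)

lemma mat_of_sym_eq_iff: "mat_of_sym X = mat_of_sym Y \<longleftrightarrow> X = Y"
  by (rule mat_of_sym_inject)

lemma inner_gram: "X \<bullet> gram F = (mat_of_sym X ** F) \<bullet> F"
  by (simp add: inner_symmat_def mat_of_sym_gram inner_matrix_mult_right)

lemma bm_objective_eq: "bm_objective C F = C \<bullet> gram F"
  by (simp add: bm_objective_def inner_symmat_def mat_of_sym_gram inner_matrix_eq_trace matrix_mul_assoc)

lemma inner_sym_mult:
  "(mat_of_sym X ** F) \<bullet> G = F \<bullet> (mat_of_sym X ** G)"
  by (simp add: inner_matrix_mult_left)

lemma psd_gram: "psd (gram F)"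
proof -
  have "v \<bullet> (mat_of_sym (gram F) *v v) = (transpose F *v v) \<bullet> (transpose F *v v)" for v
    by (simp add: mat_of_sym_gram dot_lmul_matrix vector_transpose_matrix
        flip: matrix_vector_mul_assoc)
  then show ?thesis by (simp add: psd_def)
qed

lemma continuous_on_gram: "continuous_on S (gram :: real^'r^'n \<Rightarrow> 'n::finite symmat)"
proof -
  have "continuous_on S (\<lambda>F. mat_of_sym (gram F :: 'n symmat))" for S :: "(real^'r^'n) set"
    unfolding mat_of_sym_gram
    by (intro mmult.continuous_on bounded_linear.continuous_on[OF bounded_linear_transpose] continuous_on_id)
  then show ?thesis
    unfolding continuous_on_iff dist_norm norm_symmat_def by simp
qed

lemma constraint_adjoint_diff:
  "constraint_adjoint A (x - y) = constraint_adjoint A x - constraint_adjoint A y"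
  by (simp add: constraint_adjoint_def scaleR_left_diff_distrib sum_subtractf)

lemma mat_constraint_adjoint_mult:
  "mat_of_sym (constraint_adjoint A y) ** F = (\<Sum>i\<in>UNIV. y $ i *\<^sub>R (mat_of_sym (A i) ** F))"
  by (simp add: constraint_adjoint_def mat_of_sym_sum mmult.sum_left mmult.scaleR_left)

text \<open>The flow is the power series of exp(t L) x, convergent because \<open>L\<close> is
  bounded. Each coordinate \<open>c t \<bullet> e\<close> is a real power series, which can be
  differentiated term by term.\<close>

lemma linear_flow:
  fixes L :: "'a::euclidean_space \<Rightarrow> 'a"
  assumes "linear L"
  obtains c where "c 0 = x" "\<And>t. (c has_vector_derivative L (c t)) (at t)"
proof -
  have bl: "bounded_linear L" using assms by (simp add: linear_conv_bounded_linear)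
  obtain K where K: "K > 0" "\<And>v. norm (L v) \<le> norm v * K"
    using bounded_linear.pos_bounded[OF bl] by blast
  define p where "p n = (L ^^ n) x" for n
  have p: "p 0 = x" "p (Suc n) = L (p n)" for n by (simp_all add: p_def)
  have bound: "norm (p n) \<le> norm x * K ^ n" for n
  proof (induction n)
    case (Suc n)
    have "norm (p (Suc n)) \<le> norm (p n) * K" by (simp add: p K(2))
    also have "\<dots> \<le> norm x * K ^ n * K" using Suc K(1) by (intro mult_right_mono) auto
    finally show ?case by (simp add: mult_ac)
  qed (simp add: p)
  have summ: "summable (\<lambda>n. (t ^ n / fact n) *\<^sub>R p n)" for t
  proof (rule summable_comparison_test[OF exI[of _ 0]], safe)
    show "norm ((t ^ n / fact n) *\<^sub>R p n) \<le> norm x * (inverse (fact n) * (\<bar>t\<bar> * K) ^ n)" for n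
      using mult_left_mono[OF bound[of n], of "\<bar>t\<bar> ^ n / fact n"]
      by (simp add: power_abs power_mult_distrib divide_simps mult_ac)
    show "summable (\<lambda>n. norm x * (inverse (fact n) * (\<bar>t\<bar> * K) ^ n))"
      by (intro summable_mult summable_exp)
  qed
  define c where "c t = (\<Sum>n. (t ^ n / fact n) *\<^sub>R p n)" for t
  have inner: "summable (\<lambda>n. (p n \<bullet> e / fact n) * t ^ n)"
    "c t \<bullet> e = (\<Sum>n. (p n \<bullet> e / fact n) * t ^ n)" for t e
  proof -
    have *: "((t ^ n / fact n) *\<^sub>R p n) \<bullet> e = (p n \<bullet> e / fact n) * t ^ n" for n
      by (simp add: mult.commute)
    show "summable (\<lambda>n. (p n \<bullet> e / fact n) * t ^ n)"
      using bounded_linear.summable[OF bounded_linear_inner_left[of e] summ[of t]] by (simp only: *)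
    show "c t \<bullet> e = (\<Sum>n. (p n \<bullet> e / fact n) * t ^ n)"
      using bounded_linear.suminf[OF bounded_linear_inner_left[of e] summ[of t]] by (simp only: * c_def)
  qed
  have Lc: "L (c t) \<bullet> e = (\<Sum>n. diffs (\<lambda>n. p n \<bullet> e / fact n) n * t ^ n)" for t e
  proof -
    have *: "L ((t ^ n / fact n) *\<^sub>R p n) \<bullet> e = diffs (\<lambda>n. p n \<bullet> e / fact n) n * t ^ n" for n
    proof -
      have "real (Suc n) * (v / fact (Suc n)) = v / fact n" for v :: real
        unfolding fact_Suc of_nat_mult by (simp del: of_nat_Suc)
      then have "diffs (\<lambda>n. p n \<bullet> e / fact n) n = p (Suc n) \<bullet> e / fact n"
        by (simp only: diffs_def)
      then show ?thesis by (simp add: linear_scale[OF assms] p)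
    qed
    show ?thesis
      using bounded_linear.suminf[OF bounded_linear_compose[OF bounded_linear_inner_left[of e] bl] summ[of t]]
      by (simp only: c_def *)
  qed
  show ?thesis
  proof
    show "c 0 = x"
      unfolding c_def by (subst suminf_finite[of "{0}"]) (auto simp: p)
    show "(c has_vector_derivative L (c t)) (at t)" for t
      unfolding has_vector_derivative_def
    proof (subst has_derivative_componentwise_within, intro ballI)
      fix e :: 'a
      have "((\<lambda>t. c t \<bullet> e) has_field_derivative L (c t) \<bullet> e) (at t)"
        unfolding inner Lc by (rule termdiffs_strong_converges_everywhere[OF inner(1)])
      then show "((\<lambda>t. c t \<bullet> e) has_derivative (\<lambda>h. h *\<^sub>R L (c t) \<bullet> e)) (at t)"
        by (simp add: has_field_derivative_def mult.commute[of _ "L (c t) \<bullet> e"] mult_commute_abs)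
    qed
  qed
qed

lemma orth_proj_eqI:
  assumes "subspace T" "p \<in> T" "\<And>v. v \<in> T \<Longrightarrow> (w - p) \<bullet> v = 0"
  shows "orth_proj T w = p"
  unfolding orth_proj_def
proof (rule the_equality)
  fix q assume q: "q \<in> T \<and> (\<forall>v\<in>T. (w - q) \<bullet> v = 0)"
  then have d: "p - q \<in> T" using assms subspace_diff by blast
  have "(p - q) \<bullet> (p - q) = (w - q) \<bullet> (p - q) - (w - p) \<bullet> (p - q)"
    by (simp add: inner_diff_left)
  also have "\<dots> = 0" using q assms(3) d by simp
  finally show "q = p" by simp
qed (use assms in auto)

section \<open>Constraints with pairwise orthogonal normals\<close>

text \<open>For \<open>X = gram F\<close> the second assumption says that the normals
  \<open>A i ** F\<close> of the feasible set are pairwise orthogonal with squared length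
  \<open>w i\<close>. Lagrange multipliers are then quotients, continuous in the point, instead of
  solutions of a linear system. The last assumption makes the trace constant on the feasible set and
  so bounds it.\<close>

locale regular_constraints =
  fixes A :: "'m::finite \<Rightarrow> 'n::finite symmat" and b :: "real^'m" and w :: "'m \<Rightarrow> real"
  assumes w_pos: "w i > 0"
    and orthogonal_constraints: "constraint_map A X = b \<Longrightarrow>
      (mat_of_sym (A i) ** mat_of_sym X) \<bullet> mat_of_sym (A j) = (if i = j then w i else 0)"
    and identity_constraint: "\<exists>e. constraint_adjoint A e = Symmat (mat 1)"
begin

lemma sum_delta_mult:
  "(\<Sum>j\<in>UNIV. f j * (if i = j then w i else 0)) = f i * w i"
  "(\<Sum>j\<in>UNIV. f j * (if i = j then w i else 0) / w j) = f i"
proof -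
  have *: "f j * (if i = j then w i else 0) / d j = (if i = j then f i * w i / d i else 0)" for d j
    by simp
  from *[of _ "\<lambda>_. 1"] show "(\<Sum>j\<in>UNIV. f j * (if i = j then w i else 0)) = f i * w i"
    by simp
  show "(\<Sum>j\<in>UNIV. f j * (if i = j then w i else 0) / w j) = f i"
    using w_pos[of i] by (subst *) simp
qed

text \<open>The coefficients of the normal component of C F, written through
  \<open>X = gram F\<close>. In this form they are invariant under rotations of \<open>F\<close> and
  continuous in every \<open>X\<close>, feasible or not, which the perturbation argument relies
  on.\<close>

definition multiplier :: "'n symmat \<Rightarrow> 'n symmat \<Rightarrow> real^'m" where
  "multiplier C X = (\<chi> i. (mat_of_sym (A i) ** mat_of_sym X) \<bullet> mat_of_sym C / w i)"

definition slack :: "'n symmat \<Rightarrow> 'n symmat \<Rightarrow> 'n symmat" where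
  "slack C X = C - constraint_adjoint A (multiplier C X)"

definition tangent :: "real^'r^'n \<Rightarrow> (real^'r^'n) set" where
  "tangent F = {U. \<forall>i. (mat_of_sym (A i) ** F) \<bullet> U = 0}"

lemma bm_feasible_iff:
  "F \<in> bm_feasible A b \<longleftrightarrow> (\<forall>i. (mat_of_sym (A i) ** F) \<bullet> F = b $ i)"
  by (simp add: bm_feasible_def constraint_map_def vec_eq_iff inner_gram)

lemma inner_constraints:
  assumes "F \<in> bm_feasible A b"
  shows "(mat_of_sym (A i) ** F) \<bullet> (mat_of_sym (A j) ** F) = (if i = j then w i else 0)"
proof -
  have "(mat_of_sym (A i) ** F) \<bullet> (mat_of_sym (A j) ** F) =
      (mat_of_sym (A j) ** F) \<bullet> (mat_of_sym (A i) ** F)"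
    by (rule inner_commute)
  also have "\<dots> = mat_of_sym (A j) \<bullet> (mat_of_sym (A i) ** mat_of_sym (gram F))"
    by (simp add: inner_matrix_mult_right mat_of_sym_gram matrix_mul_assoc)
  also have "\<dots> = (if i = j then w i else 0)"
    using orthogonal_constraints[of "gram F" i j] assms by (simp add: bm_feasible_def inner_commute)
  finally show ?thesis .
qed

lemma adjoint_mult_eq_0:
  assumes "F \<in> bm_feasible A b" "mat_of_sym (constraint_adjoint A y) ** F = 0"
  shows "y = 0"
proof -
  have "y $ i = 0" for i
  proof -
    have "0 = (mat_of_sym (A i) ** F) \<bullet> (mat_of_sym (constraint_adjoint A y) ** F)"
      by (simp add: assms(2))
    also have "\<dots> = y $ i * w i"
      by (simp add: mat_constraint_adjoint_mult inner_sum_right inner_constraints[OF assms(1)] sum_delta_mult)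
    finally show ?thesis using w_pos[of i] by simp
  qed
  then show ?thesis by (simp add: vec_eq_iff)
qed

text \<open>Up to the factors \<open>w\<close>, the symmetrized products of the \<open>A j\<close>
  with \<open>X\<close> form a family dual to the \<open>A i\<close>.\<close>

lemma surj_constraint_map:
  assumes "constraint_map A X = b"
  shows "surj (constraint_map A)"
proof (rule surjI)
  fix y :: "real^'m"
  define B where "B j = Symmat ((1 / 2) *\<^sub>R (mat_of_sym (A j) ** mat_of_sym X + mat_of_sym X ** mat_of_sym (A j)))" for j
  have B: "mat_of_sym (B j) = (1 / 2) *\<^sub>R (mat_of_sym (A j) ** mat_of_sym X + mat_of_sym X ** mat_of_sym (A j))" for j
    unfolding B_def
    by (rule mat_of_sym_Symmat)
      (simp add: transpose_scaleR transpose_add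
        matrix_transpose_mul add.commute)
  have "A i \<bullet> B j = (if i = j then w i else 0)" for i j
  proof -
    have "mat_of_sym (A i) \<bullet> (mat_of_sym X ** mat_of_sym (A j)) =
        mat_of_sym (A i) \<bullet> (mat_of_sym (A j) ** mat_of_sym X)"
      by (metis inner_transpose matrix_transpose_mul transpose_mat_of_sym)
    then have "A i \<bullet> B j = (mat_of_sym (A j) ** mat_of_sym X) \<bullet> mat_of_sym (A i)"
      by (simp add: inner_symmat_def B inner_add_right inner_commute)
    then show ?thesis using orthogonal_constraints[OF assms, of j i] by auto
  qed
  then show "constraint_map A (\<Sum>j\<in>UNIV. (y $ j / w j) *\<^sub>R B j) = y"
    using sum_delta_mult(2)[of "\<lambda>j. y $ j"]
    by (simp add: constraint_map_def vec_eq_iff inner_sum_right)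
qed

lemma slack_mult:
  "mat_of_sym (slack C X) ** F =
    mat_of_sym C ** F - (\<Sum>i\<in>UNIV. multiplier C X $ i *\<^sub>R (mat_of_sym (A i) ** F))"
  by (simp add: slack_def mmult.diff_left mat_constraint_adjoint_mult)

lemma multiplier_gram:
  "multiplier C (gram F) $ i = (mat_of_sym (A i) ** F) \<bullet> (mat_of_sym C ** F) / w i"
  by (simp add: multiplier_def mat_of_sym_gram inner_commute inner_matrix_mult_right matrix_mul_assoc)

lemma slack_tangent:
  assumes "F \<in> bm_feasible A b"
  shows "mat_of_sym (slack C (gram F)) ** F \<in> tangent F"
  using w_pos
  by (simp add: tangent_def slack_mult inner_diff_right inner_sum_right inner_constraints[OF assms]
      multiplier_gram sum_delta_mult less_imp_neq[THEN not_sym])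

lemma inner_tangent:
  assumes "U \<in> tangent F"
  shows "(mat_of_sym (constraint_adjoint A y) ** F) \<bullet> U = 0"
  using assms by (simp add: mat_constraint_adjoint_mult inner_sum_left tangent_def)

lemma subspace_tangent: "subspace (tangent F)"
  by (auto simp: subspace_def tangent_def inner_add_right)

definition proj :: "real^'r^'n \<Rightarrow> real^'r^'n \<Rightarrow> real^'r^'n" where
  "proj F V = V - (\<Sum>i\<in>UNIV. ((mat_of_sym (A i) ** F) \<bullet> V / w i) *\<^sub>R (mat_of_sym (A i) ** F))"

lemma orth_proj_tangent:
  assumes "F \<in> bm_feasible A b"
  shows "proj F V \<in> tangent F" "orth_proj (tangent F) V = proj F V"
    "U \<in> tangent F \<Longrightarrow> proj F V \<bullet> U = V \<bullet> U"
proof -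
  show 1: "proj F V \<in> tangent F"
    using w_pos by (simp add: tangent_def proj_def inner_diff_right inner_sum_right
        inner_constraints[OF assms] sum_delta_mult less_imp_neq[THEN not_sym])
  show 2: "proj F V \<bullet> U = V \<bullet> U" if "U \<in> tangent F" for U
    using that by (simp add: proj_def inner_diff_left inner_sum_left tangent_def)
  show "orth_proj (tangent F) V = proj F V"
    by (rule orth_proj_eqI[OF subspace_tangent 1]) (simp add: inner_diff_left 2)
qed

lemma inner_slack:
  assumes "constraint_map A X = b"
  shows "C \<bullet> X = (C - constraint_adjoint A y) \<bullet> X + b \<bullet> y"
  using constraint_adjoint[of A X y] assms
  by (simp add: inner_diff_left inner_commute[of "constraint_adjoint A y"])

lemma compact_bm_feasible: "compact (bm_feasible A b :: (real^'r^'n) set)"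
proof -
  obtain e where e: "constraint_adjoint A e = Symmat (mat 1)" using identity_constraint by blast
  have "(norm F)\<^sup>2 = b \<bullet> e" if "F \<in> bm_feasible A b" for F :: "real^'r^'n"
  proof -
    have "b \<bullet> e = gram F \<bullet> Symmat (mat 1)"
      using that constraint_adjoint[of A "gram F" e] by (simp add: bm_feasible_def e)
    also have "\<dots> = F \<bullet> F"
      by (simp add: inner_commute[of "gram F"] inner_gram mat_of_sym_Symmat)
    finally show ?thesis by (simp add: power2_norm_eq_inner)
  qed
  then have "norm F \<le> sqrt (b \<bullet> e)" if "F \<in> bm_feasible A b" for F :: "real^'r^'n"
    using that by (metis order_refl real_sqrt_abs abs_norm_cancel)
  then have "bounded (bm_feasible A b :: (real^'r^'n) set)"
    unfolding bounded_iff by blast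
  moreover have "closed (bm_feasible A b :: (real^'r^'n) set)"
  proof -
    have "bm_feasible A b = (\<Inter>i. {F :: real^'r^'n. A i \<bullet> gram F = b $ i})"
      by (auto simp: bm_feasible_def constraint_map_def vec_eq_iff)
    moreover have "closed {F :: real^'r^'n. A i \<bullet> gram F = b $ i}" for i
      by (intro closed_Collect_eq continuous_on_inner continuous_on_const continuous_on_gram)
    ultimately show ?thesis by auto
  qed
  ultimately show ?thesis by (simp add: compact_eq_bounded_closed)
qed

end

section \<open>Second order stationary points\<close>

text \<open>
  The assumption below extends a tangent vector to a linear vector field along which all constraint
  functions are constant; its flow provides the curves that define the tangent space.
\<close>

locale bm_manifold = regular_constraints A b w
  for A :: "'m::finite \<Rightarrow> 'n::finite symmat" and b :: "real^'m" and w :: "'m \<Rightarrow> real" +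
  fixes factor :: "'r::finite itself"
  assumes tangent_generator: "F \<in> bm_feasible A b \<Longrightarrow> U \<in> tangent F \<Longrightarrow>
    \<exists>L. linear L \<and> L F = U \<and> (\<forall>(G :: real^'r^'n) i. (mat_of_sym (A i) ** G) \<bullet> L G = 0)"
begin

abbreviation M :: "(real^'r^'n) set" where
  "M \<equiv> bm_feasible A b"

lemma curve_mult:
  "(c has_vector_derivative u) net \<Longrightarrow> ((\<lambda>t. B ** c t) has_vector_derivative B ** u) net"
  for c :: "real \<Rightarrow> real^'r^'n" and B :: "real^'n^'n"
  by (rule bounded_linear.has_vector_derivative[OF mmult.bounded_linear_right])

lemma curve_inner:
  fixes c :: "real \<Rightarrow> real^'r^'n" and B D :: "real^'n^'n"
  assumes "(c has_vector_derivative u) (at t)"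
  shows "((\<lambda>t. (B ** c t) \<bullet> (D ** c t)) has_field_derivative
    (B ** c t) \<bullet> (D ** u) + (B ** u) \<bullet> (D ** c t)) (at t)"
  unfolding has_real_derivative_iff_has_vector_derivative
  by (rule bounded_bilinear.has_vector_derivative[OF bounded_bilinear_inner curve_mult curve_mult];
      rule assms)

lemma curve_quadratic:
  fixes c :: "real \<Rightarrow> real^'r^'n"
  assumes "(c has_vector_derivative u) (at t)"
  shows "((\<lambda>t. (mat_of_sym X ** c t) \<bullet> c t) has_field_derivative
    2 * ((mat_of_sym X ** c t) \<bullet> u)) (at t)"
proof -
  have "(mat_of_sym X ** u) \<bullet> c t = (mat_of_sym X ** c t) \<bullet> u"
    using inner_sym_mult[of X u "c t"] by (simp only: inner_commute[of u])
  then show ?thesis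
    using curve_inner[OF assms, of "mat_of_sym X" "mat 1"] by simp
qed

lemma curve_exists:
  assumes "F \<in> M" "U \<in> tangent F"
  obtains c where "curve_with_velocity M F U c" "range c \<subseteq> M"
proof -
  obtain L :: "real^'r^'n \<Rightarrow> real^'r^'n" where L: "linear L" "L F = U"
    and ortho: "\<And>G i. (mat_of_sym (A i) ** G) \<bullet> L G = 0"
    using tangent_generator[OF assms] by blast
  obtain c where c: "c 0 = F" "\<And>t. (c has_vector_derivative L (c t)) (at t)"
    using linear_flow[OF L(1), of F] by blast
  have in_M: "c t \<in> M" for t
  proof -
    have "(mat_of_sym (A i) ** c t) \<bullet> c t = (mat_of_sym (A i) ** c 0) \<bullet> c 0" for i
    proof -
      have "\<forall>t. ((\<lambda>t. (mat_of_sym (A i) ** c t) \<bullet> c t) has_field_derivative 0) (at t)"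
        using curve_quadratic[OF c(2), of "A i"] by (simp add: ortho)
      from DERIV_isconst_all[OF this, of t 0] show ?thesis .
    qed
    then show ?thesis using assms(1) by (simp add: bm_feasible_iff c(1))
  qed
  have bl: "bounded_linear (L ^^ k)" for k
  proof (induction k)
    case 0
    then show ?case by (simp add: bounded_linear_ident id_def)
  next
    case (Suc k)
    then show ?case
      using bounded_linear_compose[of L "L ^^ k"] L(1) by (simp add: linear_conv_bounded_linear o_def)
  qed
  have "smooth_on_interval I c" for I
    unfolding smooth_on_interval_def
  proof (intro exI[of _ "\<lambda>k t. (L ^^ k) (c t)"] conjI allI ballI)
    fix k t
    show "((\<lambda>t. (L ^^ k) (c t)) has_vector_derivative (L ^^ Suc k) (c t)) (at t)"
      using bounded_linear.has_vector_derivative[OF bl c(2)] by (simp add: funpow_swap1)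
  qed simp
  then have "curve_with_velocity M F U c"
    unfolding curve_with_velocity_def using in_M c(1) c(2)[of 0] L(2)
    by (auto intro!: exI[of _ "1::real"])
  then show thesis using that in_M by blast
qed

lemma curve_nbhd:
  assumes "curve_with_velocity M F U c"
  obtains e where "e > 0" "\<And>t. t \<in> {-e<..<e} \<Longrightarrow> c t \<in> M"
  using assms unfolding curve_with_velocity_def by blast

lemma tangent_space_eq:
  assumes "F \<in> M"
  shows "tangent_space M F = tangent F"
proof (intro set_eqI iffI)
  fix U assume "U \<in> tangent_space M F"
  then obtain c where c: "curve_with_velocity M F U c" by (auto simp: tangent_space_def)
  have d: "c 0 = F" "(c has_vector_derivative U) (at 0)"
    using c by (auto simp: curve_with_velocity_def)
  obtain e where e: "e > 0" "\<And>t. t \<in> {-e<..<e} \<Longrightarrow> c t \<in> M"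
    using curve_nbhd[OF c] by blast
  have "(mat_of_sym (A i) ** F) \<bullet> U = 0" for i
  proof -
    have *: "b $ i = (mat_of_sym (A i) ** c t) \<bullet> c t" if "t \<in> {-e<..<e}" for t
      using e(2)[OF that] by (simp only: bm_feasible_iff)
    have "((\<lambda>t. (mat_of_sym (A i) ** c t) \<bullet> c t) has_field_derivative 0) (at 0)"
      by (rule has_field_derivative_transform_within_open[OF DERIV_const open_greaterThanLessThan _ *])
        (use e(1) in simp_all)
    from DERIV_unique[OF this curve_quadratic[OF d(2), of "A i"]] show ?thesis by (simp add: d(1))
  qed
  then show "U \<in> tangent F" by (simp add: tangent_def)
next
  fix U assume "U \<in> tangent F"
  then show "U \<in> tangent_space M F"
    using curve_exists[OF assms, of U] unfolding tangent_space_def by blast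
qed

lemma riem_gradient_eq:
  assumes "F \<in> M"
  shows "riem_gradient M (bm_objective C) F = 2 *\<^sub>R (mat_of_sym (slack C (gram F)) ** F)"
proof -
  let ?g = "2 *\<^sub>R (mat_of_sym (slack C (gram F)) ** F)"
  have has: "(bm_objective C has_derivative (\<lambda>V. (mat_of_sym C ** F) \<bullet> V + (mat_of_sym C ** V) \<bullet> F)) (at F)"
  proof -
    have "((\<lambda>F. (mat_of_sym C ** F) \<bullet> F) has_derivative
        (\<lambda>V. (mat_of_sym C ** F) \<bullet> V + (mat_of_sym C ** V) \<bullet> F)) (at F)"
      by (intro bounded_bilinear.FDERIV[OF bounded_bilinear_inner] has_derivative_ident
          bounded_linear.has_derivative[OF mmult.bounded_linear_right])
    moreover have "bm_objective C = (\<lambda>F :: real^'r^'n. (mat_of_sym C ** F) \<bullet> F)"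
      by (simp add: fun_eq_iff bm_objective_eq inner_gram)
    ultimately show ?thesis by simp
  qed
  have D: "frechet_derivative (bm_objective C) (at F) V = 2 * ((mat_of_sym C ** F) \<bullet> V)" for V
    unfolding frechet_derivative_at[OF has, symmetric]
    using inner_sym_mult[of C V F] by (simp only: inner_commute[of V] mult_2)
  have g: "?g \<bullet> V = 2 * ((mat_of_sym C ** F) \<bullet> V)" if "V \<in> tangent F" for V
    using inner_tangent[OF that, of "multiplier C (gram F)"]
    by (simp add: slack_def mmult.diff_left inner_diff_left)
  have "?g \<in> tangent F"
    using slack_tangent[OF assms] subspace_scale[OF subspace_tangent] by blast
  show ?thesis
    unfolding riem_gradient_def tangent_space_eq[OF assms]
  proof (rule the_equality)
    fix h assume h: "h \<in> tangent F \<and> (\<forall>v\<in>tangent F. frechet_derivative (bm_objective C) (at F) v = h \<bullet> v)"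
    then have "h - ?g \<in> tangent F" using \<open>?g \<in> _\<close> subspace_diff[OF subspace_tangent] by blast
    then have "(h - ?g) \<bullet> (h - ?g) = 0" using h D g by (simp add: inner_diff_left)
    then show "h = ?g" by simp
  qed (use \<open>?g \<in> _\<close> g D in auto)
qed

text \<open>Along a curve the multipliers vary too, but their derivatives \<open>l'\<close> multiply
  the normals \<open>A i ** F\<close> and disappear in the projection; what is left depends on the
  velocity alone. The curve from \<open>curve_exists\<close> keeps the definite description from
  being vacuous.\<close>

lemma riem_hessian_eq:
  assumes F: "F \<in> M" and Z: "mat_of_sym (slack C (gram F)) ** F = 0" and u: "u \<in> tangent F"
  shows "riem_hessian M (bm_objective C) F u =
    proj F (2 *\<^sub>R (mat_of_sym (slack C (gram F)) ** u))" (is "_ = ?h")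
proof -
  have key: "\<exists>w. ((\<lambda>t. riem_gradient M (bm_objective C) (c t)) has_vector_derivative w) (at 0) \<and>
      ?h = orth_proj (tangent_space M F) w"
    if c: "curve_with_velocity M F u c" for c
  proof -
    have d: "c 0 = F" "(c has_vector_derivative u) (at 0)"
      using c by (auto simp: curve_with_velocity_def)
    obtain e where e: "e > 0" "\<And>t. t \<in> {-e<..<e} \<Longrightarrow> c t \<in> M"
      using curve_nbhd[OF c] by blast
    define l where "l t i = (mat_of_sym (A i) ** c t) \<bullet> (mat_of_sym C ** c t) / w i" for t i
    define l' where "l' i = ((mat_of_sym (A i) ** c 0) \<bullet> (mat_of_sym C ** u) +
      (mat_of_sym (A i) ** u) \<bullet> (mat_of_sym C ** c 0)) / w i" for i
    have l: "((\<lambda>t. l t i) has_field_derivative l' i) (at 0)" for i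
      unfolding l_def l'_def by (intro DERIV_cdivide curve_inner d)
    let ?w = "2 *\<^sub>R (mat_of_sym C ** u -
      (\<Sum>i\<in>UNIV. l 0 i *\<^sub>R (mat_of_sym (A i) ** u) + l' i *\<^sub>R (mat_of_sym (A i) ** c 0)))"
    have "((\<lambda>t. 2 *\<^sub>R (mat_of_sym C ** c t - (\<Sum>i\<in>UNIV. l t i *\<^sub>R (mat_of_sym (A i) ** c t))))
        has_vector_derivative ?w) (at 0)"
      by (intro bounded_linear.has_vector_derivative[OF bounded_linear_scaleR_right]
          has_vector_derivative_diff has_vector_derivative_sum has_vector_derivative_scaleR
          curve_mult d l)
    then have "((\<lambda>t. riem_gradient M (bm_objective C) (c t)) has_vector_derivative ?w) (at 0)"
      by (rule has_vector_derivative_transform_within_open[of _ _ _ "{-e<..<e}"])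
        (use e in \<open>auto simp: riem_gradient_eq slack_mult l_def multiplier_gram\<close>)
    moreover have "orth_proj (tangent F) ?w = ?h"
    proof (rule orth_proj_eqI[OF subspace_tangent])
      show "?h \<in> tangent F" by (rule orth_proj_tangent(1)[OF F])
      fix v assume v: "v \<in> tangent F"
      have "?w = 2 *\<^sub>R (mat_of_sym (slack C (gram F)) ** u) - 2 *\<^sub>R (\<Sum>i\<in>UNIV. l' i *\<^sub>R (mat_of_sym (A i) ** F))"
      proof -
        have m: "multiplier C (gram F) $ i = l 0 i" for i
          by (simp add: multiplier_gram l_def d(1))
        show ?thesis
          unfolding slack_mult m d(1) sum.distrib by (simp add: scaleR_right_diff_distrib scaleR_right_distrib)
      qed
      moreover have "(\<Sum>i\<in>UNIV. l' i *\<^sub>R (mat_of_sym (A i) ** F)) \<bullet> v = 0"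
        using v by (simp add: inner_sum_left tangent_def)
      ultimately have "?w \<bullet> v = (2 *\<^sub>R (mat_of_sym (slack C (gram F)) ** u)) \<bullet> v"
        by (simp only: inner_diff_left inner_scaleR_left)
      then show "(?w - ?h) \<bullet> v = 0"
        using orth_proj_tangent(3)[OF F v, of "2 *\<^sub>R (mat_of_sym (slack C (gram F)) ** u)"]
        by (simp only: inner_diff_left)
    qed
    ultimately show ?thesis
      unfolding tangent_space_eq[OF F] by (intro exI[of _ ?w] conjI) (simp_all only:)
  qed
  obtain c where c: "curve_with_velocity M F u c" "range c \<subseteq> M" by (rule curve_exists[OF F u])
  show ?thesis
    unfolding riem_hessian_def
  proof (rule the_equality)
    fix h assume "\<forall>c. curve_with_velocity M F u c \<longrightarrow>
      (\<exists>w. ((\<lambda>t. riem_gradient M (bm_objective C) (c t)) has_vector_derivative w) (at 0) \<and>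
        h = orth_proj (tangent_space M F) w)"
    then obtain w where "((\<lambda>t. riem_gradient M (bm_objective C) (c t)) has_vector_derivative w) (at 0)"
      "h = orth_proj (tangent_space M F) w" using c(1) by blast
    moreover obtain w' where "((\<lambda>t. riem_gradient M (bm_objective C) (c t)) has_vector_derivative w') (at 0)"
      "?h = orth_proj (tangent_space M F) w'" using key[OF c(1)] by blast
    ultimately show "h = ?h"
      using vector_derivative_unique_at[of "\<lambda>t. riem_gradient M (bm_objective C) (c t)" w 0 w'] by simp
  qed (use key in blast)
qed

text \<open>The second order condition is obtained without second derivatives of curves. On
  \<open>M\<close> the cost differs from \<open>?Z \<bullet> gram G\<close> by a constant, and since
  \<open>?Z\<close> annihilates \<open>F\<close> this is a quadratic form in \<open>G - F\<close>.
  Scaling \<open>c t - F\<close> by the inverse of \<open>t\<close> and passing to the limit leaves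
  the form at the velocity.\<close>

lemma local_minimum:
  assumes F: "F \<in> M" and e: "e > 0" "\<And>G. G \<in> M \<Longrightarrow> dist G F < e \<Longrightarrow> bm_objective C F \<le> bm_objective C G"
  shows "mat_of_sym (slack C (gram F)) ** F = 0" "sosp M (bm_objective C) F"
proof -
  let ?Z = "slack C (gram F)"
  have near: "\<exists>d>0. \<forall>t. \<bar>t\<bar> < d \<longrightarrow> bm_objective C F \<le> bm_objective C (c t)"
    if c: "c 0 = F" "(c has_vector_derivative U) (at 0)" "\<And>t. c t \<in> M" for c U
  proof -
    have "isCont c 0" using c(2) has_vector_derivative_continuous by blast
    then obtain d where "d > 0" "\<And>t. dist t 0 < d \<Longrightarrow> dist (c t) (c 0) < e"
      using e(1) unfolding continuous_at_eps_delta by blast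
    then show ?thesis using e(2) c by (auto simp: dist_real_def)
  qed
  have first: "(mat_of_sym C ** F) \<bullet> U = 0" if U: "U \<in> tangent F" for U
  proof -
    obtain c where c: "curve_with_velocity M F U c" "range c \<subseteq> M"
      by (rule curve_exists[OF F U])
    have cM: "c t \<in> M" for t using c(2) by auto
    have d: "c 0 = F" "(c has_vector_derivative U) (at 0)"
      using c(1) by (auto simp: curve_with_velocity_def)
    obtain h where h: "h > 0" "\<forall>t. \<bar>t\<bar> < h \<longrightarrow> bm_objective C F \<le> bm_objective C (c t)"
      using near[OF d cM] by blast
    have "2 * ((mat_of_sym C ** c 0) \<bullet> U) = 0"
      by (rule DERIV_local_min[OF curve_quadratic[OF d(2)] h(1)])
        (use h(2) in \<open>auto simp: d(1) bm_objective_eq inner_gram\<close>)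
    then show ?thesis by (simp add: d(1))
  qed
  show Z: "mat_of_sym ?Z ** F = 0"
  proof -
    let ?V = "mat_of_sym ?Z ** F"
    have V: "?V \<in> tangent F" by (rule slack_tangent[OF F])
    have "?V \<bullet> ?V = (mat_of_sym C ** F) \<bullet> ?V - (mat_of_sym (constraint_adjoint A (multiplier C (gram F))) ** F) \<bullet> ?V"
      by (simp add: slack_def mmult.diff_left inner_diff_left inner_diff_right)
    also have "\<dots> = 0" using first[OF V] inner_tangent[OF V] by simp
    finally show ?thesis by simp
  qed
  have second: "0 \<le> (mat_of_sym ?Z ** U) \<bullet> U" if U: "U \<in> tangent F" for U
  proof -
    obtain c where c: "curve_with_velocity M F U c" "range c \<subseteq> M"
      by (rule curve_exists[OF F U])
    have cM: "c t \<in> M" for t using c(2) by auto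
    have d: "c 0 = F" "(c has_vector_derivative U) (at 0)"
      using c(1) by (auto simp: curve_with_velocity_def)
    obtain h where h: "h > 0" "\<And>t. \<bar>t\<bar> < h \<Longrightarrow> bm_objective C F \<le> bm_objective C (c t)"
      using near[OF d cM] by blast
    have lag: "bm_objective C G = (mat_of_sym ?Z ** G) \<bullet> G + b \<bullet> multiplier C (gram F)" if "G \<in> M" for G
      using inner_slack[of "gram G" C "multiplier C (gram F)"] that
      by (simp add: bm_objective_eq bm_feasible_def slack_def inner_gram)
    have pos: "0 \<le> (mat_of_sym ?Z ** ((c t - F) /\<^sub>R t)) \<bullet> ((c t - F) /\<^sub>R t)" if "\<bar>t\<bar> < h" for t
    proof -
      have "(mat_of_sym ?Z ** (c t - F)) \<bullet> (c t - F) = (mat_of_sym ?Z ** c t) \<bullet> c t"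
        using inner_sym_mult[of ?Z "c t" F] by (simp add: mmult.diff_right Z inner_diff_right)
      moreover have "0 \<le> (mat_of_sym ?Z ** c t) \<bullet> c t"
        using h(2)[OF that] lag[OF cM] lag[OF F] by (simp add: Z)
      ultimately have "0 \<le> inverse t * inverse t * ((mat_of_sym ?Z ** (c t - F)) \<bullet> (c t - F))"
        by (intro mult_nonneg_nonneg zero_le_square) simp
      then show ?thesis by (simp only: mmult.scaleR_right inner_scaleR_left inner_scaleR_right mult.assoc)
    qed
    have lim: "((\<lambda>t. (c t - F) /\<^sub>R t) \<longlongrightarrow> U) (at 0)"
    proof -
      have "((\<lambda>t. norm (c t - c 0 - (t - 0) *\<^sub>R U) / norm (t - 0)) \<longlongrightarrow> 0) (at 0)"
        using d(2) unfolding has_vector_derivative_def has_derivative_iff_norm by blast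
      moreover have "\<forall>\<^sub>F t in at 0. norm (c t - c 0 - (t - 0) *\<^sub>R U) / norm (t - 0) = norm ((c t - F) /\<^sub>R t - U)"
      proof (rule eventually_at_topological[THEN iffD2], intro exI[of _ UNIV] conjI ballI impI)
        fix t :: real assume "t \<noteq> 0"
        then have "(c t - F) /\<^sub>R t - U = (c t - c 0 - (t - 0) *\<^sub>R U) /\<^sub>R t"
          by (simp add: d(1) scaleR_diff_right)
        then show "norm (c t - c 0 - (t - 0) *\<^sub>R U) / norm (t - 0) = norm ((c t - F) /\<^sub>R t - U)"
          by (simp only: norm_scaleR) (simp add: divide_inverse mult.commute)
      qed auto
      ultimately have "((\<lambda>t. norm ((c t - F) /\<^sub>R t - U)) \<longlongrightarrow> 0) (at 0)"
        by (rule Lim_transform_eventually)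
      then show ?thesis by (simp add: tendsto_norm_zero_iff LIM_zero_iff)
    qed
    show ?thesis
    proof (rule tendsto_lowerbound)
      show "((\<lambda>t. (mat_of_sym ?Z ** ((c t - F) /\<^sub>R t)) \<bullet> ((c t - F) /\<^sub>R t)) \<longlongrightarrow> (mat_of_sym ?Z ** U) \<bullet> U) (at 0)"
        by (intro tendsto_inner lim mmult.tendsto tendsto_const)
      show "\<forall>\<^sub>F t in at 0. 0 \<le> (mat_of_sym ?Z ** ((c t - F) /\<^sub>R t)) \<bullet> ((c t - F) /\<^sub>R t)"
        unfolding eventually_at using h(1) pos by (auto intro!: exI[of _ h] simp: dist_real_def)
    qed simp
  qed
  have H: "riem_hessian M (bm_objective C) F u = proj F (2 *\<^sub>R (mat_of_sym ?Z ** u))"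
    if "u \<in> tangent F" for u
    by (rule riem_hessian_eq[OF F Z that])
  have lin: "linear (\<lambda>u. proj F (2 *\<^sub>R (mat_of_sym ?Z ** u)))"
  proof -
    have "linear (\<lambda>V. ((mat_of_sym (A i) ** F) \<bullet> V / w i) *\<^sub>R (mat_of_sym (A i) ** F))" for i
      by (rule linearI) (simp_all add: inner_add_right add_divide_distrib scaleR_left_distrib)
    then have "linear (proj F)"
      unfolding proj_def[abs_def] by (intro linear_compose_sub linear_ident linear_compose_sum) auto
    moreover have "linear (\<lambda>u. 2 *\<^sub>R (mat_of_sym ?Z ** u))"
      by (rule linearI) (simp_all add: mmult.add_right mmult.scaleR_right scaleR_right_distrib)
    ultimately show ?thesis using linear_compose[of "\<lambda>u. 2 *\<^sub>R (mat_of_sym ?Z ** u)" "proj F"]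
      by (simp add: o_def)
  qed
  show "sosp M (bm_objective C) F"
    unfolding sosp_def psd_symmetric_linear_on_def tangent_space_eq[OF F]
  proof (intro conjI ballI allI F)
    show "riem_gradient M (bm_objective C) F = 0" by (simp add: riem_gradient_eq[OF F] Z)
    show "riem_hessian M (bm_objective C) F ` tangent F \<subseteq> tangent F"
      using H orth_proj_tangent(1)[OF F] by auto
    fix u v a assume u: "u \<in> tangent F" 
    show "riem_hessian M (bm_objective C) F (a *\<^sub>R u) = a *\<^sub>R riem_hessian M (bm_objective C) F u"
      unfolding H[OF u] H[OF subspace_scale[OF subspace_tangent u]] by (rule linear_scale[OF lin])
    show "0 \<le> u \<bullet> riem_hessian M (bm_objective C) F u"
      using second[OF u] orth_proj_tangent(3)[OF F u, of "2 *\<^sub>R (mat_of_sym ?Z ** u)"]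
      unfolding H[OF u] by (simp only: inner_commute[of u] inner_scaleR_left)
    assume v: "v \<in> tangent F"
    show "riem_hessian M (bm_objective C) F (u + v) =
        riem_hessian M (bm_objective C) F u + riem_hessian M (bm_objective C) F v"
      unfolding H[OF u] H[OF v] H[OF subspace_add[OF subspace_tangent u v]] by (rule linear_add[OF lin])
    show "riem_hessian M (bm_objective C) F u \<bullet> v = u \<bullet> riem_hessian M (bm_objective C) F v"
    proof -
      have "u \<bullet> proj F (2 *\<^sub>R (mat_of_sym ?Z ** v)) = 2 * (u \<bullet> (mat_of_sym ?Z ** v))"
        using orth_proj_tangent(3)[OF F u, of "2 *\<^sub>R (mat_of_sym ?Z ** v)"]
        by (simp only: inner_commute[of u] inner_scaleR_left)
      moreover have "proj F (2 *\<^sub>R (mat_of_sym ?Z ** u)) \<bullet> v = 2 * ((mat_of_sym ?Z ** u) \<bullet> v)"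
        using orth_proj_tangent(3)[OF F v, of "2 *\<^sub>R (mat_of_sym ?Z ** u)"]
        by (simp only: inner_scaleR_left)
      ultimately show ?thesis unfolding H[OF u] H[OF v] by (simp only: inner_sym_mult)
    qed
  qed
qed

end

section \<open>Stability of solutions and of local minima\<close>

lemma norm_matrix_vector_le: "norm (A *v x) \<le> norm A * norm (x :: real^'n)"
  for A :: "real^'n^'m"
proof -
  have "norm (A *v x) \<le> L2_set (\<lambda>i. norm (A $ i) * norm x) UNIV"
    unfolding norm_vec_def[of "A *v x"]
    by (rule L2_set_mono) (simp_all add: matrix_vector_mul_component Cauchy_Schwarz_ineq2)
  also have "\<dots> = norm A * norm x"
    by (simp add: norm_vec_def[of A] L2_set_left_distrib)
  finally show ?thesis .
qed

lemma norm_transpose: "norm (transpose A) = norm (A :: real^'n^'m)"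
  by (simp add: norm_eq_sqrt_inner inner_transpose)

lemma norm_matrix_mult_le: "norm (A ** B) \<le> norm A * norm B"
  for A :: "real^'n^'m" and B :: "real^'k^'n"
proof -
  have row: "(A ** B) $ i = transpose B *v (A $ i)" for i
    by (simp add: matrix_matrix_mult_def matrix_vector_mult_def transpose_def vec_eq_iff mult.commute)
  have "norm (A ** B) \<le> L2_set (\<lambda>i. norm (A $ i) * norm B) UNIV"
    unfolding norm_vec_def[of "A ** B"] row
  proof (rule L2_set_mono)
    show "norm (transpose B *v (A $ i)) \<le> norm (A $ i) * norm B" for i
      using norm_matrix_vector_le[of "transpose B" "A $ i"]
      by (simp only: norm_transpose mult.commute[of "norm B"])
  qed simp
  also have "\<dots> = norm A * norm B"
    by (simp add: norm_vec_def[of A] L2_set_left_distrib)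
  finally show ?thesis .
qed

lemma inner_matrix_columns:
  "(Z ** G) \<bullet> G = (\<Sum>k\<in>UNIV. column k G \<bullet> (Z *v column k G))" for G :: "real^'k^'n" and Z :: "real^'n^'n"
proof -
  have "(Z ** G) \<bullet> G = (\<Sum>i\<in>UNIV. \<Sum>k\<in>UNIV. (Z ** G) $ i $ k * G $ i $ k)"
    by (simp add: inner_vec_def)
  also have "\<dots> = (\<Sum>k\<in>UNIV. \<Sum>i\<in>UNIV. (Z ** G) $ i $ k * G $ i $ k)" by (rule sum.swap)
  also have "\<dots> = (\<Sum>k\<in>UNIV. column k G \<bullet> (Z *v column k G))"
    by (simp add: inner_vec_def column_def matrix_matrix_mult_def matrix_vector_mult_def mult.commute)
  finally show ?thesis .
qed

lemma inner_sym_vec: "x \<bullet> (mat_of_sym X *v y) = (mat_of_sym X *v x) \<bullet> y"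
  using dot_lmul_matrix[of x "mat_of_sym X" y] by (metis transpose_mat_of_sym transpose_matrix_vector)

section \<open>Positive semidefinite matrices: kernel, factorization, rank\<close>

text \<open>If the image \<open>?u\<close> of \<open>v\<close> were nonzero, a small step from
  \<open>v\<close> along \<open>- ?u\<close> would make the form negative, because the linear
  decrease beats the quadratic term.\<close>

lemma psd_ker:
  assumes "psd X" "v \<bullet> (mat_of_sym X *v v) = 0"
  shows "mat_of_sym X *v v = 0"
proof -
  let ?u = "mat_of_sym X *v v"
  define a where "a = ?u \<bullet> (mat_of_sym X *v ?u)"
  have a: "0 \<le> a" using assms(1) by (simp add: psd_def a_def)
  have *: "0 \<le> s\<^sup>2 * a - 2 * s * (?u \<bullet> ?u)" for s
  proof -
    have "0 \<le> (v - s *\<^sub>R ?u) \<bullet> (mat_of_sym X *v (v - s *\<^sub>R ?u))"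
      using assms(1) by (simp add: psd_def)
    also have "\<dots> = s\<^sup>2 * a - 2 * s * (?u \<bullet> ?u)"
      using assms(2) inner_sym_vec[of v X ?u]
      by (simp add: matrix_vector_mult_diff_distrib matrix_vector_mult_scaleR inner_diff_left
          inner_diff_right a_def power2_eq_square right_diff_distrib)
    finally show ?thesis .
  qed
  have "?u \<bullet> ?u \<le> 0"
  proof (rule ccontr)
    assume "\<not> ?thesis"
    then have p: "?u \<bullet> ?u > 0" by linarith
    \<comment> \<open>The added 1 keeps the quotient meaningful for \<open>a = 0\<close>.\<close>
    define s where "s = (?u \<bullet> ?u) / (a + 1)"
    have s: "s > 0" using p a by (simp add: s_def)
    have "s * a < 2 * (?u \<bullet> ?u)"
      using p a by (simp add: s_def divide_simps)
    then have "s * (s * a) < s * (2 * (?u \<bullet> ?u))" using s by (rule mult_strict_left_mono)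
    then show False using *[of s] by (simp add: power2_eq_square)
  qed
  then show ?thesis by (metis inner_eq_zero_iff inner_ge_zero order_antisym)
qed

text \<open>Cholesky factorization, eliminating one index of the support at a time.\<close>

lemma psd_decomposition:
  fixes P :: "'n::finite symmat"
  assumes "finite I" "psd P" "\<And>k l. k \<notin> I \<Longrightarrow> mat_of_sym P $ k $ l = 0"
  shows "\<exists>g :: 'n \<Rightarrow> real^'n. \<forall>a c. mat_of_sym P $ a $ c = (\<Sum>k\<in>I. g k $ a * g k $ c)"
  using assms
proof (induction I arbitrary: P rule: finite_induct)
  case empty
  then show ?case by simp
next
  case (insert i I)
  let ?M = "mat_of_sym P"
  define p where "p = ?M $ i $ i"
  have col: "?M *v axis i 1 = (\<chi> a. ?M $ a $ i)"
    by (simp add: matrix_vector_mult_basis column_def)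
  have p: "p = axis i 1 \<bullet> (?M *v axis i 1)"
    by (simp add: col p_def inner_axis')
  then have "p \<ge> 0" using insert.prems(1) by (simp add: psd_def)
  show ?case
  proof (cases "p = 0")
    case True
    then have "?M *v axis i 1 = 0" using psd_ker[OF insert.prems(1), of "axis i 1"] p by simp
    then have "?M $ a $ i = 0" for a unfolding col by (simp add: vec_eq_iff)
    then have "?M $ i $ l = 0" for l using mat_of_sym_entries_commute[of P i l] by simp
    then have "?M $ k $ l = 0" if "k \<notin> I" for k l
      using insert.prems(2)[of k l] that by (cases "k = i") auto
    from insert.IH[OF insert.prems(1) this] obtain g :: "'n \<Rightarrow> real^'n" where
      g: "\<forall>a c. ?M $ a $ c = (\<Sum>k\<in>I. g k $ a * g k $ c)" by blast
    have "\<forall>a c. ?M $ a $ c = (\<Sum>k\<in>insert i I. (g(i := 0)) k $ a * (g(i := 0)) k $ c)"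
    proof (intro allI)
      fix a c
      have "(\<Sum>k\<in>I. (g(i := 0)) k $ a * (g(i := 0)) k $ c) = (\<Sum>k\<in>I. g k $ a * g k $ c)"
        using insert.hyps(2) by (intro sum.cong) auto
      then show "?M $ a $ c = (\<Sum>k\<in>insert i I. (g(i := 0)) k $ a * (g(i := 0)) k $ c)"
        using g insert.hyps by simp
    qed
    then show ?thesis by blast
  next
    case False
    then have "p > 0" using \<open>p \<ge> 0\<close> by simp
    \<comment> \<open>Column \<open>i\<close> divided by the root of the pivot; subtracting its
      square leaves the Schur complement \<open>Q\<close>.\<close>
    define h where "h = (1 / sqrt p) *\<^sub>R (?M *v axis i 1)"
    define Q where "Q = Symmat (?M - (\<chi> a c. h $ a * h $ c))"
    have Q: "mat_of_sym Q = ?M - (\<chi> a c. h $ a * h $ c)"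
      unfolding Q_def
      by (rule mat_of_sym_Symmat) (simp add: transpose_def vec_eq_iff mult.commute mat_of_sym_entries_commute)
    have h: "h $ a * h $ c = ?M $ a $ i * ?M $ c $ i / p" for a c
      using \<open>p > 0\<close> by (simp add: h_def col)
    have "psd Q"
      unfolding psd_def
    proof
      fix v :: "real^'n"
      \<comment> \<open>The minimizer of the form of \<open>P\<close> over all
        \<open>v + s *\<^sub>R axis i 1\<close>; the minimum is the value of the form of
        \<open>Q\<close> at \<open>v\<close>.\<close>
      define s where "s = - (axis i 1 \<bullet> (?M *v v)) / p"
      have hv: "h \<bullet> v = (axis i 1 \<bullet> (?M *v v)) / sqrt p"
        by (simp add: h_def inner_sym_vec)
      have outer: "(\<chi> a c. h $ a * h $ c) *v v = (h \<bullet> v) *\<^sub>R h"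
        by (simp add: vec_eq_iff matrix_vector_mult_def inner_vec_def sum_distrib_left mult_ac)
      have "v \<bullet> (mat_of_sym Q *v v) = v \<bullet> (?M *v v) - (axis i 1 \<bullet> (?M *v v))\<^sup>2 / p"
        using \<open>p > 0\<close>
        by (simp add: Q matrix_vector_mult_diff_rdistrib outer inner_diff_right inner_commute[of v h] hv
            power2_eq_square)
      also have "\<dots> = (v + s *\<^sub>R axis i 1) \<bullet> (?M *v (v + s *\<^sub>R axis i 1))"
      proof -
        have "v \<bullet> (?M *v axis i 1) = axis i 1 \<bullet> (?M *v v)"
          by (metis inner_commute inner_sym_vec)
        then have "(v + s *\<^sub>R axis i 1) \<bullet> (?M *v (v + s *\<^sub>R axis i 1)) =
            v \<bullet> (?M *v v) + 2 * s * (axis i 1 \<bullet> (?M *v v)) + s\<^sup>2 * p"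
          by (simp add: matrix_vector_right_distrib matrix_vector_mult_scaleR inner_add_left
              inner_add_right p power2_eq_square algebra_simps)
        then show ?thesis
          using \<open>p > 0\<close> by (simp add: s_def field_simps power2_eq_square)
      qed
      also have "\<dots> \<ge> 0" using insert.prems(1) by (simp add: psd_def)
      finally show "0 \<le> v \<bullet> (mat_of_sym Q *v v)" .
    qed
    moreover have "mat_of_sym Q $ k $ l = 0" if "k \<notin> I" for k l
    proof (cases "k = i")
      case True
      then show ?thesis
        using \<open>p > 0\<close> mat_of_sym_entries_commute[of P i l] by (simp add: Q h) (simp add: p_def)
    next
      case False
      then show ?thesis using insert.prems(2)[of k] that by (simp add: Q h)
    qed
    ultimately obtain g :: "'n \<Rightarrow> real^'n" where
      g: "\<forall>a c. mat_of_sym Q $ a $ c = (\<Sum>k\<in>I. g k $ a * g k $ c)"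
      using insert.IH by blast
    have "\<forall>a c. ?M $ a $ c = (\<Sum>k\<in>insert i I. (g(i := h)) k $ a * (g(i := h)) k $ c)"
    proof (intro allI)
      fix a c
      have "(\<Sum>k\<in>I. (g(i := h)) k $ a * (g(i := h)) k $ c) = (\<Sum>k\<in>I. g k $ a * g k $ c)"
        using insert.hyps(2) by (intro sum.cong) auto
      moreover have "?M $ a $ c = mat_of_sym Q $ a $ c + h $ a * h $ c" by (simp add: Q)
      ultimately show "?M $ a $ c = (\<Sum>k\<in>insert i I. (g(i := h)) k $ a * (g(i := h)) k $ c)"
        using g insert.hyps by simp
    qed
    then show ?thesis by blast
  qed
qed

lemma psd_factorization:
  fixes X :: "'n::finite symmat"
  assumes "psd X"
  shows "\<exists>G :: real^'n^'n. X = gram G"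
proof -
  obtain g :: "'n \<Rightarrow> real^'n" where "\<forall>a c. mat_of_sym X $ a $ c = (\<Sum>k\<in>UNIV. g k $ a * g k $ c)"
    using psd_decomposition[of UNIV X] assms by auto
  then have "mat_of_sym X = mat_of_sym (gram (\<chi> a k. g k $ a))"
    by (simp add: mat_of_sym_gram vec_eq_iff matrix_matrix_mult_def transpose_def)
  then show ?thesis by (metis mat_of_sym_eq_iff)
qed

lemma inner_psd_gram:
  assumes "psd Z"
  shows "0 \<le> Z \<bullet> gram G" "Z \<bullet> gram G = 0 \<Longrightarrow> column k G \<bullet> (mat_of_sym Z *v column k G) = 0"
proof -
  have pos: "0 \<le> column k G \<bullet> (mat_of_sym Z *v column k G)" for k
    using assms by (simp add: psd_def)
  show "0 \<le> Z \<bullet> gram G"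
    by (simp add: inner_gram inner_matrix_columns sum_nonneg pos)
  show "column k G \<bullet> (mat_of_sym Z *v column k G) = 0" if "Z \<bullet> gram G = 0"
    using that pos by (simp add: inner_gram inner_matrix_columns sum_nonneg_eq_0_iff)
qed

lemma rank_injective:
  fixes F :: "real^'k^'n"
  assumes "\<And>a. F *v a = 0 \<Longrightarrow> a = 0"
  shows "rank F = CARD('k)"
proof -
  have "inj ((*v) F)"
    by (rule linear_injective_0[THEN iffD2]) (use assms in auto)
  then show ?thesis by (simp add: rank_dim_range dim_image_eq[OF matrix_vector_mul_linear])
qed

lemma rank_kernel:
  fixes B :: "real^'n^'m"
  shows "rank B + dim {v. B *v v = 0} = CARD('n)"
proof -
  have "{v. B *v v = 0} = {v \<in> UNIV. \<forall>x\<in>span (rows B). orthogonal x v}"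
  proof (intro subset_antisym subsetI)
    fix v assume "v \<in> {v. B *v v = 0}"
    then show "v \<in> {v \<in> UNIV. \<forall>x\<in>span (rows B). orthogonal x v}"
      using orthogonal_nullspace_rowspace[of B v] by (auto simp: orthogonal_commute)
  next
    fix v assume *: "v \<in> {v \<in> UNIV. \<forall>x\<in>span (rows B). orthogonal x v}"
    have "(B *v v) $ i = 0" for i
    proof -
      have "row i B \<in> span (rows B)" by (rule span_base) (auto simp: rows_def)
      then have "orthogonal (row i B) v" using * by blast
      then show ?thesis by (simp add: matrix_vector_mul_component row_def orthogonal_def)
    qed
    then show "v \<in> {v. B *v v = 0}" by (simp add: vec_eq_iff)
  qed
  then show ?thesis
    using dim_subspace_orthogonal_to_vectors[OF subspace_span subspace_UNIV, of "rows B"]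
    by (simp add: row_rank_def)
qed

lemma rank_gram:
  fixes F :: "real^'k^'n"
  assumes "\<And>a. F *v a = 0 \<Longrightarrow> a = 0"
  shows "rank (mat_of_sym (gram F)) = CARD('k)"
proof -
  have "{v. mat_of_sym (gram F) *v v = 0} = {v. transpose F *v v = 0}"
    using assms by (auto simp: mat_of_sym_gram simp flip: matrix_vector_mul_assoc simp del: transpose_matrix_vector)
  then have "rank (mat_of_sym (gram F)) = rank (transpose F)"
    using rank_kernel[of "mat_of_sym (gram F)"] rank_kernel[of "transpose F"] by simp
  then show ?thesis using rank_injective[OF assms] by (simp add: rank_transpose)
qed

section \<open>Optimality certificates\<close>

context regular_constraints
begin

text \<open>Among the symmetric matrices F S F^T, the constraint values then determine S. For a
  solution of rank \<open>d\<close> this is what turns membership in a face of the cone into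
  uniqueness.\<close>

definition rigid :: "real^'d^'n \<Rightarrow> bool" where
  "rigid F \<longleftrightarrow> (\<forall>G. transpose G = G \<longrightarrow>
    (\<forall>i. mat_of_sym (A i) \<bullet> (F ** G ** transpose F) = 0) \<longrightarrow> G = 0)"

lemma rigid_injective:
  assumes "rigid F" "F *v a = 0"
  shows "a = 0"
proof -
  let ?G = "\<chi> i j. a $ i * a $ j"
  have "F ** ?G = 0"
    using assms(2)
    by (simp add: vec_eq_iff matrix_matrix_mult_def matrix_vector_mult_def mult.assoc[symmetric]
        flip: sum_distrib_right)
  moreover have "transpose ?G = ?G" by (simp add: transpose_def vec_eq_iff mult.commute)
  ultimately have "?G = 0" using assms(1) unfolding rigid_def by fastforce
  then show "a = 0" by (simp add: vec_eq_iff)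
qed

text \<open>Complementary slackness does all the work. The columns of a factor of another primal
  solution lie in the kernel of the slack matrix, so the factor is F J, and rigidity gives J J^T =
  1. The slack matrix of another dual solution also annihilates \<open>F\<close>, and then
  \<open>adjoint_mult_eq_0\<close> identifies the multipliers. As the kernel is exactly the range of
  \<open>F\<close>, the ranks add up to the full dimension.\<close>

lemma kkt:
  fixes F :: "real^'d^'n"
  assumes F: "F \<in> bm_feasible A b" and rigid: "rigid F"
    and psd: "psd (C - constraint_adjoint A y)"
    and ZF: "mat_of_sym (C - constraint_adjoint A y) ** F = 0"
    and ker: "\<And>v. v \<bullet> (mat_of_sym (C - constraint_adjoint A y) *v v) = 0 \<Longrightarrow> v \<in> range ((*v) F)"
  shows "unique_solution_of_rank CARD('d) C A b \<and> simple_sdp C A b"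
    and "primal_solution C A b X' \<Longrightarrow> X' = gram F"
proof -
  let ?Z = "C - constraint_adjoint A y" and ?X = "gram F"
  have AX: "constraint_map A ?X = b" using F by (simp add: bm_feasible_def)
  have CX: "C \<bullet> ?X = b \<bullet> y"
    using inner_slack[OF AX, of C y] by (simp add: inner_gram ZF del: mat_of_sym_diff)
  have feas: "primal_feasible A b ?X" by (simp add: primal_feasible_def AX psd_gram)
  have weak: "b \<bullet> y' \<le> C \<bullet> X'" if *: "primal_feasible A b X'" "dual_feasible C A y'" for X' y'
  proof -
    obtain G :: "real^'n^'n" where "X' = gram G"
      using *(1) psd_factorization unfolding primal_feasible_def by blast
    then show ?thesis
      using inner_psd_gram(1)[of "C - constraint_adjoint A y'" G] inner_slack[of X' C y'] *
      by (simp add: primal_feasible_def dual_feasible_def)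
  qed
  have primal: "primal_solution C A b ?X"
    using feas weak psd by (simp add: primal_solution_def CX dual_feasible_def)
  have dual: "dual_solution C A b y"
    using feas weak psd CX by (metis dual_solution_def dual_feasible_def)
  have primal_unique: "X' = ?X" if "primal_solution C A b X'" for X'
  proof -
    have "C \<bullet> X' \<le> C \<bullet> ?X" using that feas unfolding primal_solution_def by blast
    then have "C \<bullet> X' \<le> b \<bullet> y" unfolding CX .
    moreover have "b \<bullet> y \<le> C \<bullet> X'"
      using weak[of X' y] that psd by (simp add: primal_solution_def dual_feasible_def)
    ultimately have X': "constraint_map A X' = b" "psd X'" "C \<bullet> X' = b \<bullet> y"
      using that by (simp_all add: primal_solution_def primal_feasible_def)
    obtain G :: "real^'n^'n" where G: "X' = gram G" using X'(2) psd_factorization by blast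
    have "?Z \<bullet> X' = 0" using inner_slack[OF X'(1), of C y] X'(3) by linarith
    then have ZG: "?Z \<bullet> gram G = 0" unfolding G .
    have "\<exists>a. column k G = F *v a" for k
      using ker[OF inner_psd_gram(2)[OF psd ZG]] by (simp add: image_iff)
    then obtain j where j: "\<And>k. column k G = F *v j k" by metis
    define J where "J = (\<chi> a k. j k $ a)"
    have "G = F ** J"
      using j by (simp add: vec_eq_iff column_def matrix_matrix_mult_def matrix_vector_mult_def J_def)
    then have GG: "mat_of_sym X' = F ** (J ** transpose J) ** transpose F"
      by (simp add: G mat_of_sym_gram matrix_transpose_mul matrix_mul_assoc)
    have "J ** transpose J - mat 1 = 0"
    proof (rule rigid[unfolded rigid_def, rule_format])
      show "transpose (J ** transpose J - mat 1) = J ** transpose J - mat 1"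
        by (simp add: transpose_diff matrix_transpose_mul)
      fix i
      have "F ** (J ** transpose J - mat 1) ** transpose F = mat_of_sym X' - mat_of_sym ?X"
        by (simp add: GG mmult.diff_left mmult.diff_right mat_of_sym_gram)
      moreover have "A i \<bullet> X' = A i \<bullet> ?X"
        using X'(1) AX by (simp add: constraint_map_def vec_eq_iff)
      ultimately show "mat_of_sym (A i) \<bullet> (F ** (J ** transpose J - mat 1) ** transpose F) = 0"
        by (simp add: inner_diff_right inner_symmat_def)
    qed
    then have "J ** transpose J = mat 1" by simp
    then have "mat_of_sym X' = mat_of_sym ?X" unfolding GG by (simp add: mat_of_sym_gram)
    then show ?thesis by (simp only: mat_of_sym_eq_iff)
  qed
  have dual_unique: "y' = y" if "dual_solution C A b y'" for y'
  proof -
    have y': "psd (C - constraint_adjoint A y')" "b \<bullet> y' = b \<bullet> y"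
      using that dual by (auto simp: dual_solution_def dual_feasible_def intro: order_antisym)
    have "(C - constraint_adjoint A y') \<bullet> ?X = 0"
      using inner_slack[OF AX, of C y'] CX y'(2) by simp
    then have "mat_of_sym (C - constraint_adjoint A y') *v column k F = 0" for k
      using inner_psd_gram(2)[OF y'(1)] psd_ker[OF y'(1)] by blast
    then have "mat_of_sym (C - constraint_adjoint A y') ** F = 0"
      by (simp add: vec_eq_iff column_def matrix_matrix_mult_def matrix_vector_mult_def)
    then have "mat_of_sym (constraint_adjoint A (y' - y)) ** F = 0"
      using ZF by (simp add: constraint_adjoint_diff mmult.diff_left)
    from adjoint_mult_eq_0[OF F this] show ?thesis by simp
  qed
  note inj = rigid_injective[OF rigid]
  have rankX: "rank (mat_of_sym ?X) = CARD('d)" by (rule rank_gram[OF inj])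
  have rankZ: "rank (mat_of_sym ?X) + rank (mat_of_sym ?Z) = CARD('n)"
  proof -
    have "{v. mat_of_sym ?Z *v v = 0} = range ((*v) F)"
      using ker ZF by (auto simp: matrix_vector_mul_assoc)
    then have "dim {v. mat_of_sym ?Z *v v = 0} = CARD('d)"
      using rank_injective[OF inj] by (simp add: rank_dim_range)
    then show ?thesis using rank_kernel[of "mat_of_sym ?Z"] rankX by simp
  qed
  have "trace (mat_of_sym C ** mat_of_sym ?X) = b \<bullet> y"
    using CX by (simp add: inner_symmat_eq_trace)
  then have "strong_duality C A b"
    unfolding strong_duality_def using primal dual primal_unique dual_unique by metis
  moreover have "strict_complementarity C A b"
    unfolding strict_complementarity_def using primal dual rankZ by blast
  ultimately have "simple_sdp C A b"
    unfolding simple_sdp_def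
    using surj_constraint_map[OF AX] primal dual primal_unique dual_unique by metis
  moreover have "unique_solution_of_rank CARD('d) C A b"
    unfolding unique_solution_of_rank_def using primal primal_unique rankX by blast
  ultimately show "unique_solution_of_rank CARD('d) C A b \<and> simple_sdp C A b" by blast
  show "primal_solution C A b X' \<Longrightarrow> X' = gram F" by (rule primal_unique)
qed

end

lemma continuous_on_mat_of_sym:
  "continuous_on S f \<Longrightarrow> continuous_on S (\<lambda>x. mat_of_sym (f x))"
  by (rule bounded_linear.continuous_on[OF bounded_linear_mat_of_sym])

lemma (in regular_constraints) continuous_on_slack:
  "continuous_on S (\<lambda>p. slack (fst p) (snd p))"
proof -
  have "slack C X = C - (\<Sum>i\<in>UNIV. ((mat_of_sym (A i) ** mat_of_sym X) \<bullet> mat_of_sym C / w i) *\<^sub>R A i)" for C X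
    by (simp add: slack_def constraint_adjoint_def multiplier_def)
  then show ?thesis
    by (simp only:)
      (intro continuous_intros mmult.continuous_on continuous_on_mat_of_sym; use w_pos in \<open>simp add: less_imp_neq[THEN not_sym]\<close>)
qed

lemma quadratic_form_bound:
  "\<bar>v \<bullet> (B *v v)\<bar> \<le> norm B * (norm v)\<^sup>2" for B :: "real^'n^'n"
proof -
  have "\<bar>v \<bullet> (B *v v)\<bar> \<le> norm v * norm (B *v v)" by (rule Cauchy_Schwarz_ineq2)
  also have "\<dots> \<le> norm v * (norm B * norm v)"
    by (intro mult_left_mono norm_matrix_vector_le) simp
  finally show ?thesis by (simp add: power2_eq_square mult_ac)
qed

lemma positive_on_subspace:
  fixes B :: "real^'n^'n" and V :: "real^'n^'m"
  assumes "\<And>v. V *v v = 0 \<Longrightarrow> v \<noteq> 0 \<Longrightarrow> 0 < v \<bullet> (B *v v)"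
  obtains l where "l > 0" "\<And>v. V *v v = 0 \<Longrightarrow> l * (norm v)\<^sup>2 \<le> v \<bullet> (B *v v)"
proof -
  define S where "S = {v. V *v v = 0} \<inter> sphere 0 1"
  have cont: "continuous_on T (\<lambda>v. v \<bullet> (B *v v))" for T
    by (intro continuous_intros matrix_vector_mult_linear_continuous_on)
  have "closed {v. V *v v = 0}"
    by (intro closed_Collect_eq continuous_on_const matrix_vector_mult_linear_continuous_on)
  then have "compact S" unfolding S_def by (intro closed_Int_compact) auto
  show thesis
  proof (cases "S = {}")
    case True
    have "v = 0" if "V *v v = 0" for v
    proof (rule ccontr)
      assume "v \<noteq> 0"
      then have "v /\<^sub>R norm v \<in> S"
        using that by (simp add: S_def matrix_vector_mult_scaleR)
      then show False using True by simp
    qed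
    then show thesis using that[of 1] by fastforce
  next
    case False
    obtain u where u: "u \<in> S" "\<And>v. v \<in> S \<Longrightarrow> u \<bullet> (B *v u) \<le> v \<bullet> (B *v v)"
      using continuous_attains_inf[OF \<open>compact S\<close> False cont] by blast
    let ?l = "u \<bullet> (B *v u)"
    have "?l * (norm v)\<^sup>2 \<le> v \<bullet> (B *v v)" if "V *v v = 0" for v
    proof (cases "v = 0")
      case False
      then have "v /\<^sub>R norm v \<in> S"
        using that by (simp add: S_def matrix_vector_mult_scaleR)
      then have "?l \<le> (v /\<^sub>R norm v) \<bullet> (B *v (v /\<^sub>R norm v))" by (rule u(2))
      also have "\<dots> = (v \<bullet> (B *v v)) / (norm v)\<^sup>2"
        by (simp add: matrix_vector_mult_scaleR power2_eq_square divide_simps)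
      finally show ?thesis using False by (simp add: pos_le_divide_eq)
    qed simp
    moreover have "?l > 0" using u(1) by (intro assms) (auto simp: S_def)
    ultimately show thesis using that by blast
  qed
qed

section \<open>Perturbation of the cost\<close>

context bm_manifold
begin

lemma compact_far: "compact {F \<in> M. e \<le> dist (gram F) X}"
proof -
  have "{F \<in> M. e \<le> dist (gram F) X} = M \<inter> {F. e \<le> dist (gram F) X}" by auto
  moreover have "closed {F :: real^'r^'n. e \<le> dist (gram F) X}"
    by (intro closed_Collect_le continuous_on_const continuous_on_dist continuous_on_gram)
  ultimately show ?thesis using compact_Int_closed[OF compact_bm_feasible] by metis
qed

lemma compact_near: "compact {F \<in> M. dist (gram F) X \<le> e}"
proof -
  have "{F \<in> M. dist (gram F) X \<le> e} = M \<inter> {F. dist (gram F) X \<le> e}" by auto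
  moreover have "closed {F :: real^'r^'n. dist (gram F) X \<le> e}"
    by (intro closed_Collect_le continuous_on_const continuous_on_dist continuous_on_gram)
  ultimately show ?thesis using compact_Int_closed[OF compact_bm_feasible] by metis
qed

lemma compact_gap:
  assumes "compact K" "\<And>F :: real^'r^'n. F \<in> K \<Longrightarrow> 0 < C \<bullet> (gram F - X)"
  obtains h where "h > 0" "\<And>F. F \<in> K \<Longrightarrow> h \<le> C \<bullet> (gram F - X)"
proof (cases "K = {}")
  case True
  then show thesis using that[of 1] by simp
next
  case False
  have "continuous_on K (\<lambda>F. C \<bullet> (gram F - X))"
    by (intro continuous_intros continuous_on_gram)
  then obtain G where "G \<in> K" "\<And>F. F \<in> K \<Longrightarrow> C \<bullet> (gram G - X) \<le> C \<bullet> (gram F - X)"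
    using continuous_attains_inf[OF assms(1) False] by blast
  then show thesis using that[of "C \<bullet> (gram G - X)"] assms(2) by blast
qed

text \<open>The cost \<open>C0\<close> exceeds its value at \<open>F0\<close> by a fixed gap on the
  sphere around \<open>gram F0\<close>, so for a nearby cost the minimum over the ball is attained
  inside. The ball lives in the space of gram matrices since \<open>F0\<close> is isolated only up
  to rotation; continuity of \<open>gram\<close> makes the minimizer a local one in
  \<open>M\<close>.\<close>

lemma bm_fails_near:
  assumes F0: "F0 \<in> M" and e: "e > 0"
    and strict: "\<And>F. F \<in> M \<Longrightarrow> dist (gram F) (gram F0) \<le> e \<Longrightarrow> gram F \<noteq> gram F0 \<Longrightarrow>
      C0 \<bullet> gram F0 < C0 \<bullet> gram F"
    and G: "G \<in> M" "C0 \<bullet> gram G < C0 \<bullet> gram F0"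
  obtains \<delta> where "\<delta> > 0" "\<And>C. dist C C0 < \<delta> \<Longrightarrow> bm_fails TYPE('r) C A b"
proof -
  let ?X = "gram F0"
  have gap: "0 < C0 \<bullet> (?X - gram G)" using G(2) by (simp add: inner_diff_right)
  have cont: "isCont (\<lambda>p. fst p \<bullet> (snd p - gram G)) (C0, ?X)"
    by (intro continuous_intros)
  obtain d where d: "d > 0" "\<forall>p. dist p (C0, ?X) < d \<longrightarrow>
      dist (fst p \<bullet> (snd p - gram G)) (C0 \<bullet> (?X - gram G)) < C0 \<bullet> (?X - gram G)"
    using cont[unfolded continuous_at_eps_delta, rule_format, OF gap] unfolding fst_conv snd_conv
    by (elim exE conjE)
  define r where "r = min e (d / 2)"
  have r: "r > 0" "r \<le> e" "r \<le> d / 2" using e d(1) by (auto simp: r_def)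
  have pos: "0 < C \<bullet> (X - gram G)" if "dist C C0 < d / 2" "dist X ?X \<le> r" for C X
  proof -
    have "dist (C, X) (C0, ?X) \<le> dist C C0 + dist X ?X"
      unfolding dist_Pair_Pair by (rule sqrt_sum_squares_le_sum) auto
    then have "dist (C, X) (C0, ?X) < d" using that r(3) by linarith
    from d(2)[rule_format, OF this] show ?thesis by (auto simp: dist_real_def)
  qed
  obtain h where h: "h > 0" "\<And>F. F \<in> M \<Longrightarrow> dist (gram F) ?X = r \<Longrightarrow> h \<le> C0 \<bullet> (gram F - ?X)"
  proof -
    have "{F \<in> M. dist (gram F) ?X = r} = {F \<in> M. dist (gram F) ?X \<le> r} \<inter> {F \<in> M. r \<le> dist (gram F) ?X}"
      by auto
    then have "compact {F \<in> M. dist (gram F) ?X = r}"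
      by (simp only: compact_Int[OF compact_near compact_far])
    moreover have "0 < C0 \<bullet> (gram F - ?X)" if "F \<in> {F \<in> M. dist (gram F) ?X = r}" for F
      using strict[of F] that r by (auto simp: inner_diff_right)
    ultimately show thesis
      by (rule compact_gap[of _ C0 ?X]) (use that in auto)
  qed
  show thesis
  \<comment> \<open>The bound \<open>d / 2\<close> keeps \<open>G\<close> cheaper than every point
    of the ball, and \<open>h / r\<close> keeps the change of the cost on the sphere below the
    gap.\<close>
  proof (rule that[of "min (d / 2) (h / r)"])
    show "min (d / 2) (h / r) > 0" using d(1) h(1) r(1) by simp
    fix C assume C: "dist C C0 < min (d / 2) (h / r)"
    let ?K = "{F \<in> M. dist (gram F) ?X \<le> r}"
    have "F0 \<in> ?K" using F0 r(1) by simp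
    moreover have "continuous_on ?K (\<lambda>F. C \<bullet> gram F)"
      by (intro continuous_intros continuous_on_gram)
    ultimately obtain F where F: "F \<in> ?K" "\<And>H. H \<in> ?K \<Longrightarrow> C \<bullet> gram F \<le> C \<bullet> gram H"
      using continuous_attains_inf[OF compact_near] by blast
    have "dist (gram F) ?X \<noteq> r"
    proof
      assume eq: "dist (gram F) ?X = r"
      have "\<bar>(C - C0) \<bullet> (gram F - ?X)\<bar> \<le> norm (C - C0) * norm (gram F - ?X)"
        by (rule Cauchy_Schwarz_ineq2)
      also have "\<dots> < h"
        using C r(1) eq by (simp add: dist_norm pos_less_divide_eq)
      finally have "C \<bullet> gram F > C \<bullet> ?X"
        using h(2)[of F] F(1) eq by (simp add: inner_diff_left inner_diff_right abs_less_iff)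
      then show False using F(2)[OF \<open>F0 \<in> ?K\<close>] by simp
    qed
    then have lt: "dist (gram F) ?X < r" using F(1) by auto
    have "isCont gram F"
      using continuous_on_gram[of UNIV] continuous_on_eq_continuous_at[of UNIV] by blast
    then obtain s where s: "s > 0"
      "\<And>H. dist H F < s \<Longrightarrow> dist (gram H :: 'n symmat) (gram F) < r - dist (gram F) ?X"
      using lt unfolding continuous_at_eps_delta by (metis diff_gt_0_iff_gt)
    have "sosp M (bm_objective C) F"
    proof (rule local_minimum(2)[OF _ s(1)])
      show "F \<in> M" using F(1) by blast
      fix H assume H: "H \<in> M" "dist H F < s"
      have "dist (gram H) ?X \<le> r"
        using s(2)[OF H(2)] dist_triangle[of "gram H" ?X "gram F"] by linarith
      then show "bm_objective C F \<le> bm_objective C H"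
        using F(2)[of H] H(1) by (simp add: bm_objective_eq)
    qed
    moreover have "bm_objective C G < bm_objective C F"
      using pos[of C "gram F"] C F(1) by (simp add: bm_objective_eq inner_diff_right)
    ultimately show "bm_fails TYPE('r) C A b"
      unfolding bm_fails_def using G(1) by (meson not_le)
  qed
qed

text \<open>
  The slack matrix of a minimizer of the perturbed cost annihilates the minimizer and is close to \<open>C0\<close>,
  hence still positive on the orthogonal complement of \<open>U\<close>. By dimension it is a dual certificate.
\<close>

lemma simple_near:
  assumes U: "U \<in> M" and rigid: "\<And>F :: real^'r^'n. F \<in> M \<Longrightarrow> rigid F"
    and psd: "psd C0" and CU: "mat_of_sym C0 ** U = 0"
    and ker: "\<And>v. v \<bullet> (mat_of_sym C0 *v v) = 0 \<Longrightarrow> v \<in> range ((*v) U)"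
  obtains \<delta> where "\<delta> > 0"
    "\<And>C. dist C C0 < \<delta> \<Longrightarrow> unique_solution_of_rank CARD('r) C A b \<and> simple_sdp C A b"
proof -
  let ?X = "gram U"
  \<comment> \<open>Since \<open>C0\<close> annihilates \<open>U\<close>, the multiplier at
    \<open>?X\<close> is zero. The slack matrix starts at \<open>C0\<close> and stays close to it by
    continuity.\<close>
  have slack0: "slack C0 ?X = C0"
    by (simp add: slack_def constraint_adjoint_def multiplier_gram CU)
  have CX: "C0 \<bullet> ?X = 0" by (simp add: inner_gram CU)
  obtain l where l: "l > 0" "\<And>v. transpose U *v v = 0 \<Longrightarrow> l * (norm v)\<^sup>2 \<le> v \<bullet> (mat_of_sym C0 *v v)"
  proof (rule positive_on_subspace[of "transpose U" "mat_of_sym C0"])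
    fix v assume v: "transpose U *v v = 0" "v \<noteq> 0"
    have "v \<bullet> (mat_of_sym C0 *v v) \<noteq> 0"
    proof
      assume "v \<bullet> (mat_of_sym C0 *v v) = 0"
      then obtain a where "v = U *v a" using ker by blast
      then have "v \<bullet> v = a \<bullet> (transpose U *v v)"
        by (metis dot_lmul_matrix inner_commute transpose_matrix_vector transpose_transpose)
      then show False using v by simp
    qed
    then show "0 < v \<bullet> (mat_of_sym C0 *v v)" using psd by (metis psd_def order_le_less)
  qed blast
  have "isCont (\<lambda>p. slack (fst p) (snd p)) (C0, ?X)"
    using continuous_on_slack[of UNIV] continuous_on_eq_continuous_at[of UNIV] by blast
  then obtain d where d: "d > 0" "\<And>p. dist p (C0, ?X) < d \<Longrightarrow> dist (slack (fst p) (snd p)) C0 < l / 2"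
    using l(1) unfolding continuous_at_eps_delta by (metis slack0 fst_conv snd_conv half_gt_zero)
  \<comment> \<open>Uniqueness of the solution for \<open>C0\<close>, made uniform by compactness,
    so that minimizers for nearby costs cannot be far from \<open>?X\<close>.\<close>
  obtain h where h: "h > 0" "\<And>F. F \<in> M \<Longrightarrow> d / 2 \<le> dist (gram F) ?X \<Longrightarrow> h \<le> C0 \<bullet> (gram F - ?X)"
  proof -
    have "0 < C0 \<bullet> (gram F - ?X)" if F: "F \<in> {F \<in> M. d / 2 \<le> dist (gram F) ?X}" for F
    proof -
      have "gram F \<noteq> ?X" using F d(1) by auto
      moreover have "gram F = ?X" if "C0 \<bullet> gram F = 0"
      proof (rule kkt(2)[OF U rigid[OF U]])
        show "psd (C0 - constraint_adjoint A 0)" "mat_of_sym (C0 - constraint_adjoint A 0) ** U = 0"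
          "\<And>v. v \<bullet> (mat_of_sym (C0 - constraint_adjoint A 0) *v v) = 0 \<Longrightarrow> v \<in> range ((*v) U)"
          using psd CU ker by (simp_all add: constraint_adjoint_def)
        have "0 \<le> C0 \<bullet> X'" if "primal_feasible A b X'" for X'
          using that psd_factorization[of X'] inner_psd_gram(1)[OF psd]
          by (auto simp: primal_feasible_def)
        then show "primal_solution C0 A b (gram F)"
          using F \<open>C0 \<bullet> gram F = 0\<close>
          by (simp add: primal_solution_def primal_feasible_def psd_gram bm_feasible_def)
      qed
      ultimately show ?thesis
        using inner_psd_gram(1)[OF psd, of F] by (auto simp: inner_diff_right CX order_less_le)
    qed
    then show thesis
      by (rule compact_gap[OF compact_far, of "d / 2" ?X C0 ?X]) (use that in auto)
  qed
  have "bounded (gram ` M :: 'n symmat set)"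
    by (intro compact_imp_bounded compact_continuous_image continuous_on_gram compact_bm_feasible)
  then obtain B where B: "B > 0" "\<And>F. F \<in> M \<Longrightarrow> norm (gram F :: 'n symmat) \<le> B"
    unfolding bounded_pos by blast
  show thesis
  proof (rule that[of "min (d / 2) (h / (2 * B))"])
    show "min (d / 2) (h / (2 * B)) > 0" using d(1) h(1) B(1) by simp
    fix C assume C: "dist C C0 < min (d / 2) (h / (2 * B))"
    have "continuous_on M (\<lambda>F. C \<bullet> gram F)"
      by (intro continuous_intros continuous_on_gram)
    then obtain F where F: "F \<in> M" "\<And>H. H \<in> M \<Longrightarrow> C \<bullet> gram F \<le> C \<bullet> gram H"
      using continuous_attains_inf[OF compact_bm_feasible] U by blast
    have near: "dist (gram F) ?X < d / 2"
    proof (rule ccontr)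
      assume "\<not> ?thesis"
      then have "h \<le> C0 \<bullet> (gram F - ?X)" using h(2)[OF F(1)] by simp
      also have "\<dots> = C \<bullet> (gram F - ?X) - (C - C0) \<bullet> (gram F - ?X)" by (simp add: inner_diff_left)
      also have "\<dots> \<le> \<bar>(C - C0) \<bullet> (gram F - ?X)\<bar>" using F(2)[OF U] by (simp add: inner_diff_right)
      also have "\<dots> \<le> norm (C - C0) * norm (gram F - ?X)" by (rule Cauchy_Schwarz_ineq2)
      also have "\<dots> \<le> norm (C - C0) * (2 * B)"
        using norm_triangle_ineq4[of "gram F" ?X] B(2)[OF F(1)] B(2)[OF U]
        by (intro mult_left_mono) auto
      also have "\<dots> < h" using C B(1) by (simp add: dist_norm pos_less_divide_eq)
      finally show False by simp
    qed
    define Z where "Z = slack C (gram F)"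
    have ZF: "mat_of_sym Z ** F = 0"
      unfolding Z_def by (rule local_minimum(1)[of F 1]) (use F in \<open>auto simp: bm_objective_eq\<close>)
    have "dist (C, gram F) (C0, ?X) \<le> dist C C0 + dist (gram F) ?X"
      unfolding dist_Pair_Pair by (rule sqrt_sum_squares_le_sum) auto
    then have "dist (C, gram F) (C0, ?X) < d" using near C by simp
    from d(2)[OF this] have Zn: "norm (mat_of_sym (Z - C0)) < l / 2"
      by (simp add: Z_def dist_norm norm_symmat_def del: mat_of_sym_diff)
    have pos: "l / 2 * (norm v)\<^sup>2 \<le> v \<bullet> (mat_of_sym Z *v v)" if "transpose U *v v = 0" for v
    proof -
      have "\<bar>v \<bullet> (mat_of_sym (Z - C0) *v v)\<bar> \<le> l / 2 * (norm v)\<^sup>2"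
        using quadratic_form_bound[of v "mat_of_sym (Z - C0)"] Zn
        by (meson less_imp_le mult_right_mono order_trans zero_le_power2)
      moreover have "v \<bullet> (mat_of_sym Z *v v) = v \<bullet> (mat_of_sym C0 *v v) + v \<bullet> (mat_of_sym (Z - C0) *v v)"
        by (simp add: matrix_vector_mult_diff_rdistrib inner_diff_right)
      ultimately show ?thesis using l(2)[OF that] by (simp add: abs_le_iff)
    qed
    \<comment> \<open>If \<open>F *v a\<close> is orthogonal to the columns of \<open>U\<close>,
      then \<open>Z\<close> is positive there and yet annihilates it. The square matrix
      \<open>transpose U ** F\<close> is therefore invertible, so every vector is a vector in the
      range of \<open>F\<close> plus one orthogonal to \<open>U\<close>.\<close>
    have inj: "a = 0" if "(transpose U ** F) *v a = 0" for a
    proof -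
      have "transpose U *v (F *v a) = 0"
        using that by (simp add: matrix_vector_mul_assoc del: transpose_matrix_vector)
      from pos[OF this] have "l / 2 * (norm (F *v a))\<^sup>2 \<le> 0"
        using ZF by (simp add: matrix_vector_mul_assoc)
      then have "F *v a = 0" using l(1) by (simp add: mult_le_0_iff)
      then show ?thesis by (rule rigid_injective[OF rigid[OF F(1)]])
    qed
    have "surj ((*v) (transpose U ** F))"
      by (rule linear_injective_imp_surjective[OF matrix_vector_mul_linear])
        (use inj in \<open>auto simp: linear_injective_0[OF matrix_vector_mul_linear]\<close>)
    then have split: "\<exists>a q. v = F *v a + q \<and> transpose U *v q = 0" for v
    proof -
      obtain a where "transpose U *v v = (transpose U ** F) *v a"
        using \<open>surj _\<close> by (metis surjD)
      then have "transpose U *v (v - F *v a) = 0"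
        by (simp add: matrix_vector_mult_diff_distrib matrix_vector_mul_assoc del: transpose_matrix_vector)
      then show ?thesis by (intro exI[of _ a] exI[of _ "v - F *v a"]) simp
    qed
    have form: "\<exists>a q. v = F *v a + q \<and> l / 2 * (norm q)\<^sup>2 \<le> v \<bullet> (mat_of_sym Z *v v)" for v
    proof -
      obtain a q where q: "v = F *v a + q" "transpose U *v q = 0" using split by blast
      have ZFa: "mat_of_sym Z *v (F *v a) = 0" using ZF by (simp add: matrix_vector_mul_assoc)
      then have "v \<bullet> (mat_of_sym Z *v v) = q \<bullet> (mat_of_sym Z *v q)"
        using inner_sym_vec[of "F *v a" Z q] by (simp add: q(1) matrix_vector_right_distrib inner_add_left)
      then show ?thesis using pos[OF q(2)] q(1) by auto
    qed
    have "psd Z"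
      unfolding psd_def
    proof
      fix v
      obtain a q where "v = F *v a + q \<and> l / 2 * (norm q)\<^sup>2 \<le> v \<bullet> (mat_of_sym Z *v v)"
        using form[of v] by (elim exE)
      then have "l / 2 * (norm q)\<^sup>2 \<le> v \<bullet> (mat_of_sym Z *v v)" by (rule conjunct2)
      moreover have "0 \<le> l / 2 * (norm q)\<^sup>2" using l(1) by simp
      ultimately show "0 \<le> v \<bullet> (mat_of_sym Z *v v)" by linarith
    qed
    moreover have "v \<in> range ((*v) F)" if "v \<bullet> (mat_of_sym Z *v v) = 0" for v
    proof -
      obtain a q where q: "v = F *v a + q" "l / 2 * (norm q)\<^sup>2 \<le> v \<bullet> (mat_of_sym Z *v v)"
        using form[of v] by (elim exE conjE)
      then have "q = 0" using that l(1) by (simp add: mult_le_0_iff)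
      then show ?thesis using q(1) by simp
    qed
    ultimately show "unique_solution_of_rank CARD('r) C A b \<and> simple_sdp C A b"
      using kkt(1)[OF F(1) rigid[OF F(1)], of C "multiplier C (gram F)"] ZF
      unfolding Z_def slack_def by blast
  qed
qed

end

section \<open>The adversarial cost matrix\<close>

lemma inner_congruence:
  fixes N :: "real^'n^'n" and F :: "real^'j^'n" and U :: "real^'k^'n"
  shows "N \<bullet> (F ** T ** transpose U) = (transpose F ** N ** U) \<bullet> T"
proof -
  have "(F ** T ** transpose U) \<bullet> N = T \<bullet> (transpose F ** (N ** U))"
    unfolding inner_matrix_mult_right[of "F ** T"] transpose_transpose by (rule inner_matrix_mult_left)
  then show ?thesis by (simp add: inner_commute matrix_mul_assoc)
qed

context regular_constraints
begin

text \<open>For \<open>G = F L + U K\<close> the difference of the gram matrices of \<open>G\<close>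
  and \<open>F\<close> has this shape with \<open>T = L L^T - 1\<close> and
  \<open>R = L K^T\<close>, up to a term quadratic in \<open>K\<close>.\<close>

definition pair_map :: "real^'r^'n \<Rightarrow> real^'d^'n \<Rightarrow> real^'r^'r \<Rightarrow> real^'d^'r \<Rightarrow> real^'m" where
  "pair_map F U T R = (\<chi> i. mat_of_sym (A i) \<bullet>
    (F ** T ** transpose F + F ** R ** transpose U + U ** transpose R ** transpose F))"

lemma pair_map_inner:
  "pair_map F U T R \<bullet> y = mat_of_sym (constraint_adjoint A y) \<bullet>
    (F ** T ** transpose F + F ** R ** transpose U + U ** transpose R ** transpose F)"
  by (simp add: pair_map_def inner_vec_def[where 'b = "'m"] constraint_adjoint_def mat_of_sym_sum
      inner_sum_left mult.commute)

lemma dual_certificate: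
  fixes F :: "real^'r^'n" and U :: "real^'d^'n"
  assumes inj: "\<And>T R. transpose T = T \<Longrightarrow> pair_map F U T R = 0 \<Longrightarrow> T = 0 \<and> R = 0"
  obtains y B where
    "transpose F ** mat_of_sym (constraint_adjoint A y) ** F = - mat 1"
    "transpose U ** mat_of_sym (constraint_adjoint A y) ** F = 0"
    "B > 0" "\<And>T R. transpose T = T \<Longrightarrow> B * norm R \<le> norm (pair_map F U T R)"
proof -
  \<comment> \<open>Taking \<open>T\<close> from the type of symmetric matrices matters: a skew
    \<open>T\<close> contributes nothing, as the \<open>A i\<close> are symmetric.\<close>
  define \<Phi> :: "'r symmat \<times> (real^'d^'r) \<Rightarrow> real^'m" where
    "\<Phi> = (\<lambda>p. pair_map F U (mat_of_sym (fst p)) (snd p))"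
  have lin: "linear \<Phi>"
    by (rule linearI)
      (simp_all add: \<Phi>_def pair_map_def vec_eq_iff mmult.add_left mmult.add_right transpose_add transpose_scaleR
        mmult.scaleR_left mmult.scaleR_right inner_add_right algebra_simps)
  have "inj \<Phi>"
  proof (rule linear_injective_0[OF lin, THEN iffD2], intro allI impI)
    fix p assume "\<Phi> p = 0"
    then have "mat_of_sym (fst p) = 0 \<and> snd p = 0" unfolding \<Phi>_def by (intro inj) simp_all
    then show "p = 0" by (metis mat_of_sym_eq_iff mat_of_sym_zero prod.collapse zero_prod_def)
  qed
  obtain B where B: "B > 0" "\<And>p. B * norm p \<le> norm (\<Phi> p)"
    using linear_inj_bounded_below_pos[OF lin \<open>inj \<Phi>\<close>] by blast
  have "surj (adjoint \<Phi>)" using \<open>inj \<Phi>\<close> lin by simp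
  then obtain y where y: "adjoint \<Phi> y = (- Symmat (mat 1), 0)" by (metis surjD)
  define N where "N = mat_of_sym (constraint_adjoint A y)"
  have Nt: "transpose N = N" by (simp add: N_def)
  have key: "N \<bullet> (F ** T ** transpose F + F ** R ** transpose U + U ** transpose R ** transpose F) =
      - (mat 1 \<bullet> T)" if "transpose T = T" for T R
  proof -
    have "pair_map F U T R \<bullet> y = (Symmat T, R) \<bullet> adjoint \<Phi> y"
      using adjoint_works[OF lin, of "(Symmat T, R)" y] that by (simp add: \<Phi>_def mat_of_sym_Symmat)
    also have "\<dots> = - (mat 1 \<bullet> T)"
      using that by (simp add: y inner_symmat_def mat_of_sym_Symmat inner_commute)
    finally show ?thesis by (simp add: pair_map_inner N_def)
  qed
  have 1: "transpose F ** N ** F = - mat 1"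
  proof -
    \<comment> \<open>The residual is symmetric, hence admissible as its own test matrix in
      \<open>key\<close>; its norm must vanish.\<close>
    let ?T = "transpose F ** N ** F + mat 1"
    have t: "transpose ?T = ?T" by (simp add: transpose_add matrix_transpose_mul Nt matrix_mul_assoc)
    have "(transpose F ** N ** F) \<bullet> ?T = - (mat 1 \<bullet> ?T)"
      using key[OF t, of 0] by (simp add: inner_congruence transpose_zero)
    then have "?T \<bullet> ?T = 0" by (simp only: inner_add_left)
    then have "?T = 0" by simp
    then show ?thesis by (simp add: eq_neg_iff_add_eq_0)
  qed
  have 2: "transpose U ** N ** F = 0"
  proof -
    let ?R = "transpose F ** N ** U"
    have "N \<bullet> (F ** ?R ** transpose U) = ?R \<bullet> ?R" by (rule inner_congruence)
    moreover have "N \<bullet> (U ** transpose ?R ** transpose F) = N \<bullet> (F ** ?R ** transpose U)"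
      using inner_transpose[of N "F ** ?R ** transpose U"] by (simp add: Nt matrix_transpose_mul matrix_mul_assoc)
    ultimately have "?R \<bullet> ?R = 0"
      using key[of 0 ?R] by (simp add: inner_add_right transpose_zero)
    then have "transpose ?R = 0" by (simp add: transpose_zero)
    then show ?thesis by (simp add: matrix_transpose_mul Nt matrix_mul_assoc)
  qed
  have 3: "B * norm R \<le> norm (pair_map F U T R)" if "transpose T = T" for T R
  proof -
    have "B * norm R \<le> B * norm (Symmat T, R)"
      using B(1) norm_snd_le[of R "Symmat T"] by (intro mult_left_mono) auto
    also have "\<dots> \<le> norm (pair_map F U T R)"
      using B(2)[of "(Symmat T, R)"] that by (simp add: \<Phi>_def mat_of_sym_Symmat)
    finally show ?thesis .
  qed
  show thesis by (rule that[of y B]) (use 1 2 3 B(1) in \<open>simp_all add: N_def\<close>)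
qed

text \<open>Closeness is known only for gram matrices, so \<open>L\<close>, \<open>K\<close> and
  \<open>Y\<close> in \<open>adversarial_cost\<close> are each bounded through their own.\<close>

lemma norm_le_norm_gram: "(norm K)\<^sup>2 \<le> norm (K ** transpose K) * norm (mat 1 :: real^'k^'k)" for K :: "real^'j^'k"
proof -
  have "(norm K)\<^sup>2 = (K ** transpose K) \<bullet> mat 1"
    by (simp add: power2_norm_eq_inner inner_matrix_mult_right)
  also have "\<dots> \<le> norm (K ** transpose K) * norm (mat 1 :: real^'k^'k)" by (rule norm_cauchy_schwarz)
  finally show ?thesis .
qed

text \<open>In the Frobenius norm a square matrix is as far from having orthonormal rows as from having
  orthonormal columns.\<close>

lemma norm_gram_swap:
  "norm (L ** transpose L - mat 1) = norm (transpose L ** L - mat 1)" for L :: "real^'k^'k"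
proof -
  have "(L ** transpose L) \<bullet> (L ** transpose L) = (transpose L ** L) \<bullet> (transpose L ** L)"
    by (simp add: inner_matrix_mult_right[of L] inner_matrix_mult_left[of "transpose L"] matrix_mul_assoc)
  moreover have "(L ** transpose L) \<bullet> mat 1 = (transpose L ** L) \<bullet> mat 1"
    by (simp add: inner_matrix_mult_right[of L] inner_matrix_mult_left[of "transpose L"])
  moreover have "(X - Y) \<bullet> (X - Y) = X \<bullet> X - 2 * (X \<bullet> Y) + Y \<bullet> Y" for X Y :: "real^'k^'k"
    by (simp add: inner_diff_left inner_diff_right inner_commute[of Y X])
  ultimately show ?thesis by (simp only: norm_eq_sqrt_inner)
qed

text \<open>The core is the estimate \<open>norm K <= c * norm Y\<close>. Comparing constraint
  values bounds \<open>norm K\<close> by \<open>norm Y\<close> and squares of both; closeness to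
  \<open>F\<close> lets the square of \<open>norm K\<close> be absorbed on the left. The possibly
  negative contribution of \<open>N\<close> is then at most a constant times the square of
  \<open>norm Y\<close>, which \<open>t\<close> outweighs.\<close>

lemma adversarial_cost:
  fixes F :: "real^'r^'n" and U :: "real^'d^'n"
  assumes F: "F \<in> bm_feasible A b" and U: "\<And>a. U *v a = 0 \<Longrightarrow> a = 0"
    and inj: "\<And>T R. transpose T = T \<Longrightarrow> pair_map F U T R = 0 \<Longrightarrow> T = 0 \<and> R = 0"
  obtains C e where "psd C" "mat_of_sym C ** U = 0"
    "\<And>v. v \<bullet> (mat_of_sym C *v v) = 0 \<Longrightarrow> v \<in> range ((*v) U)"
    "0 < C \<bullet> gram F" "e > 0"
    "\<And>G :: real^'r^'n. G \<in> bm_feasible A b \<Longrightarrow> dist (gram G) (gram F) \<le> e \<Longrightarrow> gram G \<noteq> gram F \<Longrightarrow>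
      C \<bullet> gram F < C \<bullet> gram G"
proof -
  obtain y B where y: "transpose F ** mat_of_sym (constraint_adjoint A y) ** F = - mat 1"
      "transpose U ** mat_of_sym (constraint_adjoint A y) ** F = 0"
    and B: "B > 0" "\<And>T R. transpose T = T \<Longrightarrow> B * norm R \<le> norm (pair_map F U T R)"
    using dual_certificate[OF inj] by blast
  define N where "N = mat_of_sym (constraint_adjoint A y)"
  have Nt: "transpose N = N" by (simp add: N_def)
  \<comment> \<open>Three coordinates on the ambient space: \<open>P\<close> along \<open>F\<close>,
    \<open>S\<close> along \<open>U\<close>, and the projection \<open>E\<close> for the rest.
    Reading \<open>P\<close> off the certificate gives \<open>P F = 1\<close> and
    \<open>P U = 0\<close>, and makes \<open>C F\<close> equal to \<open>- N F\<close> later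
    on.\<close>
  define P where "P = - (transpose F ** N)"
  have Pt: "transpose P = - (N ** F)"
    by (simp add: P_def transpose_minus matrix_transpose_mul Nt)
  have PF: "P ** F = mat 1" using y(1) by (simp add: P_def N_def mmult.minus_left)
  have PU: "P ** U = 0"
  proof -
    have "transpose (transpose U ** N ** F) = 0" using y(2) by (simp add: N_def transpose_zero)
    then have "transpose F ** N ** U = 0"
      by (simp add: matrix_transpose_mul Nt matrix_mul_assoc transpose_zero)
    then show ?thesis by (simp add: P_def mmult.minus_left)
  qed
  \<comment> \<open>Any left inverse of \<open>U\<close>; the definition of \<open>S\<close>
    corrects it so that it also annihilates \<open>F\<close>.\<close>
  obtain V where V: "V ** U = mat 1"
    using matrix_left_invertible_injective[of U] U by (auto simp: linear_injective_0[OF matrix_vector_mul_linear])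
  define S where "S = V ** (mat 1 - F ** P)"
  have SF: "S ** F = 0"
    by (simp add: S_def mmult.diff_left PF flip: matrix_mul_assoc)
  have SU: "S ** U = mat 1"
    by (simp add: S_def mmult.diff_left PU V flip: matrix_mul_assoc)
  define E where "E = mat 1 - F ** P - U ** S"
  have EF: "E ** F = 0" and EU: "E ** U = 0"
    by (simp_all add: E_def mmult.diff_left PF PU SF SU flip: matrix_mul_assoc)
  have EE: "E ** E = E"
    by (subst (2) E_def) (simp add: mmult.diff_right EF EU matrix_mul_assoc)
  have dec: "v = F *v (P *v v) + U *v (S *v v) + E *v v" for v
    by (simp add: E_def matrix_vector_mult_diff_rdistrib matrix_vector_mul_assoc)
  obtain a where a: "a > 0"
    "\<And>Q :: real^'n^'n. norm (\<chi> i. mat_of_sym (A i) \<bullet> Q) \<le> norm Q * a"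
  proof -
    have "bounded_linear (\<lambda>Q :: real^'n^'n. (\<chi> i. mat_of_sym (A i) \<bullet> Q) :: real^'m)"
      by (intro linear_conv_bounded_linear[THEN iffD1] linearI)
        (simp_all add: vec_eq_iff inner_add_right)
    from bounded_linear.pos_bounded[OF this] show thesis using that by blast
  qed
  define l where "l = norm (mat 1 :: real^'r^'r) + 1"
  \<comment> \<open>The common factor carries a bound on \<open>?Q\<close> over to \<open>K\<close>.
    The rest of \<open>c1\<close>, \<open>c2\<close> and \<open>c3\<close> comes from the
    coefficients of \<open>norm Y\<close>, of the square of \<open>norm K\<close> and of the square
    of \<open>norm Y\<close>.\<close>
  define c1 where "c1 = 2 * l / B * a * 2 * norm F * l"
  define c2 where "c2 = 2 * l / B * a * 2 * (norm U)\<^sup>2"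
  define c3 where "c3 = 2 * l / B * a * 2"
  \<comment> \<open>The factor 2 accounts for the half of \<open>norm K\<close> that is absorbed. In
    \<open>t\<close>, the summand 1 is the gain that remains once \<open>N\<close> is
    outweighed.\<close>
  define c where "c = 2 * (c1 + c3)"
  define t where "t = norm N * (norm U * c + 1)\<^sup>2 + 1"
  have l: "l \<ge> 1" by (simp add: l_def)
  have cs: "c1 \<ge> 0" "c2 \<ge> 0" "c3 \<ge> 0" "c \<ge> 0"
    using l B(1) a(1) by (simp_all add: c1_def c2_def c3_def c_def)
  have t: "t \<ge> 1" by (simp add: t_def)
  define C where "C = Symmat (transpose P ** P + t *\<^sub>R (transpose E ** E))"
  have C: "mat_of_sym C = transpose P ** P + t *\<^sub>R (transpose E ** E)"
    unfolding C_def
    by (rule mat_of_sym_Symmat)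
      (simp add: transpose_add matrix_transpose_mul
        transpose_scaleR)
  have quad: "v \<bullet> (mat_of_sym C *v v) = (norm (P *v v))\<^sup>2 + t * (norm (E *v v))\<^sup>2" for v
  proof -
    have sq: "v \<bullet> ((transpose Q ** Q) *v v) = (norm (Q *v v))\<^sup>2" for Q :: "real^'n^'k"
      using dot_lmul_matrix[of v "transpose Q" "Q *v v"]
      by (simp add: power2_norm_eq_inner vector_transpose_matrix flip: matrix_vector_mul_assoc)
    show ?thesis
      by (simp add: C matrix_vector_mult_add_rdistrib inner_add_right sq flip: scaleR_matrix_vector_assoc)
  qed
  have CF: "mat_of_sym C ** F = transpose P"
    by (simp add: C mmult.add_left mmult.scaleR_left PF EF flip: matrix_mul_assoc)
  have psd: "psd C" using t by (simp add: psd_def quad)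
  have CU: "mat_of_sym C ** U = 0"
    by (simp add: C mmult.add_left mmult.scaleR_left PU EU flip: matrix_mul_assoc)
  have ker: "v \<in> range ((*v) U)" if "v \<bullet> (mat_of_sym C *v v) = 0" for v
  proof -
    have "(norm (P *v v))\<^sup>2 = 0 \<and> t * (norm (E *v v))\<^sup>2 = 0"
      using that t unfolding quad by (subst add_nonneg_eq_0_iff[symmetric]) auto
    then have "P *v v = 0" "E *v v = 0" using t by simp_all
    then show ?thesis using dec[of v] by simp
  qed
  have pos: "0 < C \<bullet> gram F"
  proof -
    have "C \<bullet> gram F = transpose P \<bullet> F" by (simp add: inner_gram CF)
    also have "\<dots> = mat 1 \<bullet> (P ** F)"
      using inner_matrix_mult_left[of "transpose P" "mat 1" F] by simp
    also have "\<dots> > 0"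
    proof -
      have "(mat 1 :: real^'r^'r) \<noteq> 0"
        by (metis mat_0 rank_0 rank_I zero_less_card_finite less_irrefl)
      then show ?thesis by (simp add: PF)
    qed
    finally show ?thesis .
  qed
  define Z where "Z = C + constraint_adjoint A y"
  have mZ: "mat_of_sym Z = mat_of_sym C + N" by (simp add: Z_def N_def)
  have ZF: "mat_of_sym Z ** F = 0" by (simp add: mZ mmult.add_left CF Pt)
  have diff: "C \<bullet> gram G - C \<bullet> gram F = Z \<bullet> gram G" if "G \<in> bm_feasible A b" for G :: "real^'r^'n"
  proof -
    have "constraint_adjoint A y \<bullet> gram G = constraint_adjoint A y \<bullet> gram F"
      using constraint_adjoint[of A "gram G" y] constraint_adjoint[of A "gram F" y] that F
      by (simp add: bm_feasible_def inner_commute)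
    moreover have "Z \<bullet> gram F = 0" by (simp add: inner_gram ZF)
    ultimately show ?thesis by (simp add: Z_def inner_add_left)
  qed
  define \<rho> where "\<rho> = min 1 (1 / (2 * (c2 + 1)))"
  have \<rho>: "\<rho> > 0" "\<rho> \<le> 1" "c2 * \<rho> \<le> 1 / 2"
  proof -
    show "\<rho> > 0" "\<rho> \<le> 1" using cs by (simp_all add: \<rho>_def)
    have "c2 * \<rho> \<le> c2 * (1 / (2 * (c2 + 1)))" using cs by (intro mult_left_mono) (simp_all add: \<rho>_def)
    also have "\<dots> \<le> 1 / 2" using cs by (simp add: divide_simps)
    finally show "c2 * \<rho> \<le> 1 / 2" .
  qed
  define p where "p = (norm P)\<^sup>2"
  define s where "s = (norm S)\<^sup>2 * norm (mat 1 :: real^'d^'d)"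
  define q where "q = (norm E)\<^sup>2 * norm (mat 1 :: real^'n^'n)"
  \<comment> \<open>Three requirements, each obtained from a congruence applied to \<open>D\<close>:
    L L^T is within 1/2 of the identity, \<open>norm K\<close> is at most \<open>\<rho>\<close>, and
    so is \<open>norm Y\<close>. The added 1 in each denominator avoids division by zero.\<close>
  define e where "e = min ((1 / 2) / (p + 1)) (min (\<rho>\<^sup>2 / (s + 1)) (\<rho>\<^sup>2 / (q + 1)))"
  have nonneg: "p \<ge> 0" "s \<ge> 0" "q \<ge> 0" by (simp_all add: p_def s_def q_def)
  have e: "e > 0" using nonneg \<rho>(1) by (simp add: e_def)
  have small: "k * x \<le> r" if "x \<le> r / (k + 1)" "0 \<le> k" "0 \<le> x" for k x r :: real
  proof -
    have "k * x \<le> (k + 1) * x" using that by (simp add: algebra_simps)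
    also have "\<dots> \<le> r" using that by (simp add: pos_le_divide_eq mult.commute)
    finally show ?thesis .
  qed
  have strict: "C \<bullet> gram F < C \<bullet> gram G"
    if G: "G \<in> bm_feasible A b" and d: "dist (gram G) (gram F) \<le> e" and ne: "gram G \<noteq> gram F"
    for G :: "real^'r^'n"
  proof -
    define D where "D = G ** transpose G - F ** transpose F"
    define x where "x = norm D"
    have x: "x \<le> e" "0 \<le> x"
      using d by (simp_all add: x_def D_def dist_norm norm_symmat_def mat_of_sym_gram)
    define L where "L = P ** G"
    define K where "K = S ** G"
    define Y where "Y = E ** G"
    define W where "W = U ** K + Y"
    have G_eq: "G = F ** L + W"
      by (simp add: W_def L_def K_def Y_def E_def mmult.diff_left matrix_mul_assoc)
    have cong: "norm (Q ** D ** transpose Q) \<le> (norm Q)\<^sup>2 * x" for Q :: "real^'n^'k"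
    proof -
      have "norm (Q ** D ** transpose Q) \<le> norm (Q ** D) * norm (transpose Q)" by (rule norm_matrix_mult_le)
      also have "\<dots> \<le> norm Q * x * norm Q"
        unfolding x_def norm_transpose by (intro mult_right_mono norm_matrix_mult_le) simp
      finally show ?thesis by (simp add: power2_eq_square mult_ac)
    qed
    have LL: "L ** transpose L - mat 1 = P ** D ** transpose P"
    proof -
      have "mat 1 = (P ** F) ** transpose (P ** F)" by (simp add: PF)
      then show ?thesis
        by (simp add: L_def D_def mmult.diff_left mmult.diff_right matrix_transpose_mul matrix_mul_assoc)
    qed
    have KK: "K ** transpose K = S ** D ** transpose S"
    proof -
      have "S ** (F ** transpose F) ** transpose S = (S ** F) ** transpose (S ** F)"
        by (simp only: matrix_transpose_mul matrix_mul_assoc)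
      then have "S ** (F ** transpose F) ** transpose S = 0" by (simp add: SF)
      then show ?thesis
        by (simp add: K_def D_def mmult.diff_left mmult.diff_right matrix_transpose_mul matrix_mul_assoc)
    qed
    have YY: "Y ** transpose Y = E ** D ** transpose E"
    proof -
      have "E ** (F ** transpose F) ** transpose E = (E ** F) ** transpose (E ** F)"
        by (simp only: matrix_transpose_mul matrix_mul_assoc)
      then have "E ** (F ** transpose F) ** transpose E = 0" by (simp add: EF)
      then show ?thesis
        by (simp add: Y_def D_def mmult.diff_left mmult.diff_right matrix_transpose_mul matrix_mul_assoc)
    qed
    have L1: "norm (L ** transpose L - mat 1) \<le> 1 / 2"
      using cong[of P] small[of x "1 / 2" p] x nonneg unfolding LL p_def e_def by simp
    have "(norm K)\<^sup>2 \<le> \<rho>\<^sup>2"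
    proof -
      have "(norm K)\<^sup>2 \<le> (norm S)\<^sup>2 * x * norm (mat 1 :: real^'d^'d)"
        using norm_le_norm_gram[of K] cong[of S] unfolding KK
        by (meson mult_right_mono norm_ge_zero order_trans)
      also have "\<dots> \<le> \<rho>\<^sup>2" using small[of x "\<rho>\<^sup>2" s] x nonneg by (simp add: s_def e_def mult_ac)
      finally show ?thesis .
    qed
    then have K\<rho>: "norm K \<le> \<rho>" using \<rho>(1) by (simp add: power2_le_iff_abs_le)
    have "(norm Y)\<^sup>2 \<le> \<rho>\<^sup>2"
    proof -
      have "(norm Y)\<^sup>2 \<le> (norm E)\<^sup>2 * x * norm (mat 1 :: real^'n^'n)"
        using norm_le_norm_gram[of Y] cong[of E] unfolding YY
        by (meson mult_right_mono norm_ge_zero order_trans)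
      also have "\<dots> \<le> \<rho>\<^sup>2" using small[of x "\<rho>\<^sup>2" q] x nonneg by (simp add: q_def e_def mult_ac)
      finally show ?thesis .
    qed
    then have Y\<rho>: "norm Y \<le> 1" using \<rho>(1,2) by (simp add: power2_le_iff_abs_le)
    have Ll: "norm L \<le> l"
    proof -
      have "(norm L)\<^sup>2 \<le> norm (L ** transpose L) * norm (mat 1 :: real^'r^'r)" by (rule norm_le_norm_gram)
      also have "\<dots> \<le> l * l"
      proof (rule mult_mono)
        have "norm (L ** transpose L) \<le> norm (L ** transpose L - mat 1) + norm (mat 1 :: real^'r^'r)"
          using norm_triangle_ineq[of "L ** transpose L - mat 1" "mat 1"] by simp
        then show "norm (L ** transpose L) \<le> l" using L1 by (simp add: l_def)
      qed (use l in \<open>auto simp: l_def\<close>)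
      finally show ?thesis using l by (simp add: power2_le_iff_abs_le flip: power2_eq_square)
    qed
    \<comment> \<open>As \<open>L\<close> is square, \<open>norm_gram_swap\<close> makes L^T L as
      close to the identity as L L^T is, so \<open>K\<close> can be recovered from L K^T with an
      error of at most half its norm.\<close>
    have KL: "norm K \<le> 2 * l * norm (L ** transpose K)"
    proof -
      have "transpose K = transpose L ** (L ** transpose K) - (transpose L ** L - mat 1) ** transpose K"
        by (simp add: mmult.diff_left matrix_mul_assoc)
      then have "norm K \<le> norm (transpose L ** (L ** transpose K)) + norm ((transpose L ** L - mat 1) ** transpose K)"
        by (metis norm_transpose norm_triangle_ineq4)
      moreover have "norm (transpose L ** (L ** transpose K)) \<le> l * norm (L ** transpose K)"
        using norm_matrix_mult_le[of "transpose L" "L ** transpose K"] Ll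
        by (simp add: norm_transpose) (meson mult_right_mono norm_ge_zero order_trans)
      moreover have "norm ((transpose L ** L - mat 1) ** transpose K) \<le> 1 / 2 * norm K"
        using norm_matrix_mult_le[of "transpose L ** L - mat 1" "transpose K"] L1
        unfolding norm_gram_swap norm_transpose by (meson mult_right_mono norm_ge_zero order_trans)
      ultimately show ?thesis by linarith
    qed
    let ?T = "L ** transpose L - mat 1" and ?R = "L ** transpose K"
    let ?Q = "F ** L ** transpose Y + Y ** transpose L ** transpose F + W ** transpose W"
    \<comment> \<open>\<open>G\<close> and \<open>F\<close> satisfy the same constraints, so the
      constraint values of \<open>D\<close> vanish; \<open>?Q\<close> collects the terms of
      \<open>D\<close> that are not of the shape seen by \<open>pair_map\<close>.\<close>
    have pm: "pair_map F U ?T ?R = - (\<chi> i. mat_of_sym (A i) \<bullet> ?Q)"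
    proof -
      have "mat_of_sym (A i) \<bullet> D = 0" for i
      proof -
        have "A i \<bullet> gram G = A i \<bullet> gram F"
          using G F by (simp add: bm_feasible_def constraint_map_def vec_eq_iff)
        then show ?thesis by (simp add: D_def inner_symmat_def mat_of_sym_gram inner_diff_right)
      qed
      moreover have "D = (F ** ?T ** transpose F + F ** ?R ** transpose U + U ** transpose ?R ** transpose F) + ?Q"
        unfolding D_def
        by (subst (1 2) G_eq)
          (simp add: W_def mmult.add_left mmult.add_right mmult.diff_left mmult.diff_right transpose_add
            matrix_transpose_mul matrix_mul_assoc)
      ultimately have "mat_of_sym (A i) \<bullet> (F ** ?T ** transpose F + F ** ?R ** transpose U + U ** transpose ?R ** transpose F)
          + mat_of_sym (A i) \<bullet> ?Q = 0" for i
        by (metis inner_add_right)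
      then show ?thesis by (simp add: pair_map_def vec_eq_iff eq_neg_iff_add_eq_0)
    qed
    have Tt: "transpose ?T = ?T" by (simp add: transpose_diff matrix_transpose_mul)
    have W1: "norm W \<le> norm U * norm K + norm Y"
      unfolding W_def by (rule order_trans[OF norm_triangle_ineq]) (simp add: norm_matrix_mult_le)
    have W2: "(norm W)\<^sup>2 \<le> 2 * (norm U)\<^sup>2 * (norm K)\<^sup>2 + 2 * (norm Y)\<^sup>2"
    proof -
      have "(norm W)\<^sup>2 \<le> (norm U * norm K + norm Y)\<^sup>2" using W1 by (rule power_mono) simp
      also have "\<dots> \<le> 2 * (norm U)\<^sup>2 * (norm K)\<^sup>2 + 2 * (norm Y)\<^sup>2"
        using zero_le_power2[of "norm U * norm K - norm Y"]
        by (simp add: power2_sum power2_diff power_mult_distrib)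
      finally show ?thesis .
    qed
    have Q: "norm ?Q \<le> 2 * norm F * l * norm Y + (norm W)\<^sup>2"
    proof -
      have FLY: "norm (F ** L ** transpose Y) \<le> norm F * l * norm Y"
      proof -
        have "norm (F ** L ** transpose Y) \<le> norm (F ** L) * norm Y"
          using norm_matrix_mult_le[of "F ** L" "transpose Y"] by (simp add: norm_transpose)
        also have "\<dots> \<le> (norm F * norm L) * norm Y" by (intro mult_right_mono norm_matrix_mult_le) simp
        also have "\<dots> \<le> norm F * l * norm Y" by (intro mult_right_mono mult_left_mono Ll) auto
        finally show ?thesis .
      qed
      have "Y ** transpose L ** transpose F = transpose (F ** L ** transpose Y)"
        by (simp add: matrix_transpose_mul matrix_mul_assoc)
      then have "norm (Y ** transpose L ** transpose F) \<le> norm F * l * norm Y"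
        using FLY by (simp only: norm_transpose)
      moreover have "norm (W ** transpose W) \<le> (norm W)\<^sup>2"
        using norm_matrix_mult_le[of W "transpose W"] by (simp add: norm_transpose power2_eq_square)
      ultimately show ?thesis
        using FLY norm_triangle_ineq[of "F ** L ** transpose Y + Y ** transpose L ** transpose F" "W ** transpose W"]
          norm_triangle_ineq[of "F ** L ** transpose Y" "Y ** transpose L ** transpose F"] by linarith
    qed
    have "norm ?R \<le> (2 * norm F * l * norm Y + (norm W)\<^sup>2) * a / B"
    proof -
      have "B * norm ?R \<le> norm ?Q * a"
        using B(2)[OF Tt, of ?R] a(2)[of ?Q] unfolding pm norm_minus_cancel by (rule order_trans)
      also have "\<dots> \<le> (2 * norm F * l * norm Y + (norm W)\<^sup>2) * a"
        using Q a(1) by (intro mult_right_mono) auto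
      finally show ?thesis using B(1) by (simp add: pos_le_divide_eq mult.commute)
    qed
    then have "norm K \<le> 2 * l * ((2 * norm F * l * norm Y + (norm W)\<^sup>2) * a / B)"
      using KL l by (meson mult_left_mono order_trans zero_le_mult_iff zero_le_numeral zero_le_one)
    also have "\<dots> \<le> 2 * l * ((2 * norm F * l * norm Y + (2 * (norm U)\<^sup>2 * (norm K)\<^sup>2 + 2 * (norm Y)\<^sup>2)) * a / B)"
      using W2 l a(1) B(1) by (intro mult_left_mono divide_right_mono mult_right_mono add_left_mono) auto
    also have "\<dots> = c1 * norm Y + c2 * (norm K)\<^sup>2 + c3 * (norm Y)\<^sup>2"
      using B(1) by (simp add: c1_def c2_def c3_def field_simps)
    also have "\<dots> \<le> c1 * norm Y + 1 / 2 * norm K + c3 * norm Y"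
    proof -
      have "c2 * (norm K)\<^sup>2 \<le> c2 * \<rho> * norm K"
        using K\<rho> cs(2) by (simp add: power2_eq_square mult.assoc mult_left_mono mult_right_mono)
      also have "\<dots> \<le> 1 / 2 * norm K" using \<rho>(3) by (intro mult_right_mono) auto
      finally have 1: "c2 * (norm K)\<^sup>2 \<le> 1 / 2 * norm K" .
      have "(norm Y)\<^sup>2 \<le> norm Y" using Y\<rho> by (simp add: power2_eq_square mult_left_le)
      then have "c3 * (norm Y)\<^sup>2 \<le> c3 * norm Y" using cs(3) by (rule mult_left_mono)
      with 1 show ?thesis by linarith
    qed
    finally have KY: "norm K \<le> c * norm Y" by (simp add: c_def algebra_simps)
    have WY: "norm W \<le> (norm U * c + 1) * norm Y"
    proof -
      have "norm U * norm K \<le> norm U * (c * norm Y)" using KY by (intro mult_left_mono) auto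
      then show ?thesis using W1 by (simp add: algebra_simps)
    qed
    \<comment> \<open>Otherwise the estimates give \<open>K = 0\<close> and \<open>W = 0\<close>,
      injectivity makes \<open>L\<close> orthogonal, and \<open>G\<close> is only a rotation of
      \<open>F\<close>.\<close>
    have "Y \<noteq> 0"
    proof
      assume "Y = 0"
      then have "K = 0" "W = 0" using KY WY by simp_all
      have "(\<chi> i. mat_of_sym (A i) \<bullet> ?Q) = (0 :: real^'m)"
        by (simp add: \<open>Y = 0\<close> \<open>W = 0\<close> transpose_zero mmult.zero_right vec_eq_iff)
      then have "pair_map F U ?T 0 = 0"
        using pm by (simp add: \<open>K = 0\<close> transpose_zero mmult.zero_right)
      then have "?T = 0" using inj[OF Tt] by blast
      then have "L ** transpose L = mat 1" by simp
      then have "F ** L ** transpose (F ** L) = F ** transpose F"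
        by (metis matrix_mul_assoc matrix_mul_rid matrix_transpose_mul)
      moreover have "G = F ** L" using G_eq \<open>W = 0\<close> by simp
      ultimately have "mat_of_sym (gram G) = mat_of_sym (gram F)" by (simp only: mat_of_sym_gram)
      then show False using ne by (simp only: mat_of_sym_eq_iff)
    qed
    have EW: "E ** W = Y"
    proof -
      have "E ** W = E ** G - E ** F ** L"
        by (subst G_eq) (simp add: mmult.add_right matrix_mul_assoc)
      then show ?thesis by (simp add: EF Y_def)
    qed
    have "Z \<bullet> gram G = (mat_of_sym Z ** W) \<bullet> W"
    proof -
      have ZG: "mat_of_sym Z ** G = mat_of_sym Z ** W"
        by (subst G_eq) (simp add: mmult.add_right matrix_mul_assoc ZF)
      have "Z \<bullet> gram G = (mat_of_sym Z ** W) \<bullet> G" unfolding inner_gram ZG ..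
      also have "\<dots> = W \<bullet> (mat_of_sym Z ** G)" by (rule inner_sym_mult)
      also have "\<dots> = (mat_of_sym Z ** W) \<bullet> W" unfolding ZG by (rule inner_commute)
      finally show ?thesis .
    qed
    also have "\<dots> = (P ** W) \<bullet> (P ** W) + t * (Y \<bullet> Y) + (N ** W) \<bullet> W"
    proof -
      have sq: "(transpose Q ** Q ** W) \<bullet> W = (Q ** W) \<bullet> (Q ** W)" for Q :: "real^'n^'k"
        using inner_matrix_mult_left[of "transpose Q" "Q ** W" W] by (simp add: matrix_mul_assoc)
      show ?thesis
        by (simp add: mZ C mmult.add_left mmult.scaleR_left inner_add_left sq EW)
    qed
    also have "\<dots> \<ge> t * (norm Y)\<^sup>2 - norm N * (norm W)\<^sup>2"
    proof -
      have "\<bar>(N ** W) \<bullet> W\<bar> \<le> norm (N ** W) * norm W" by (rule Cauchy_Schwarz_ineq2)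
      also have "\<dots> \<le> norm N * norm W * norm W" by (intro mult_right_mono norm_matrix_mult_le) simp
      finally have "- (norm N * (norm W)\<^sup>2) \<le> (N ** W) \<bullet> W" by (simp add: power2_eq_square mult.assoc abs_le_iff)
      moreover have "0 \<le> (P ** W) \<bullet> (P ** W)" by (rule inner_ge_zero)
      ultimately show ?thesis unfolding power2_norm_eq_inner by linarith
    qed
    finally have "t * (norm Y)\<^sup>2 - norm N * (norm W)\<^sup>2 \<le> Z \<bullet> gram G" .
    moreover have "norm N * (norm W)\<^sup>2 \<le> norm N * ((norm U * c + 1) * norm Y)\<^sup>2"
      using WY by (intro mult_left_mono power_mono) auto
    moreover have "t * (norm Y)\<^sup>2 = norm N * ((norm U * c + 1) * norm Y)\<^sup>2 + (norm Y)\<^sup>2"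
      unfolding t_def power_mult_distrib by (simp only: distrib_right mult_1 mult.assoc)
    ultimately have "(norm Y)\<^sup>2 \<le> Z \<bullet> gram G" by linarith
    moreover have "(norm Y)\<^sup>2 > 0" using \<open>Y \<noteq> 0\<close> by simp
    ultimately show ?thesis using diff[OF G] by linarith
  qed
  show thesis using that[OF psd CU ker pos e strict] by blast
qed

end

section \<open>From one cost matrix to a set of positive measure\<close>

text \<open>The two manifold structures have different tasks: factor size \<open>r\<close> carries
  the spurious point, while factor size \<open>d\<close> supplies the minimizers that certify
  simplicity. The costs good for both contain a ball.\<close>

theorem failing_costs:
  fixes A :: "'m::finite \<Rightarrow> 'n::finite symmat" and F :: "real^'r^'n" and U :: "real^'d^'n"
  assumes "bm_manifold TYPE('r) A b w" "bm_manifold TYPE('d) A b w"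
    and F: "F \<in> bm_feasible A b" and U: "U \<in> bm_feasible A b"
    and rigid: "\<And>G :: real^'d^'n. G \<in> bm_feasible A b \<Longrightarrow> regular_constraints.rigid A G"
    and inj: "\<And>T R. transpose T = T \<Longrightarrow> regular_constraints.pair_map A F U T R = 0 \<Longrightarrow> T = 0 \<and> R = 0"
    and le: "CARD('d) \<le> CARD('r)"
  shows "\<exists>W :: 'n symmat set. W \<in> sets lebesgue \<and> 0 < emeasure lebesgue W \<and>
    (\<forall>C\<in>W. unique_solution_of_rank CARD('d) C A b \<and> simple_sdp C A b \<and> bm_fails TYPE('r) C A b)"
proof -
  interpret R: bm_manifold A b w "TYPE('r)" by fact
  interpret D: bm_manifold A b w "TYPE('d)" by fact
  have injU: "U *v a = 0 \<Longrightarrow> a = 0" for a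
    using R.rigid_injective[OF rigid[OF U]] by blast
  obtain C0 e where C0: "psd C0" "mat_of_sym C0 ** U = 0"
    "\<And>v. v \<bullet> (mat_of_sym C0 *v v) = 0 \<Longrightarrow> v \<in> range ((*v) U)" "0 < C0 \<bullet> gram F"
    and e: "e > 0" "\<And>G :: real^'r^'n. G \<in> bm_feasible A b \<Longrightarrow> dist (gram G) (gram F) \<le> e \<Longrightarrow>
      gram G \<noteq> gram F \<Longrightarrow> C0 \<bullet> gram F < C0 \<bullet> gram G"
    using R.adversarial_cost[OF F injU inj] by blast
  obtain h :: "'d \<Rightarrow> 'r" where h: "inj h"
    using le card_le_inj[of "UNIV :: 'd set" "UNIV :: 'r set"] by auto
  \<comment> \<open>\<open>U ** J\<close> is \<open>U\<close> with its columns placed among zero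
    columns: a feasible point of factor size \<open>r\<close> whose cost is 0, hence below that of
    \<open>F\<close>.\<close>
  define J :: "real^'r^'d" where "J = (\<chi> i j. if j = h i then 1 else 0)"
  have "J ** transpose J = mat 1"
    using h by (auto simp: J_def vec_eq_iff matrix_matrix_mult_def transpose_def mat_def inj_def
        if_distrib[of "\<lambda>x. x * _"] cong: if_cong)
  then have gramJ: "gram (U ** J) = gram U"
    unfolding gram_def matrix_transpose_mul by (metis matrix_mul_assoc matrix_mul_rid)
  obtain d1 where d1: "d1 > 0" "\<And>C. dist C C0 < d1 \<Longrightarrow> bm_fails TYPE('r) C A b"
  proof (rule R.bm_fails_near[OF F e])
    show "U ** J \<in> bm_feasible A b" using U by (simp add: bm_feasible_def gramJ)
    show "C0 \<bullet> gram (U ** J) < C0 \<bullet> gram F" unfolding gramJ using C0(4) by (simp add: inner_gram C0(2))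
  qed auto
  obtain d2 where d2: "d2 > 0"
    "\<And>C. dist C C0 < d2 \<Longrightarrow> unique_solution_of_rank CARD('d) C A b \<and> simple_sdp C A b"
    by (rule D.simple_near[OF U rigid C0(1-3)]) auto
  let ?W = "ball C0 (min d1 d2)"
  have "\<not> negligible ?W" using d1(1) d2(1) by (intro open_not_negligible) auto
  moreover have W: "?W \<in> sets lebesgue" by simp
  ultimately have "emeasure lebesgue ?W \<noteq> 0" using negligible_iff_emeasure0 by blast
  then have "0 < emeasure lebesgue ?W" by (simp add: zero_less_iff_neq_zero)
  then show ?thesis
    using W d1(2) d2(2) by (intro exI[of _ ?W]) (auto simp: dist_commute)
qed

section \<open>The three classes of programs\<close>

lemma matrix_mult_transpose_entry: "(H ** transpose G) $ k $ l = H $ k \<bullet> G $ l"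
  for H :: "real^'r^'n" and G :: "real^'r^'m"
  by (simp add: matrix_matrix_mult_def transpose_def inner_vec_def)

lemma matrix_mult_row: "(F ** T) $ k = transpose T *v (F $ k)" for F :: "real^'r^'n" and T :: "real^'d^'r"
  by (simp add: vec_eq_iff matrix_matrix_mult_def matrix_vector_mult_def transpose_def mult.commute)

lemma inner_transpose_vec: "(transpose T *v x) \<bullet> y = x \<bullet> (T *v y)" for T :: "real^'d^'r"
  using dot_lmul_matrix[of x T y] by simp

lemma congruence_entry: "(F ** T ** transpose G) $ k $ l = F $ k \<bullet> (T *v G $ l)"
  for F :: "real^'r^'n" and T :: "real^'d^'r" and G :: "real^'d^'m"
  unfolding matrix_mult_transpose_entry by (simp only: matrix_mult_row inner_transpose_vec)

section \<open>ProductSDP: a product of spheres\<close>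

context
  fixes S :: "'m::finite \<Rightarrow> 'n::finite set"
  assumes ne: "\<And>i. S i \<noteq> {}" and disj: "disjoint_family S" and cover: "(\<Union>i. S i) = UNIV"
begin

lemma mat_product_mats:
  "mat_of_sym (product_mats S i) = (\<chi> k l. if k = l \<and> k \<in> S i then 1 else 0)"
  unfolding product_mats_def by (rule mat_of_sym_Symmat) (auto simp: transpose_def vec_eq_iff)

lemma product_mats_mult:
  "mat_of_sym (product_mats S i) ** G = (\<chi> k. if k \<in> S i then G $ k else 0)"
  for G :: "real^'r^'n"
proof -
  have "(mat_of_sym (product_mats S i) ** G) $ k $ j = (if k \<in> S i then G $ k else 0) $ j" for k j
  proof -
    have "(mat_of_sym (product_mats S i) ** G) $ k $ j =
        (\<Sum>l\<in>UNIV. (if k = l \<and> k \<in> S i then 1 else 0) * G $ l $ j)"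
      by (simp add: matrix_matrix_mult_def mat_product_mats)
    also have "\<dots> = (\<Sum>l\<in>UNIV. if l = k then (if k \<in> S i then G $ l $ j else 0) else 0)"
      by (intro sum.cong) auto
    finally have "(mat_of_sym (product_mats S i) ** G) $ k $ j = \<dots>" .
    then show ?thesis by simp
  qed
  then show ?thesis by (simp add: vec_eq_iff)
qed

lemma product_mats_inner:
  "mat_of_sym (product_mats S i) \<bullet> B = (\<Sum>k\<in>S i. B $ k $ k)"
proof -
  have "(\<Sum>l\<in>UNIV. (if k = l \<and> k \<in> S i then 1 else 0) * B $ k $ l) = (if k \<in> S i then B $ k $ k else 0)" for k
    by (simp add: if_distrib[of "\<lambda>x. x * _"] cong: if_cong)
  then have "mat_of_sym (product_mats S i) \<bullet> B = (\<Sum>k\<in>UNIV. if k \<in> S i then B $ k $ k else 0)"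
    by (simp add: inner_vec_def mat_product_mats)
  then show ?thesis by (simp add: sum.If_cases)
qed

lemma product_disjoint: "k \<in> S i \<Longrightarrow> k \<in> S j \<longleftrightarrow> i = j"
  using disj by (auto simp: disjoint_family_on_def)

text \<open>The constraint matrices are complementary coordinate projections; the tangent generator
  below rests on this.\<close>

lemma product_mats_idem:
  "mat_of_sym (product_mats S i) ** (mat_of_sym (product_mats S j) ** G) =
    (if i = j then mat_of_sym (product_mats S i) ** G else 0)" for G :: "real^'r^'n"
  using product_disjoint by (auto simp: product_mats_mult vec_eq_iff)

lemma product_mats_sum: "(\<Sum>i\<in>UNIV. mat_of_sym (product_mats S i) ** G) = G" for G :: "real^'r^'n"
proof -
  have "(\<Sum>i\<in>UNIV. mat_of_sym (product_mats S i) ** G) $ k = G $ k" for k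
  proof -
    obtain j where j: "k \<in> S j" using cover by blast
    have "(\<Sum>i\<in>UNIV. mat_of_sym (product_mats S i) ** G) $ k = (\<Sum>i\<in>UNIV. if i = j then G $ k else 0)"
      unfolding sum_component product_mats_mult
      by (intro sum.cong) (use product_disjoint[OF j] in auto)
    then show ?thesis by simp
  qed
  then show ?thesis by (simp add: vec_eq_iff)
qed

lemma product_regular: "regular_constraints (product_mats S) product_rhs (\<lambda>_. 1)"
proof
  fix X :: "'n symmat" and i j :: 'm
  assume "constraint_map (product_mats S) X = product_rhs"
  then have X: "(\<Sum>k\<in>S i. mat_of_sym X $ k $ k) = 1"
    by (simp add: constraint_map_def product_rhs_def product_constraint vec_eq_iff)
  have "(mat_of_sym (product_mats S i) ** mat_of_sym X) \<bullet> mat_of_sym (product_mats S j) =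
      (\<Sum>k\<in>S j. if k \<in> S i then mat_of_sym X $ k $ k else 0)"
    by (subst inner_commute) (auto simp: product_mats_inner product_mats_mult intro!: sum.cong)
  also have "\<dots> = (if i = j then 1 else 0)"
  proof (cases "i = j")
    case True
    then show ?thesis using X by simp
  next
    case False
    then show ?thesis using product_disjoint by (auto intro!: sum.neutral)
  qed
  finally show "(mat_of_sym (product_mats S i) ** mat_of_sym X) \<bullet> mat_of_sym (product_mats S j) =
      (if i = j then 1 else 0)" .
next
  have "mat_of_sym (constraint_adjoint (product_mats S) (\<chi> i. 1)) = mat 1"
    using product_mats_sum[of "mat 1"] by (simp add: constraint_adjoint_def mat_of_sym_sum)
  then have "constraint_adjoint (product_mats S) (\<chi> i. 1) = Symmat (mat 1)"
    by (metis mat_of_sym_inverse)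
  then show "\<exists>e. constraint_adjoint (product_mats S) e = Symmat (mat 1)" by blast
qed simp

text \<open>The rows in one block form a point on a unit sphere. The generator is, block by block,
  the infinitesimal rotation in the plane of that point and the tangent vector; being skew, it
  preserves all constraint values.\<close>

lemma product_manifold: "bm_manifold TYPE('r::finite) (product_mats S) product_rhs (\<lambda>_. 1)"
proof -
  interpret regular_constraints "product_mats S" product_rhs "\<lambda>_. 1" by (rule product_regular)
  let ?A = "\<lambda>i. mat_of_sym (product_mats S i)"
  show ?thesis
  proof (unfold_locales)
    fix F U :: "real^'r^'n"
    assume F: "F \<in> bm_feasible (product_mats S) product_rhs" and U: "U \<in> tangent F"
    define L where "L = (\<lambda>G. \<Sum>i\<in>UNIV. ((?A i ** F) \<bullet> G) *\<^sub>R (?A i ** U) - ((?A i ** U) \<bullet> G) *\<^sub>R (?A i ** F))"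
    have orth: "(?A j ** G) \<bullet> (?A i ** V) = (if i = j then (?A i ** V) \<bullet> G else 0)" for i j and G V :: "real^'r^'n"
      using inner_sym_mult[of "product_mats S j" G "?A i ** V"]
      by (auto simp: product_mats_idem inner_commute[of G])
    show "\<exists>L. linear L \<and> L F = U \<and> (\<forall>(G :: real^'r^'n) i. (?A i ** G) \<bullet> L G = 0)"
    proof (intro exI[of _ L] conjI allI)
      show "linear L"
        unfolding L_def
        by (intro linear_compose_sum ballI linear_compose_sub linearI)
          (simp_all add: inner_add_right scaleR_left_distrib)
      have "(?A i ** F) \<bullet> F = 1" for i
        using F unfolding bm_feasible_iff by (simp add: product_rhs_def)
      moreover have "(?A i ** U) \<bullet> F = 0" for i
        using U inner_sym_mult[of "product_mats S i" U F] by (simp add: tangent_def inner_commute)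
      ultimately show "L F = U" by (simp add: L_def product_mats_sum)
      fix G :: "real^'r^'n" and j
      have "(?A j ** G) \<bullet> L G = (\<Sum>i\<in>UNIV. if i = j then
          ((?A i ** F) \<bullet> G) * ((?A i ** U) \<bullet> G) - ((?A i ** U) \<bullet> G) * ((?A i ** F) \<bullet> G) else 0)"
        unfolding L_def inner_sum_right by (intro sum.cong) (simp_all add: inner_diff_right orth)
      then show "(?A j ** G) \<bullet> L G = 0" by simp
    qed
  qed
qed

lemma product_rigid:
  assumes "F \<in> bm_feasible (product_mats S) product_rhs"
  shows "regular_constraints.rigid (product_mats S) (F :: real^unit^'n)"
proof -
  interpret regular_constraints "product_mats S" product_rhs "\<lambda>_. 1" by (rule product_regular)
  show ?thesis
    unfolding rigid_def
  proof (intro allI impI)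
    fix G :: "real^unit^unit"
    assume z: "\<forall>i. mat_of_sym (product_mats S i) \<bullet> (F ** G ** transpose F) = 0"
    have "G = (G $ () $ ()) *\<^sub>R mat 1" by (simp add: vec_eq_iff mat_def)
    then have "F ** G = (G $ () $ ()) *\<^sub>R F" by (metis mmult.scaleR_right matrix_mul_rid)
    then have "mat_of_sym (product_mats S i) \<bullet> (F ** G ** transpose F) =
        G $ () $ () * ((mat_of_sym (product_mats S i) ** F) \<bullet> F)" for i
      by (simp add: mmult.scaleR_left inner_matrix_mult_right)
    moreover have "(mat_of_sym (product_mats S i) ** F) \<bullet> F = 1" for i
      using assms unfolding bm_feasible_iff by (simp add: product_rhs_def)
    ultimately have "G $ () $ () = 0" using z by simp
    then show "G = 0" by (simp add: vec_eq_iff)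
  qed
qed

text \<open>\<open>F\<close> and \<open>U\<close> vanish outside one representative of each block.
  Block sums then reduce to single diagonal entries, and the frames of one vector apply as they do
  for MaxCut.\<close>

lemma product_failing:
  assumes "CARD('r::finite) * (CARD('r) + 1) div 2 + CARD('r) \<le> CARD('m)"
  shows "\<exists>W :: 'n symmat set. W \<in> sets lebesgue \<and> 0 < emeasure lebesgue W \<and>
    (\<forall>C\<in>W. unique_solution_of_rank 1 C (product_mats S) product_rhs \<and>
      simple_sdp C (product_mats S) product_rhs \<and> bm_fails TYPE('r) C (product_mats S) product_rhs)"
proof -
  interpret regular_constraints "product_mats S" product_rhs "\<lambda>_. 1" by (rule product_regular)
  obtain \<phi> :: "'m \<Rightarrow> unit \<Rightarrow> real^'r" where
    unit: "\<And>s i j. \<phi> s i \<bullet> \<phi> s j = (if i = j then 1 else 0)"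
    and inj: "\<And>(T :: real^'r^'r) (R :: real^unit^'r). transpose T = T \<Longrightarrow>
      (\<And>s i j. \<phi> s i \<bullet> (T *v \<phi> s j) + (transpose R *v \<phi> s i) $ j + (transpose R *v \<phi> s j) $ i = 0) \<Longrightarrow>
      T = 0 \<and> R = 0"
    using interpolating_frames[where 's = 'm and 'd = unit and 'r = 'r] assms by (auto simp: Suc_le_eq)
  have "\<exists>k. k \<in> S i" for i using ne[of i] by blast
  then obtain rep where rep: "\<And>i. rep i \<in> S i" by metis
  define block where "block k = (THE i. k \<in> S i)" for k
  have block: "block k = i" if "k \<in> S i" for k i
    unfolding block_def using that product_disjoint by blast
  define F :: "real^'r^'n" where "F = (\<chi> k. if k = rep (block k) then \<phi> (block k) () else 0)"
  define U :: "real^unit^'n" where "U = (\<chi> k. if k = rep (block k) then axis () 1 else 0)"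
  have F_row: "F $ k = (if k = rep i then \<phi> i () else 0)"
    and U_row: "U $ k = (if k = rep i then axis () 1 else 0)" if "k \<in> S i" for k i
    using block[OF that] block[OF rep] by (auto simp: F_def U_def)
  have F_rep: "F $ rep i = \<phi> i ()" and U_rep: "U $ rep i = axis () 1" for i
    using F_row[OF rep[of i]] U_row[OF rep[of i]] by simp_all
  have constraint: "mat_of_sym (product_mats S i) \<bullet> B = B $ rep i $ rep i"
    if "\<And>k. k \<in> S i \<Longrightarrow> k \<noteq> rep i \<Longrightarrow> B $ k $ k = 0" for B i
  proof -
    have "(\<Sum>k\<in>S i. B $ k $ k) = (\<Sum>k\<in>S i. if k = rep i then B $ k $ k else 0)"
      by (intro sum.cong) (use that in auto)
    then show ?thesis using rep by (simp add: product_mats_inner)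
  qed
  have feas: "V \<in> bm_feasible (product_mats S) product_rhs"
    if "\<And>i. V $ rep i \<bullet> V $ rep i = 1" "\<And>k i. k \<in> S i \<Longrightarrow> k \<noteq> rep i \<Longrightarrow> V $ k = 0" for V :: "real^'k^'n"
  proof (unfold bm_feasible_iff, intro allI)
    fix i
    have "mat_of_sym (product_mats S i) \<bullet> (V ** transpose V) = (V ** transpose V) $ rep i $ rep i"
      by (rule constraint) (use that(2) in \<open>simp add: matrix_mult_transpose_entry\<close>)
    then show "(mat_of_sym (product_mats S i) ** V) \<bullet> V = product_rhs $ i"
      using that(1) by (simp add: inner_matrix_mult_right matrix_mult_transpose_entry product_rhs_def)
  qed
  show ?thesis
  proof -
    have "\<exists>W :: 'n symmat set. W \<in> sets lebesgue \<and> 0 < emeasure lebesgue W \<and>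
      (\<forall>C\<in>W. unique_solution_of_rank CARD(unit) C (product_mats S) product_rhs \<and>
        simple_sdp C (product_mats S) product_rhs \<and> bm_fails TYPE('r) C (product_mats S) product_rhs)"
    proof (rule failing_costs[OF product_manifold product_manifold])
      show "F \<in> bm_feasible (product_mats S) product_rhs"
        by (rule feas) (simp_all add: F_rep F_row unit)
      show "U \<in> bm_feasible (product_mats S) product_rhs"
        by (rule feas) (simp_all add: U_rep U_row inner_axis_axis)
      show "CARD(unit) \<le> CARD('r)" by (simp add: Suc_le_eq)
      show "rigid G" if "G \<in> bm_feasible (product_mats S) product_rhs" for G :: "real^unit^'n"
        using that by (rule product_rigid)
      fix T :: "real^'r^'r" and R :: "real^unit^'r"
      assume T: "transpose T = T" and z: "pair_map F U T R = 0"
      show "T = 0 \<and> R = 0"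
      proof (rule inj[OF T])
        fix s :: 'm and i j :: unit
        let ?B = "F ** T ** transpose F + F ** R ** transpose U + U ** transpose R ** transpose F"
        have B: "?B $ k $ k = F $ k \<bullet> (T *v F $ k) + (transpose R *v F $ k) \<bullet> U $ k + U $ k \<bullet> (transpose R *v F $ k)" for k
          by (simp only: vector_add_component congruence_entry inner_transpose_vec)
        have "?B $ rep s $ rep s = 0"
        proof -
          have "mat_of_sym (product_mats S s) \<bullet> ?B = 0" using z by (simp add: pair_map_def vec_eq_iff)
          moreover have "mat_of_sym (product_mats S s) \<bullet> ?B = ?B $ rep s $ rep s"
            by (rule constraint) (simp only: B F_row U_row, simp)
          ultimately show ?thesis by simp
        qed
        then show "\<phi> s i \<bullet> (T *v \<phi> s j) + (transpose R *v \<phi> s i) $ j + (transpose R *v \<phi> s j) $ i = 0"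
          unfolding B F_rep U_rep
          by (simp add: inner_axis inner_axis' del: transpose_matrix_vector)
      qed
    qed
    then show ?thesis by simp
  qed
qed

end

section \<open>OrthogonalCut: a product of Stiefel manifolds\<close>

lemma mat_orthcut_mats:
  "mat_of_sym (orthcut_mats q) = (\<chi> k l.
    if fst k = fst q \<and> fst l = fst q \<and> Upair (snd k) (snd l) = snd q
    then (if k = l then 1 else 1 / 2) else 0)"
proof -
  obtain s i j where q: "q = (s, Upair i j)" by (metis surj_pair uprod_exhaust)
  show ?thesis
    unfolding orthcut_mats_def q fst_conv snd_conv
    by (rule mat_of_sym_Symmat) (auto simp: transpose_def vec_eq_iff)
qed

lemma orthcut_inner:
  "mat_of_sym (orthcut_mats (s, Upair i j)) \<bullet> B = (B $ (s, i) $ (s, j) + B $ (s, j) $ (s, i)) / 2"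
proof -
  have "mat_of_sym (orthcut_mats (s, Upair i j)) = (\<chi> k l.
      (1 / 2) * (if k = (s, i) then (if l = (s, j) then 1 else 0) else 0)
      + (1 / 2) * (if k = (s, j) then (if l = (s, i) then 1 else 0) else 0))"
    by (auto simp: mat_orthcut_mats vec_eq_iff)
  then have "mat_of_sym (orthcut_mats (s, Upair i j)) $ k $ l * B $ k $ l =
      (if k = (s, i) then (if l = (s, j) then B $ k $ l / 2 else 0) else 0)
      + (if k = (s, j) then (if l = (s, i) then B $ k $ l / 2 else 0) else 0)" for k l
    by simp
  then have "mat_of_sym (orthcut_mats (s, Upair i j)) \<bullet> B = B $ (s, i) $ (s, j) / 2 + B $ (s, j) $ (s, i) / 2"
    by (simp add: inner_vec_def sum.distrib sum_delta_delta)
  then show ?thesis by simp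
qed

lemma orthcut_mult_inner:
  "(mat_of_sym (orthcut_mats (s, Upair i j)) ** G) \<bullet> H =
    (H $ (s, i) \<bullet> G $ (s, j) + H $ (s, j) \<bullet> G $ (s, i)) / 2"
  by (simp add: inner_matrix_mult_right orthcut_inner matrix_mult_transpose_entry)

text \<open>The squared Frobenius norm of \<open>orthcut_mats q\<close>; off the diagonal that
  matrix has two entries 1/2.\<close>

definition orthcut_weight :: "'s \<times> 'd uprod \<Rightarrow> real" where
  "orthcut_weight q = (if proper_uprod (snd q) then 1 / 2 else 1)"

lemma orthcut_constraint_block:
  assumes "constraint_map orthcut_mats X = orthcut_rhs"
  shows "mat_of_sym X $ (s, i) $ (s, j) = (if i = j then 1 else 0)"
proof -
  have "orthcut_mats (s, Upair i j) \<bullet> X = orthcut_rhs $ (s, Upair i j)"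
    using assms by (auto simp: constraint_map_def vec_eq_iff)
  then show ?thesis by (simp add: orthcut_constraint orthcut_rhs_def)
qed

lemma orthcut_feasible_rows:
  "F \<in> bm_feasible orthcut_mats orthcut_rhs \<longleftrightarrow>
    (\<forall>s i j. F $ (s, i) \<bullet> F $ (s, j) = (if i = j then 1 else 0))"
  for F :: "real^'r^('s::finite \<times> 'd::finite)"
proof
  assume "F \<in> bm_feasible orthcut_mats orthcut_rhs"
  then show "\<forall>s i j. F $ (s, i) \<bullet> F $ (s, j) = (if i = j then 1 else 0)"
    using orthcut_constraint_block[of "gram F"]
    by (simp add: bm_feasible_def mat_of_sym_gram matrix_mult_transpose_entry)
next
  assume R: "\<forall>s i j. F $ (s, i) \<bullet> F $ (s, j) = (if i = j then 1 else 0)"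
  have "orthcut_mats (s, p) \<bullet> gram F = (if proper_uprod p then 0 else 1)" for s p
    using R by (cases p) (auto simp: orthcut_constraint mat_of_sym_gram matrix_mult_transpose_entry)
  then show "F \<in> bm_feasible orthcut_mats orthcut_rhs"
    by (auto simp: bm_feasible_def constraint_map_def orthcut_rhs_def vec_eq_iff)
qed

lemma orthcut_regular:
  "regular_constraints (orthcut_mats :: 's::finite \<times> 'd::finite uprod \<Rightarrow> _) orthcut_rhs orthcut_weight"
proof
  show "0 < orthcut_weight i" for i by (simp add: orthcut_weight_def)
next
  fix X :: "('s \<times> 'd) symmat" and q q' :: "'s \<times> 'd uprod"
  assume "constraint_map orthcut_mats X = orthcut_rhs"
  note X = orthcut_constraint_block[OF this]
  \<comment> \<open>The constraint matrix has entries in one diagonal block only, so in these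
    products it meets \<open>X\<close> only inside that block, where \<open>X\<close> is the
    identity.\<close>
  have entry: "(mat_of_sym (orthcut_mats q) ** mat_of_sym X) $ (t, a) $ (t, c) =
      mat_of_sym (orthcut_mats q) $ (t, a) $ (t, c)" for t a c
  proof -
    have "(mat_of_sym (orthcut_mats q) ** mat_of_sym X) $ (t, a) $ (t, c) =
        (\<Sum>k\<in>UNIV. if k = (t, c) then mat_of_sym (orthcut_mats q) $ (t, a) $ k else 0)"
      unfolding matrix_matrix_mult_def vec_lambda_beta
    proof (intro sum.cong refl)
      fix k :: "'s \<times> 'd"
      show "mat_of_sym (orthcut_mats q) $ (t, a) $ k * mat_of_sym X $ k $ (t, c) =
          (if k = (t, c) then mat_of_sym (orthcut_mats q) $ (t, a) $ k else 0)"
        by (cases k) (auto simp: mat_orthcut_mats X)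
    qed
    then show ?thesis by simp
  qed
  obtain t i j where q': "q' = (t, Upair i j)" by (metis surj_pair uprod_exhaust)
  have swap: "Upair j i = Upair i j" by simp
  have "(mat_of_sym (orthcut_mats q) ** mat_of_sym X) \<bullet> mat_of_sym (orthcut_mats q') =
      (mat_of_sym (orthcut_mats q) $ (t, i) $ (t, j) + mat_of_sym (orthcut_mats q) $ (t, j) $ (t, i)) / 2"
    unfolding q' inner_commute[of "_ ** _"] orthcut_inner entry ..
  also have "\<dots> = (if q = q' then orthcut_weight q else 0)"
  proof (cases "q = q'")
    case True
    then show ?thesis by (simp add: q' swap mat_orthcut_mats orthcut_weight_def)
  next
    case False
    then have "\<not> (fst q = t \<and> snd q = Upair i j)" by (metis q' prod.collapse)
    then have "mat_of_sym (orthcut_mats q) $ (t, i) $ (t, j) = 0" "mat_of_sym (orthcut_mats q) $ (t, j) $ (t, i) = 0"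
      by (auto simp only: mat_orthcut_mats vec_lambda_beta fst_conv snd_conv swap if_False split: if_splits)
    then show ?thesis using False by simp
  qed
  finally show "(mat_of_sym (orthcut_mats q) ** mat_of_sym X) \<bullet> mat_of_sym (orthcut_mats q') =
      (if q = q' then orthcut_weight q else 0)" .
next
  have "(\<Sum>q\<in>UNIV. (if proper_uprod (snd q) then 0 else 1) * mat_of_sym (orthcut_mats q) $ k $ l) =
      (mat 1 :: real^('s \<times> 'd)^('s \<times> 'd)) $ k $ l" for k l
  proof -
    have "(\<Sum>q\<in>UNIV. (if proper_uprod (snd q) then 0 else 1) * mat_of_sym (orthcut_mats q) $ k $ l) =
        (\<Sum>q\<in>UNIV. if q = (fst k, Upair (snd k) (snd l)) then (if k = l then 1 else 0) else 0)"
      by (intro sum.cong refl) (cases k; cases l; auto simp: mat_orthcut_mats)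
    then show ?thesis by (simp add: mat_def)
  qed
  then have "mat_of_sym (constraint_adjoint orthcut_mats (\<chi> q. if proper_uprod (snd q) then 0 else 1)) =
      (mat 1 :: real^('s \<times> 'd)^('s \<times> 'd))"
    by (simp add: constraint_adjoint_def mat_of_sym_sum vec_eq_iff)
  then have "constraint_adjoint orthcut_mats (\<chi> q. if proper_uprod (snd q) then 0 else 1) =
      (Symmat (mat 1) :: ('s \<times> 'd) symmat)"
    by (metis mat_of_sym_inverse)
  then show "\<exists>e. constraint_adjoint orthcut_mats e = (Symmat (mat 1) :: ('s \<times> 'd) symmat)" by blast
qed

lemma orthcut_manifold:
  "bm_manifold TYPE('r::finite) (orthcut_mats :: 's::finite \<times> 'd::finite uprod \<Rightarrow> _) orthcut_rhs orthcut_weight"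
proof -
  interpret regular_constraints "orthcut_mats :: 's \<times> 'd uprod \<Rightarrow> _" orthcut_rhs orthcut_weight
    by (rule orthcut_regular)
  show ?thesis
  proof (unfold_locales)
    fix F U :: "real^'r^('s \<times> 'd)"
    assume "F \<in> bm_feasible orthcut_mats orthcut_rhs" and U: "U \<in> tangent F"
    then have F: "F $ (s, i) \<bullet> F $ (s, j) = (if i = j then 1 else 0)" for s i j
      by (simp add: orthcut_feasible_rows)
    have skew: "U $ (s, i) \<bullet> F $ (s, j) + U $ (s, j) \<bullet> F $ (s, i) = 0" for s i j
    proof -
      have "(mat_of_sym (orthcut_mats (s, Upair i j)) ** F) \<bullet> U = 0"
        using U unfolding tangent_def by blast
      then show ?thesis by (simp add: orthcut_mult_inner)
    qed
    \<comment> \<open>A skew map sending each row of \<open>F\<close> in block \<open>s\<close> to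
      the same row of \<open>U\<close>. The first two sums are the skew map built from the pairs of
      rows; on the rows of \<open>F\<close> the second sum adds an unwanted term. The double sum
      cancels it and is itself skew because \<open>U\<close> is tangent.\<close>
    define om where "om s g = (\<Sum>i\<in>UNIV. (g \<bullet> F $ (s, i)) *\<^sub>R U $ (s, i)) -
      (\<Sum>i\<in>UNIV. (g \<bullet> U $ (s, i)) *\<^sub>R F $ (s, i)) -
      (\<Sum>i\<in>UNIV. \<Sum>j\<in>UNIV. ((g \<bullet> F $ (s, i)) * (U $ (s, i) \<bullet> F $ (s, j))) *\<^sub>R F $ (s, j))" for s g
    have om_linear: "om s (g + h) = om s g + om s h" "om s (c *\<^sub>R g) = c *\<^sub>R om s g" for s g h c
      by (simp_all add: om_def inner_add_left distrib_right scaleR_left_distrib sum.distrib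
          scaleR_right_diff_distrib scaleR_sum_right mult.assoc)
    have om_skew: "om s g \<bullet> h + om s h \<bullet> g = 0" for s g h
    proof -
      let ?b = "\<lambda>g h. (\<Sum>i\<in>UNIV. \<Sum>j\<in>UNIV. (g \<bullet> F $ (s, i)) * (U $ (s, i) \<bullet> F $ (s, j)) * (h \<bullet> F $ (s, j)))"
      let ?a = "\<lambda>g h. (\<Sum>i\<in>UNIV. (g \<bullet> F $ (s, i)) * (h \<bullet> U $ (s, i)))"
      have om: "om s g \<bullet> h = ?a g h - ?a h g - ?b g h" for g h
      proof -
        have "om s g \<bullet> h = (\<Sum>i\<in>UNIV. (g \<bullet> F $ (s, i)) * (U $ (s, i) \<bullet> h)) -
            (\<Sum>i\<in>UNIV. (g \<bullet> U $ (s, i)) * (F $ (s, i) \<bullet> h)) -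
            (\<Sum>i\<in>UNIV. \<Sum>j\<in>UNIV. (g \<bullet> F $ (s, i)) * (U $ (s, i) \<bullet> F $ (s, j)) * (F $ (s, j) \<bullet> h))"
          by (simp add: om_def inner_diff_left inner_sum_left mult.assoc)
        then show ?thesis
          by (simp only: inner_commute[of "_ $ _" h] mult.commute[of "g \<bullet> U $ _"])
      qed
      have "?b h g = (\<Sum>i\<in>UNIV. \<Sum>j\<in>UNIV. (h \<bullet> F $ (s, j)) * (U $ (s, j) \<bullet> F $ (s, i)) * (g \<bullet> F $ (s, i)))"
        by (rule sum.swap)
      also have "\<dots> = (\<Sum>i\<in>UNIV. \<Sum>j\<in>UNIV. - ((g \<bullet> F $ (s, i)) * (U $ (s, i) \<bullet> F $ (s, j)) * (h \<bullet> F $ (s, j))))"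
      proof (intro sum.cong refl)
        fix i j
        have "U $ (s, j) \<bullet> F $ (s, i) = - (U $ (s, i) \<bullet> F $ (s, j))" using skew[of s i j] by linarith
        then show "(h \<bullet> F $ (s, j)) * (U $ (s, j) \<bullet> F $ (s, i)) * (g \<bullet> F $ (s, i)) =
            - ((g \<bullet> F $ (s, i)) * (U $ (s, i) \<bullet> F $ (s, j)) * (h \<bullet> F $ (s, j)))" by simp
      qed
      also have "\<dots> = - ?b g h" by (simp add: sum_negf)
      finally show ?thesis by (simp add: om)
    qed
    have om_F: "om s (F $ (s, a)) = U $ (s, a)" for s a
    proof -
      have 1: "(\<Sum>i\<in>UNIV. (F $ (s, a) \<bullet> F $ (s, i)) *\<^sub>R U $ (s, i)) = U $ (s, a)"
        by (simp add: F if_distrib[of "\<lambda>c. c *\<^sub>R _"] cong: if_cong)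
      have 2: "(\<Sum>i\<in>UNIV. \<Sum>j\<in>UNIV. ((F $ (s, a) \<bullet> F $ (s, i)) * (U $ (s, i) \<bullet> F $ (s, j))) *\<^sub>R F $ (s, j)) =
          (\<Sum>j\<in>UNIV. (U $ (s, a) \<bullet> F $ (s, j)) *\<^sub>R F $ (s, j))"
        by (subst sum.swap) (simp add: F if_distrib[of "\<lambda>c. (c * _) *\<^sub>R _"] cong: if_cong)
      have "(\<Sum>j\<in>UNIV. (F $ (s, a) \<bullet> U $ (s, j)) *\<^sub>R F $ (s, j)) +
          (\<Sum>j\<in>UNIV. (U $ (s, a) \<bullet> F $ (s, j)) *\<^sub>R F $ (s, j)) = 0"
        unfolding sum.distrib[symmetric] scaleR_left_distrib[symmetric]
        using skew[of s a] by (intro sum.neutral ballI) (simp add: inner_commute add.commute)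
      then show ?thesis unfolding om_def 1 2 by (simp add: diff_diff_eq)
    qed
    define L where "L = (\<lambda>G :: real^'r^('s \<times> 'd). (\<chi> k. om (fst k) (G $ k)) :: real^'r^('s \<times> 'd))"
    show "\<exists>L. linear L \<and> L F = U \<and>
      (\<forall>(G :: real^'r^('s \<times> 'd)) q. (mat_of_sym (orthcut_mats q) ** G) \<bullet> L G = 0)"
    proof (intro exI[of _ L] conjI allI)
      show "linear L" by (rule linearI) (simp_all add: L_def vec_eq_iff om_linear)
      show "L F = U" unfolding L_def by (subst vec_eq_iff) (auto simp: om_F)
      fix G :: "real^'r^('s \<times> 'd)" and q :: "'s \<times> 'd uprod"
      obtain t i j where q: "q = (t, Upair i j)" by (metis surj_pair uprod_exhaust)
      show "(mat_of_sym (orthcut_mats q) ** G) \<bullet> L G = 0"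
        using om_skew[of t "G $ (t, i)" "G $ (t, j)"] by (simp add: q orthcut_mult_inner L_def)
    qed
  qed
qed

lemma orthcut_rigid:
  assumes "F \<in> bm_feasible orthcut_mats orthcut_rhs"
  shows "regular_constraints.rigid orthcut_mats (F :: real^'d^('s::finite \<times> 'd::finite))"
proof -
  interpret regular_constraints "orthcut_mats :: 's \<times> 'd uprod \<Rightarrow> _" orthcut_rhs orthcut_weight
    by (rule orthcut_regular)
  show ?thesis
    unfolding rigid_def
  proof (intro allI impI)
    fix G :: "real^'d^'d"
    assume G: "transpose G = G"
      and z: "\<forall>q. mat_of_sym (orthcut_mats q) \<bullet> (F ** G ** transpose F) = 0"
    \<comment> \<open>One block suffices, and \<open>undefined\<close> names an arbitrary one. With
      \<open>d\<close> columns it is an orthogonal square matrix, so \<open>G\<close> can be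
      conjugated back.\<close>
    define Q :: "real^'d^'d" where "Q = (\<chi> i. F $ (undefined, i))"
    have "Q ** transpose Q = mat 1"
      using assms by (simp add: vec_eq_iff matrix_mult_transpose_entry Q_def mat_def orthcut_feasible_rows)
    then have Q: "transpose Q ** Q = mat 1" by (simp add: matrix_left_right_inverse)
    have sym: "(F ** G ** transpose F) $ k $ l = (F ** G ** transpose F) $ l $ k" for k l
      unfolding congruence_entry using inner_transpose_vec[of G "F $ k" "F $ l"] by (simp only: G inner_commute)
    have "(F ** G ** transpose F) $ (undefined, i) $ (undefined, j) = 0" for i j
      using z[rule_format, of "(undefined, Upair i j)"] sym by (simp add: orthcut_inner)
    then have "Q ** G ** transpose Q = 0"
      by (simp add: vec_eq_iff congruence_entry Q_def)
    then have "transpose Q ** (Q ** G ** transpose Q) ** Q = 0" by (simp add: mmult.zero_left mmult.zero_right)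
    moreover have "transpose Q ** (Q ** G ** transpose Q) ** Q = (transpose Q ** Q) ** G ** (transpose Q ** Q)"
      by (simp only: matrix_mul_assoc)
    ultimately show "G = 0" by (simp add: Q)
  qed
qed

lemma orthcut_failing:
  assumes "CARD('d::finite) \<in> {1, 2, 3}" "CARD('d) \<le> CARD('r::finite)"
    "CARD('r) * (CARD('r) + 1) div 2 + CARD('r) * CARD('d)
      \<le> CARD('s::finite) * CARD('d) * (CARD('d) + 1) div 2"
  shows "\<exists>W :: ('s \<times> 'd) symmat set. W \<in> sets lebesgue \<and> 0 < emeasure lebesgue W \<and>
    (\<forall>C\<in>W. unique_solution_of_rank CARD('d) C orthcut_mats orthcut_rhs \<and>
      simple_sdp C orthcut_mats orthcut_rhs \<and> bm_fails TYPE('r) C orthcut_mats orthcut_rhs)"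
proof -
  interpret regular_constraints "orthcut_mats :: 's \<times> 'd uprod \<Rightarrow> _" orthcut_rhs orthcut_weight
    by (rule orthcut_regular)
  obtain \<phi> :: "'s \<Rightarrow> 'd \<Rightarrow> real^'r" where
    unit: "\<And>s i j. \<phi> s i \<bullet> \<phi> s j = (if i = j then 1 else 0)"
    and inj: "\<And>(T :: real^'r^'r) (R :: real^'d^'r). transpose T = T \<Longrightarrow>
      (\<And>s i j. \<phi> s i \<bullet> (T *v \<phi> s j) + (transpose R *v \<phi> s i) $ j + (transpose R *v \<phi> s j) $ i = 0) \<Longrightarrow>
      T = 0 \<and> R = 0"
    using interpolating_frames[OF assms] by blast
  \<comment> \<open>Block \<open>s\<close> of \<open>F\<close> is frame \<open>s\<close>. Every
    block of \<open>U\<close> is the identity, so that the terms with \<open>R\<close> become the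
    plain entries of R^T applied to the frame vectors.\<close>
  define F :: "real^'r^('s \<times> 'd)" where "F = (\<chi> k. \<phi> (fst k) (snd k))"
  define U :: "real^'d^('s \<times> 'd)" where "U = (\<chi> k. axis (snd k) 1)"
  show ?thesis
  proof (rule failing_costs[OF orthcut_manifold orthcut_manifold])
    show "F \<in> bm_feasible orthcut_mats orthcut_rhs" by (simp add: orthcut_feasible_rows F_def unit)
    show "U \<in> bm_feasible orthcut_mats orthcut_rhs"
      by (simp add: orthcut_feasible_rows U_def inner_axis_axis)
    show "rigid G" if "G \<in> bm_feasible orthcut_mats orthcut_rhs" for G :: "real^'d^('s \<times> 'd)"
      using that by (rule orthcut_rigid)
    show "CARD('d) \<le> CARD('r)" by fact
    fix T :: "real^'r^'r" and R :: "real^'d^'r"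
    assume T: "transpose T = T" and z: "pair_map F U T R = 0"
    show "T = 0 \<and> R = 0"
    proof (rule inj[OF T])
      fix s i j
      let ?B = "F ** T ** transpose F + F ** R ** transpose U + U ** transpose R ** transpose F"
      have B: "?B $ (s, i) $ (s, j) = \<phi> s i \<bullet> (T *v \<phi> s j) + (transpose R *v \<phi> s i) $ j + (transpose R *v \<phi> s j) $ i" for i j
      proof -
        have "\<phi> s i \<bullet> (R *v axis j 1) = (transpose R *v \<phi> s i) $ j"
          using inner_transpose_vec[of R "\<phi> s i" "axis j 1"] by (simp add: inner_axis del: transpose_matrix_vector)
        then show ?thesis
          by (simp only: vector_add_component congruence_entry F_def U_def vec_lambda_beta fst_conv snd_conv)
            (simp add: inner_axis' del: transpose_matrix_vector)
      qed
      have "(T *v x) \<bullet> y = x \<bullet> (T *v y)" for x y using inner_transpose_vec[of T x y] T by simp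
      then have "\<phi> s i \<bullet> (T *v \<phi> s j) = \<phi> s j \<bullet> (T *v \<phi> s i)" by (metis inner_commute)
      moreover have "mat_of_sym (orthcut_mats (s, Upair i j)) \<bullet> ?B = 0"
        using z by (simp add: pair_map_def vec_eq_iff del: vector_add_component)
      ultimately show "\<phi> s i \<bullet> (T *v \<phi> s j) + (transpose R *v \<phi> s i) $ j + (transpose R *v \<phi> s j) $ i = 0"
        unfolding orthcut_inner B by simp
    qed
  qed
qed

text \<open>In the last part, \<open>CARD('d) \<le> CARD('r)\<close> expresses that the
  Burer--Monteiro problem has feasible points: a block needs \<open>d\<close> orthonormal rows of
  length \<open>r\<close>. In the other two parts the rank is 1 and this is automatic.\<close>

theorem theorem3:
  fixes S :: "'m::finite \<Rightarrow> 'D::finite set"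
  shows
    "(CARD('r::finite) * (CARD('r) + 1) div 2 + CARD('r) \<le> CARD('n::finite) \<longrightarrow>
       (\<exists>W :: 'n symmat set. W \<in> sets lebesgue \<and> 0 < emeasure lebesgue W \<and>
         (\<forall>C\<in>W. unique_solution_of_rank 1 C maxcut_mats maxcut_rhs \<and>
                simple_sdp C maxcut_mats maxcut_rhs \<and>
                bm_fails TYPE('r) C maxcut_mats maxcut_rhs))) \<and>
     ((\<forall>i. S i \<noteq> {}) \<and> disjoint_family S \<and> (\<Union>i. S i) = UNIV \<and>
      CARD('r) * (CARD('r) + 1) div 2 + CARD('r) \<le> CARD('m) \<longrightarrow>
       (\<exists>W :: 'D symmat set. W \<in> sets lebesgue \<and> 0 < emeasure lebesgue W \<and>
         (\<forall>C\<in>W. unique_solution_of_rank 1 C (product_mats S) product_rhs \<and>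
                simple_sdp C (product_mats S) product_rhs \<and>
                bm_fails TYPE('r) C (product_mats S) product_rhs))) \<and>
     (CARD('d::finite) \<in> {1, 2, 3} \<and> CARD('d) \<le> CARD('r) \<and>
      CARD('r) * (CARD('r) + 1) div 2 + CARD('r) * CARD('d)
        \<le> CARD('s::finite) * CARD('d) * (CARD('d) + 1) div 2 \<longrightarrow>
       (\<exists>W :: ('s \<times> 'd) symmat set. W \<in> sets lebesgue \<and> 0 < emeasure lebesgue W \<and>
         (\<forall>C\<in>W. unique_solution_of_rank CARD('d) C orthcut_mats orthcut_rhs \<and>
                simple_sdp C orthcut_mats orthcut_rhs \<and>
                bm_fails TYPE('r) C orthcut_mats orthcut_rhs)))"
proof -
  \<comment> \<open>MaxCut is ProductSDP for the partition into singletons.\<close>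
  have maxcut: "maxcut_mats = product_mats (\<lambda>i :: 'n. {i})" "maxcut_rhs = (product_rhs :: real^'n)"
    by (auto simp: fun_eq_iff maxcut_mats_def product_mats_def maxcut_rhs_def product_rhs_def
        intro!: arg_cong[of _ _ Symmat] simp: vec_eq_iff)
  show ?thesis
    unfolding maxcut
    by (intro conjI impI; (rule product_failing | rule orthcut_failing); auto simp: disjoint_family_on_def)
qed

end
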